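(* Let $K$ be an ordinary differential field (one derivation $\delta$) of characteristic zero whose field of constants $K^\delta$ is algebraically closed, and let $L|K$ be a finitely differentially generated extension of differential fields with no new constants, i.e. $L^\delta=K^\delta$. Then $L|K$ is a Picard-Vessiot extension if and only if for every differential $L$-algebra $M$ and every differential embedding $\tau\colon L\to M$ over $K$ we have $\tau(L)\subset LM^\delta$.
   Context: All rings are commutative. A differential field (ring) is a field (ring) with a derivation $\delta$; for a differential ring $R$, $R^\delta=\{r\in R\mid \delta(r)=0\}$ denotes its constants. A differential $L$-algebra $M$ is an $L$-algebra with a derivation $\delta$ such that the structure morphism $L\to M$ commutes with the derivations; $L$ is identified with its image in $M$, and $M$ is viewed as a $K$-algebra via $K\subset L\to M$. A differential embedding $\tau\colon L\to M$ over $K$ is an injective ring morphism commuting with $\delta$ that is $K$-linear. $L|K$ is finitely differentially generated if there is a finite subset of $L$ such that $L$ is the smallest differential subfield of $L$ containing $K$ and this subset. If $S,T$ are subrings of a ring $R$, then $S\cdot T=\{\sum_i s_it_i\mid s_i\in S,\ t_i\in T\}$ (finite sums) is the smallest subring of $R$ containing $S$ and $T$, and $ST=\{\frac{r}{r'}\mid r,r'\in S\cdot T,\ r'\in R^\times\}\subset R$ is the smallest subring of $R$ containing $S$ and $T$ and closed under taking inverses (of elements that are units in $R$). Thus $LM^\delta$ is formed in this sense inside $M$ from the image of $L$ and $M^\delta$. $L|K$ is a Picard-Vessiot extension if $L^\delta=K^\delta$ and there exist $n\ge 1$, a matrix $A\in K^{n\times n}$ and $Y\in \mathrm{GL}_n(L)$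 such that $\delta(Y)=AY$ and $L=K(Y)$, i.e. $L$ is generated as a field over $K$ by the entries of $Y$. *)

theory Defs
  imports "HOL-Algebra.Algebra"
begin

record 'a diff_ring = "'a ring" +
  der :: "'a \<Rightarrow> 'a" ("\<delta>\<index>")

locale differential_ring = cring R for R :: "('a, 'b) diff_ring_scheme" (structure) +
  assumes der_closed: "x \<in> carrier R \<Longrightarrow> \<delta> x \<in> carrier R"
    and der_add: "\<lbrakk>x \<in> carrier R; y \<in> carrier R\<rbrakk> \<Longrightarrow> \<delta> (x \<oplus> y) = \<delta> x \<oplus> \<delta> y"
    and der_mult: "\<lbrakk>x \<in> carrier R; y \<in> carrier R\<rbrakk> \<Longrightarrow> \<delta> (x \<otimes> y) = \<delta> x \<otimes> y \<oplus> x \<otimes> \<delta> y"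

locale differential_field = differential_ring R + field R
  for R :: "('a, 'b) diff_ring_scheme" (structure)

definition constants :: "('a, 'b) diff_ring_scheme \<Rightarrow> 'a set" where
  "constants R = {x \<in> carrier R. \<delta>\<^bsub>R\<^esub> x = \<zero>\<^bsub>R\<^esub>}"

definition char_zero :: "('a, 'b) ring_scheme \<Rightarrow> bool" where
  "char_zero R \<longleftrightarrow> (\<forall>n::nat. 0 < n \<longrightarrow> [n] \<cdot>\<^bsub>R\<^esub> \<one>\<^bsub>R\<^esub> \<noteq> \<zero>\<^bsub>R\<^esub>)"

text \<open>An extension of differential fields is a differential field \<open>L\<close> together with a
  differential subfield \<open>K\<close>, given as a subset of the carrier. As a structure of its own, \<open>K\<close> is
  \<open>L\<lparr>carrier := K\<rparr>\<close>.\<close>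

definition differential_subfield :: "'a set \<Rightarrow> ('a, 'b) diff_ring_scheme \<Rightarrow> bool" where
  "differential_subfield K L \<longleftrightarrow> subfield K L \<and> (\<forall>x\<in>K. \<delta>\<^bsub>L\<^esub> x \<in> K)"

definition generate_diff_field :: "('a, 'b) diff_ring_scheme \<Rightarrow> 'a set \<Rightarrow> 'a set" where
  "generate_diff_field L S = \<Inter> {F. differential_subfield F L \<and> S \<subseteq> F}"

definition finitely_diff_generated :: "('a, 'b) diff_ring_scheme \<Rightarrow> 'a set \<Rightarrow> bool" where
  "finitely_diff_generated L K \<longleftrightarrow>
     (\<exists>S. finite S \<and> S \<subseteq> carrier L \<and> generate_diff_field L (K \<union> S) = carrier L)"

definition differential_hom ::
    "('a, 'c) diff_ring_scheme \<Rightarrow> ('b, 'd) diff_ring_scheme \<Rightarrow> ('a \<Rightarrow> 'b) set" where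
  "differential_hom R S =
     {h \<in> ring_hom R S. \<forall>x\<in>carrier R. h (\<delta>\<^bsub>R\<^esub> x) = \<delta>\<^bsub>S\<^esub> (h x)}"

text \<open>A differential algebra is given by its structure morphism \<open>\<phi>\<close>; the zero ring is allowed.\<close>

definition differential_algebra ::
    "('a, 'c) diff_ring_scheme \<Rightarrow> ('b, 'd) diff_ring_scheme \<Rightarrow> ('a \<Rightarrow> 'b) \<Rightarrow> bool" where
  "differential_algebra L M \<phi> \<longleftrightarrow>
     differential_ring L \<and> differential_ring M \<and> \<phi> \<in> differential_hom L M"

definition differential_embedding_over ::
    "'a set \<Rightarrow> ('a, 'c) diff_ring_scheme \<Rightarrow> ('b, 'd) diff_ring_scheme \<Rightarrow> ('a \<Rightarrow> 'b) \<Rightarrow>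
     ('a \<Rightarrow> 'b) \<Rightarrow> bool" where
  "differential_embedding_over K L M \<phi> \<tau> \<longleftrightarrow>
     \<tau> \<in> differential_hom L M \<and> inj_on \<tau> (carrier L) \<and>
     (\<forall>k\<in>K. \<forall>x\<in>carrier L. \<tau> (k \<otimes>\<^bsub>L\<^esub> x) = \<phi> k \<otimes>\<^bsub>M\<^esub> \<tau> x)"

text \<open>For subrings \<open>S\<close> and \<open>T\<close> of \<open>R\<close>, \<open>sum_prod R S T\<close> is \<open>S \<cdot> T\<close> and \<open>compositum R S T\<close> is
  \<open>ST\<close>, in which the elements of \<open>S \<cdot> T\<close> that are units of \<open>R\<close> are inverted.\<close>

definition sum_prod :: "('a, 'b) ring_scheme \<Rightarrow> 'a set \<Rightarrow> 'a set \<Rightarrow> 'a set" where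
  "sum_prod R S T =
     {\<Oplus>\<^bsub>R\<^esub>i\<in>{..<n}. s i \<otimes>\<^bsub>R\<^esub> t i | (n::nat) s t. s \<in> {..<n} \<rightarrow> S \<and> t \<in> {..<n} \<rightarrow> T}"

definition compositum :: "('a, 'b) ring_scheme \<Rightarrow> 'a set \<Rightarrow> 'a set \<Rightarrow> 'a set" where
  "compositum R S T =
     {r \<otimes>\<^bsub>R\<^esub> inv\<^bsub>R\<^esub> r' | r r'. r \<in> sum_prod R S T \<and> r' \<in> sum_prod R S T \<and> r' \<in> Units R}"

text \<open>An \<open>n \<times> n\<close> matrix over \<open>R\<close> is a function on indices of which only the values at
  \<open>i, j < n\<close> matter.\<close>

definition mat_entries_in :: "nat \<Rightarrow> 'a set \<Rightarrow> (nat \<Rightarrow> nat \<Rightarrow> 'a) \<Rightarrow> bool" where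
  "mat_entries_in n S A \<longleftrightarrow> (\<forall>i<n. \<forall>j<n. A i j \<in> S)"

definition mat_prod ::
    "('a, 'b) ring_scheme \<Rightarrow> nat \<Rightarrow> (nat \<Rightarrow> nat \<Rightarrow> 'a) \<Rightarrow> (nat \<Rightarrow> nat \<Rightarrow> 'a) \<Rightarrow> nat \<Rightarrow> nat \<Rightarrow> 'a" where
  "mat_prod R n A B i j = (\<Oplus>\<^bsub>R\<^esub>k\<in>{..<n}. A i k \<otimes>\<^bsub>R\<^esub> B k j)"

definition mat_one :: "('a, 'b) ring_scheme \<Rightarrow> nat \<Rightarrow> nat \<Rightarrow> 'a" where
  "mat_one R i j = (if i = j then \<one>\<^bsub>R\<^esub> else \<zero>\<^bsub>R\<^esub>)"

definition mat_eq :: "nat \<Rightarrow> (nat \<Rightarrow> nat \<Rightarrow> 'a) \<Rightarrow> (nat \<Rightarrow> nat \<Rightarrow> 'a) \<Rightarrow> bool" where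
  "mat_eq n A B \<longleftrightarrow> (\<forall>i<n. \<forall>j<n. A i j = B i j)"

definition GL :: "nat \<Rightarrow> ('a, 'b) ring_scheme \<Rightarrow> (nat \<Rightarrow> nat \<Rightarrow> 'a) set" where
  "GL n R = {Y. mat_entries_in n (carrier R) Y \<and>
     (\<exists>Z. mat_entries_in n (carrier R) Z \<and>
        mat_eq n (mat_prod R n Y Z) (mat_one R) \<and> mat_eq n (mat_prod R n Z Y) (mat_one R))}"

definition picard_vessiot :: "('a, 'b) diff_ring_scheme \<Rightarrow> 'a set \<Rightarrow> bool" where
  "picard_vessiot L K \<longleftrightarrow>
     constants L = constants (L\<lparr>carrier := K\<rparr>) \<and>
     (\<exists>n\<ge>1. \<exists>A Y. mat_entries_in n K A \<and> Y \<in> GL n L \<and>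
        mat_eq n (\<lambda>i j. \<delta>\<^bsub>L\<^esub> (Y i j)) (mat_prod L n A Y) \<and>
        generate_field L (K \<union> {Y i j | i j. i < n \<and> j < n}) = carrier L)"

text \<open>HOL cannot quantify over types inside a formula, so "every differential \<open>L\<close>-algebra \<open>M\<close>" is
  stated as: every \<open>M\<close> whose carrier is a subset of a type \<open>'m\<close>, for an arbitrary type \<open>'m\<close> into
  which the carrier of \<open>L\<close> injects. This loses no algebra: an embedding
  \<open>\<tau> : L \<rightarrow> M\<close> is itself such an injection. Conversely, if \<open>\<tau>(a) \<notin> L M\<^sup>\<delta>\<close> for some \<open>M\<close>, the same
  holds in the differential subring of \<open>M\<close> generated by the images of \<open>L\<close> under the structure
  morphism and \<open>\<tau>\<close>, whose cardinality is that of the infinite field \<open>L\<close>; so already the smallest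
  such \<open>'m\<close> detects every counterexample.\<close>

end

theory Submission
  imports Defs
begin

text \<open>If \<open>L|K\<close> is Picard-Vessiot with fundamental matrix \<open>Y\<close>, then \<open>\<phi>(Y)\<close> and \<open>\<tau>(Y)\<close> solve the same
  equation and so differ by a matrix of constants. For the converse take the universal case
  \<open>M = L \<otimes>\<^sub>K L\<close> with \<open>\<phi>(x) = 1 \<otimes> x\<close> and \<open>\<tau>(x) = x \<otimes> 1\<close>. A \<open>K\<close>-linear form \<open>g\<close> on \<open>L\<close>, applied to the
  right factor, maps \<open>M\<close> to \<open>L\<close>; the values of a constant \<open>c\<close> under all \<open>g\<close> form a finite-dimensional
  \<open>\<delta>\<close>-stable \<open>K\<close>-subspace. Applying \<open>g\<close> to \<open>\<tau>(a) r' = r\<close> with \<open>r, r' \<in> \<phi>(L) \<cdot> M\<^sup>\<delta>\<close> therefore shows that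
  \<open>L\<close> is generated as a field by one such subspace, with basis \<open>y\<close> and \<open>y' = A y\<close>.
  Those \<open>q \<in> \<phi>(L) \<cdot> M\<^sup>\<delta>\<close> for which \<open>q \<cdot> \<tau>(y)\<close> has entries in \<open>\<phi>(L) \<cdot> M\<^sup>\<delta>\<close> form a differential
  \<open>L\<close>-submodule; it is spanned by constants \<open>d\<close> and contains a unit. The coefficients of
  \<open>d \<cdot> \<tau>(y)\<close> with respect to independent constants are solutions of \<open>v' = A v\<close> in \<open>L\<^sup>n\<close>. A linear form
  killing all solutions in \<open>L\<^sup>n\<close> kills every \<open>d \<cdot> \<tau>(y)\<close>, hence \<open>\<tau>(y)\<close>, and is zero because the entries
  of \<open>y\<close> are independent over \<open>K\<close>. So the solutions span \<open>L\<^sup>n\<close>.\<close>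

text \<open>The tensor square need not be a domain, so neither cancellation nor independence of
  constants over L comes for free. Denominators are therefore kept as products of units, and
  dependent constants are eliminated one at a time instead of being excluded beforehand. Linear
  forms take the place of a K-basis of L: they separate tensors, turn identities in M into
  identities in L, and carry a derivation of their own, the commutator with \<delta>. The vector y
  is a single solution in L^n. The remaining columns of a fundamental matrix are not visible among
  the generators of L; they appear only as coefficients in M. That there are enough of them is shown
  dually, through the linear forms that kill them, which avoids Wronskians and any count of
  dimensions of solution spaces. The condition on M refers to one fixed type \<open>'m\<close>, so
  the tensor square has to be built inside that type. This is why tensors are finite lists of pairs:
  L is infinite, so these lists inject into every type into which L injects.\<close>

section \<open>Lists over an infinite set\<close>

lemma infinite_lists_inject:
  assumes "infinite A"
  shows "\<exists>f :: 'a list \<Rightarrow> 'a. inj_on f (lists A) \<and> f \<in> lists A \<rightarrow> A"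
proof -
  have "|A \<times> A| =o |A|"
    using card_of_Times_same_infinite[OF assms] .
  then obtain p where "bij_betw p (A \<times> A) A"
    using card_of_ordIso[of "A \<times> A" A] by blast
  then have p: "inj_on p (A \<times> A)" and pA: "\<And>x y. x \<in> A \<Longrightarrow> y \<in> A \<Longrightarrow> p (x, y) \<in> A"
    by (auto simp: bij_betw_def)
  obtain e :: "nat \<Rightarrow> 'a" where e: "inj e" "range e \<subseteq> A"
    using assms infinite_countable_subset by blast
  define enc where "enc = (\<lambda>xs. foldr (\<lambda>x a. p (x, a)) xs (e 0))"
  have encA: "enc xs \<in> A" if "xs \<in> lists A" for xs
    using that by (induction xs) (use e pA in \<open>auto simp: enc_def\<close>)
  have enc_inj: "xs = ys"
    if "xs \<in> lists A" "ys \<in> lists A" "length xs = length ys" "enc xs = enc ys" for xs ys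
    using that(3,1,2,4)
  proof (induction xs ys rule: list_induct2)
    case (Cons x xs y ys)
    then have "p (x, enc xs) = p (y, enc ys)" by (simp add: enc_def)
    moreover have "(x, enc xs) \<in> A \<times> A" "(y, enc ys) \<in> A \<times> A"
      using Cons encA[of xs] encA[of ys] by auto
    ultimately have "(x, enc xs) = (y, enc ys)" using p by (meson inj_onD)
    with Cons show ?case by auto
  qed simp
  \<comment> \<open>The fold \<open>enc\<close> is injective only among lists of one length, so the
    length is stored beside it, embedded into A by \<open>e\<close>.\<close>
  let ?f = "\<lambda>xs. p (e (length xs), enc xs)"
  have "inj_on ?f (lists A)"
  proof (rule inj_onI)
    fix xs ys assume xy: "xs \<in> lists A" "ys \<in> lists A" "?f xs = ?f ys"
    then have "(e (length xs), enc xs) = (e (length ys), enc ys)"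
      using p encA e by (meson inj_onD SigmaI rangeI subsetD)
    then show "xs = ys" using xy enc_inj e by (auto dest: injD)
  qed
  moreover have "?f \<in> lists A \<rightarrow> A" using encA e pA by blast
  ultimately show ?thesis by blast
qed

text \<open>Provides the room in \<open>'m\<close> for the formal sums of which the tensor square is
  a quotient.\<close>

lemma infinite_pair_lists_inject:
  fixes A :: "'a set" and \<iota> :: "'a \<Rightarrow> 'm"
  assumes "infinite A" and "inj_on \<iota> A"
  shows "\<exists>f :: ('a \<times> 'a) list \<Rightarrow> 'm. inj_on f (lists (A \<times> A))"
proof -
  have "|A \<times> A| =o |A|"
    using card_of_Times_same_infinite[OF assms(1)] .
  then obtain p where "bij_betw p (A \<times> A) A"
    using card_of_ordIso[of "A \<times> A" A] by blast
  then have p: "inj_on p (A \<times> A)" "p ` (A \<times> A) = A" by (auto simp: bij_betw_def)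
  obtain f :: "'a list \<Rightarrow> 'a" where f: "inj_on f (lists A)" "f \<in> lists A \<rightarrow> A"
    using infinite_lists_inject[OF assms(1)] by blast
  have m: "map p ` lists (A \<times> A) = lists A"
    using p(2) by (metis lists_image)
  have "inj_on (\<iota> \<circ> f \<circ> map p) (lists (A \<times> A))"
  proof (intro comp_inj_on)
    show "inj_on (map p) (lists (A \<times> A))" using p(1) by (rule inj_on_map_lists)
    show "inj_on f (map p ` lists (A \<times> A))" using f m by simp
    show "inj_on \<iota> (f ` map p ` lists (A \<times> A))"
      using m f(2) assms(2) by (auto intro: inj_on_subset)
  qed
  then show ?thesis by blast
qed

section \<open>Rules for derivations\<close>

lemma (in ring) add_minus_add_cancel:
  assumes "x \<in> carrier R" "y \<in> carrier R" "z \<in> carrier R"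
  shows "(z \<oplus> x) \<ominus> (z \<oplus> y) = x \<ominus> y"
proof -
  have "(z \<oplus> x) \<ominus> (z \<oplus> y) = (x \<oplus> z) \<oplus> (\<ominus> z \<oplus> \<ominus> y)"
    using assms by (simp add: a_minus_def minus_add a_comm)
  also have "\<dots> = x \<ominus> y"
    using assms by (simp add: a_minus_def a_assoc r_neg2)
  finally show ?thesis .
qed

context differential_ring
begin

lemma der_zero [simp]: "\<delta> \<zero> = \<zero>"
proof -
  have "\<delta> \<zero> \<oplus> \<delta> \<zero> = \<delta> \<zero> \<oplus> \<zero>"
    using der_add[of \<zero> \<zero>] der_closed[of \<zero>] by simp
  then show ?thesis using der_closed[of \<zero>] by (metis add.l_cancel zero_closed)
qed

lemma der_one [simp]: "\<delta> \<one> = \<zero>"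
proof -
  have "\<delta> \<one> \<oplus> \<delta> \<one> = \<delta> \<one> \<oplus> \<zero>"
    using der_mult[of \<one> \<one>] der_closed[of \<one>] by simp
  then show ?thesis using der_closed[of \<one>] by (metis add.l_cancel zero_closed one_closed)
qed

lemma der_minus: "x \<in> carrier R \<Longrightarrow> \<delta> (\<ominus> x) = \<ominus> \<delta> x"
  by (metis add.inv_closed der_add der_closed der_zero minus_equality r_neg add.m_comm)

lemma der_finsum:
  "f \<in> A \<rightarrow> carrier R \<Longrightarrow> \<delta> (\<Oplus>i\<in>A. f i) = (\<Oplus>i\<in>A. \<delta> (f i))"
  by (induction A rule: infinite_finite_induct)
    (auto simp: der_add der_closed Pi_iff finsum_closed)

lemma der_inv:
  assumes "x \<in> Units R"
  shows "\<delta> (inv x) = \<ominus> (inv x \<otimes> inv x \<otimes> \<delta> x)"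
proof -
  note [simp] = der_closed
  have c [simp]: "x \<in> carrier R" "inv x \<in> carrier R" and xi: "x \<otimes> inv x = \<one>"
    using assms by auto
  have "\<delta> x \<otimes> inv x \<oplus> x \<otimes> \<delta> (inv x) = \<zero>"
    using der_mult[of x "inv x"] xi by simp
  then have "inv x \<otimes> (\<delta> x \<otimes> inv x) \<oplus> inv x \<otimes> (x \<otimes> \<delta> (inv x)) = \<zero>"
    by (metis c der_closed m_closed r_distr r_null)
  moreover have "inv x \<otimes> (x \<otimes> \<delta> (inv x)) = \<delta> (inv x)"
    using xi by (metis c der_closed m_assoc m_comm l_one)
  moreover have "inv x \<otimes> (\<delta> x \<otimes> inv x) = inv x \<otimes> inv x \<otimes> \<delta> x"
    by (simp add: m_ac)
  ultimately show ?thesis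
    by (metis c der_closed m_closed minus_equality add.m_comm)
qed

end

section \<open>Sums of products from two subsets of a ring\<close>

text \<open>Induction on the number of summands. It hides the indexing: a property stable under
  addition has to be checked on single products only.\<close>

lemma (in cring) sum_prod_induct [consumes 3, case_names zero add mult]:
  assumes "x \<in> sum_prod R S T" "S \<subseteq> carrier R" "T \<subseteq> carrier R"
    and "P \<zero>"
    and "\<And>x y. x \<in> carrier R \<Longrightarrow> y \<in> carrier R \<Longrightarrow> P x \<Longrightarrow> P y \<Longrightarrow> P (x \<oplus> y)"
    and "\<And>s t. s \<in> S \<Longrightarrow> t \<in> T \<Longrightarrow> P (s \<otimes> t)"
  shows "P x"
proof -
  obtain n :: nat and s t where st: "s \<in> {..<n} \<rightarrow> S" "t \<in> {..<n} \<rightarrow> T"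
    and x: "x = (\<Oplus>i\<in>{..<n}. s i \<otimes> t i)"
    using assms(1) by (auto simp: sum_prod_def)
  have "P (\<Oplus>i\<in>{..<m}. s i \<otimes> t i)" if "m \<le> n" for m
    using that
  proof (induction m)
    case (Suc m)
    have c: "\<And>i. i < n \<Longrightarrow> s i \<otimes> t i \<in> carrier R" using st assms(2,3) by blast
    have "(\<Oplus>i\<in>{..<Suc m}. s i \<otimes> t i) = s m \<otimes> t m \<oplus> (\<Oplus>i\<in>{..<m}. s i \<otimes> t i)"
      using c Suc by (subst lessThan_Suc, subst finsum_insert) auto
    moreover have "(\<Oplus>i\<in>{..<m}. s i \<otimes> t i) \<in> carrier R" using c Suc by (auto intro!: finsum_closed)
    ultimately show ?case using Suc st assms(5,6) c by (auto simp: Pi_iff)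
  qed (use assms in auto)
  then show ?thesis using x by auto
qed

lemma (in cring) sum_prod_closed:
  "S \<subseteq> carrier R \<Longrightarrow> T \<subseteq> carrier R \<Longrightarrow> sum_prod R S T \<subseteq> carrier R"
  unfolding sum_prod_def by (fastforce intro!: finsum_closed)

lemma (in cring) sum_prod_zero: "\<zero> \<in> sum_prod R S T"
  unfolding sum_prod_def by (intro CollectI exI[of _ 0]) auto

lemma (in cring) sum_prod_single:
  assumes "S \<subseteq> carrier R" "T \<subseteq> carrier R" "s \<in> S" "t \<in> T"
  shows "s \<otimes> t \<in> sum_prod R S T"
  unfolding sum_prod_def
  by (intro CollectI exI[of _ "1::nat"] exI[of _ "\<lambda>_. s"] exI[of _ "\<lambda>_. t"])
    (use assms in \<open>auto simp: lessThan_Suc subset_iff\<close>)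

lemma (in cring) sum_prod_add:
  assumes "S \<subseteq> carrier R" "T \<subseteq> carrier R" "x \<in> sum_prod R S T" "y \<in> sum_prod R S T"
  shows "x \<oplus> y \<in> sum_prod R S T"
proof -
  obtain n :: nat and s t where st: "s \<in> {..<n} \<rightarrow> S" "t \<in> {..<n} \<rightarrow> T"
    and x: "x = (\<Oplus>i\<in>{..<n}. s i \<otimes> t i)"
    using assms(3) by (auto simp: sum_prod_def)
  obtain m :: nat and s' t' where st': "s' \<in> {..<m} \<rightarrow> S" "t' \<in> {..<m} \<rightarrow> T"
    and y: "y = (\<Oplus>i\<in>{..<m}. s' i \<otimes> t' i)"
    using assms(4) by (auto simp: sum_prod_def)
  \<comment> \<open>The two index ranges are laid end to end, the second one shifted by n.\<close>
  define u where "u i = (if i < n then s i else s' (i - n))" for i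
  define v where "v i = (if i < n then t i else t' (i - n))" for i
  have uv: "u \<in> {..<n + m} \<rightarrow> S" "v \<in> {..<n + m} \<rightarrow> T"
    using st st' by (auto simp: u_def v_def Pi_iff)
  have c: "\<And>i. i < n + m \<Longrightarrow> u i \<otimes> v i \<in> carrier R" using uv assms(1,2) by blast
  have "{..<n + m} = {..<n} \<union> {n..<n + m}" by auto
  then have "(\<Oplus>i\<in>{..<n + m}. u i \<otimes> v i)
      = (\<Oplus>i\<in>{..<n}. u i \<otimes> v i) \<oplus> (\<Oplus>i\<in>{n..<n + m}. u i \<otimes> v i)"
    using c by (simp, subst finsum_Un_disjoint) auto
  also have "(\<Oplus>i\<in>{..<n}. u i \<otimes> v i) = x"
    unfolding x using st assms(1,2) by (intro finsum_cong') (auto simp: u_def v_def subset_eq Pi_iff)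
  also have "(\<Oplus>i\<in>{n..<n + m}. u i \<otimes> v i) = (\<Oplus>i\<in>(\<lambda>i. i + n) ` {..<m}. u i \<otimes> v i)"
    by (simp add: lessThan_atLeast0 add.commute)
  also have "\<dots> = (\<Oplus>i\<in>{..<m}. u (i + n) \<otimes> v (i + n))"
    by (rule add.finprod_reindex) (use c in auto)
  also have "\<dots> = y"
    unfolding y by (simp add: u_def v_def)
  finally show ?thesis
    using uv unfolding sum_prod_def
    by (intro CollectI exI[of _ "n + m"] exI[of _ u] exI[of _ v]) auto
qed

lemma (in cring) sum_prod_finsum:
  assumes "S \<subseteq> carrier R" "T \<subseteq> carrier R" "\<And>i. i \<in> I \<Longrightarrow> f i \<in> sum_prod R S T"
  shows "(\<Oplus>i\<in>I. f i) \<in> sum_prod R S T"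
  using assms(3)
proof (induction I rule: infinite_finite_induct)
  case (insert i I)
  then show ?case using sum_prod_closed[OF assms(1,2)]
    by (subst finsum_insert) (auto intro!: sum_prod_add assms(1,2))
qed (auto simp: sum_prod_zero)

lemma (in cring) sum_prod_mult:
  assumes S: "subring S R" and T: "subring T R"
    and "x \<in> sum_prod R S T" "y \<in> sum_prod R S T"
  shows "x \<otimes> y \<in> sum_prod R S T"
proof -
  have c: "S \<subseteq> carrier R" "T \<subseteq> carrier R" using S T by (auto dest: subringE(1))
  note c' = c[THEN subsetD] sum_prod_closed[OF c, THEN subsetD]
  from assms(3) c show ?thesis
  proof (induction rule: sum_prod_induct)
    case (mult s t)
    from assms(4) c show ?case
    proof (induction rule: sum_prod_induct)
      case (mult s' t')
      have "s \<otimes> t \<otimes> (s' \<otimes> t') = (s \<otimes> s') \<otimes> (t \<otimes> t')"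
        using \<open>s \<in> S\<close> \<open>t \<in> T\<close> mult c' by (simp add: m_ac)
      then show ?case
        using mult \<open>s \<in> S\<close> \<open>t \<in> T\<close> sum_prod_single[OF c] subringE(6)[OF S] subringE(6)[OF T] by simp
    qed (use mult c' in \<open>auto simp: r_distr sum_prod_zero intro: sum_prod_add[OF c]\<close>)
  qed (use assms(4) c' in \<open>auto simp: l_distr sum_prod_zero intro: sum_prod_add[OF c]\<close>)
qed

lemma (in cring) sum_prod_left_incl:
  assumes "S \<subseteq> carrier R" "subring T R" "s \<in> S"
  shows "s \<in> sum_prod R S T"
  using sum_prod_single[OF assms(1) subringE(1)[OF assms(2)] assms(3) subringE(3)[OF assms(2)]] assms
  by auto

lemma (in cring) sum_prod_right_incl:
  assumes "subring S R" "T \<subseteq> carrier R" "t \<in> T"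
  shows "t \<in> sum_prod R S T"
  using sum_prod_single[OF subringE(1)[OF assms(1)] assms(2) subringE(3)[OF assms(1)] assms(3)] assms
  by auto

lemma (in differential_ring) constants_subring: "subring (constants R) R"
  by (rule subringI)
    (auto simp: constants_def der_minus der_add der_mult)

lemma (in differential_ring) constants_closed: "constants R \<subseteq> carrier R"
  by (auto simp: constants_def)

subsection \<open>Linear forms on a field extension\<close>

locale differential_extension = differential_field L
  for L :: "'l diff_ring" (structure) +
  fixes K :: "'l set"
  assumes K: "differential_subfield K L"
begin

lemma subfield_K: "subfield K L" and der_K: "k \<in> K \<Longrightarrow> \<delta> k \<in> K"
  using K by (auto simp: differential_subfield_def)

lemmas K_closed = subringE[OF subfieldE(1)[OF subfield_K]]

lemma K_carrier: "k \<in> K \<Longrightarrow> k \<in> carrier L"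
  using K_closed(1) by blast

text \<open>The dual of L over K. Nothing is prescribed outside the carrier, so forms can be written
  as plain lambda terms without restriction.\<close>

definition forms :: "('l \<Rightarrow> 'l) set" where
  "forms = {g \<in> carrier L \<rightarrow> K.
     (\<forall>x\<in>carrier L. \<forall>y\<in>carrier L. g (x \<oplus> y) = g x \<oplus> g y) \<and>
     (\<forall>k\<in>K. \<forall>x\<in>carrier L. g (k \<otimes> x) = k \<otimes> g x)}"

lemma formsD:
  assumes "g \<in> forms"
  shows "x \<in> carrier L \<Longrightarrow> g x \<in> K"
    and "x \<in> carrier L \<Longrightarrow> g x \<in> carrier L"
    and "x \<in> carrier L \<Longrightarrow> y \<in> carrier L \<Longrightarrow> g (x \<oplus> y) = g x \<oplus> g y"
    and "k \<in> K \<Longrightarrow> x \<in> carrier L \<Longrightarrow> g (k \<otimes> x) = k \<otimes> g x"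
  using assms K_carrier by (auto simp: forms_def)

text \<open>The dual is an L-module. Multiplication of the right tensor factor by a corresponds to
  this action on forms.\<close>

lemma forms_translate:
  assumes "g \<in> forms" "a \<in> carrier L"
  shows "(\<lambda>x. g (a \<otimes> x)) \<in> forms"
  using assms unfolding forms_def
  by (auto simp: r_distr K_carrier m_lcomm)

text \<open>Neither the composite of \<delta> after g nor that of g after \<delta> is K-linear, but
  both produce the same extra term \<open>\<delta> k \<otimes> g x\<close>, which cancels in the
  difference.\<close>

lemma forms_der:
  assumes "g \<in> forms"
  shows "(\<lambda>x. \<delta> (g x) \<ominus> g (\<delta> x)) \<in> forms"
proof -
  note g = formsD[OF assms]
  show ?thesis unfolding forms_def
  proof (intro CollectI conjI ballI funcsetI)
    fix x assume x: "x \<in> carrier L"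
    then show "\<delta> (g x) \<ominus> g (\<delta> x) \<in> K"
      by (simp add: g der_K der_closed K_closed a_minus_def)
  next
    fix x y assume x: "x \<in> carrier L" "y \<in> carrier L"
    then show "\<delta> (g (x \<oplus> y)) \<ominus> g (\<delta> (x \<oplus> y))
        = \<delta> (g x) \<ominus> g (\<delta> x) \<oplus> (\<delta> (g y) \<ominus> g (\<delta> y))"
      by (simp add: g der_add der_closed a_minus_def minus_add a_ac)
  next
    fix k x assume k: "k \<in> K" and x: "x \<in> carrier L"
    have kc: "k \<in> carrier L" using k by (rule K_carrier)
    have "\<delta> (g (k \<otimes> x)) = \<delta> k \<otimes> g x \<oplus> k \<otimes> \<delta> (g x)"
      using x k kc by (simp add: g der_mult)
    moreover have "g (\<delta> (k \<otimes> x)) = \<delta> k \<otimes> g x \<oplus> k \<otimes> g (\<delta> x)"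
      using x k kc by (simp add: g der_mult der_K der_closed)
    ultimately show "\<delta> (g (k \<otimes> x)) \<ominus> g (\<delta> (k \<otimes> x)) = k \<otimes> (\<delta> (g x) \<ominus> g (\<delta> x))"
      using x kc g der_closed[OF kc] der_closed[OF x] der_closed[OF g(2)[OF x]]
      by (simp add: add_minus_add_cancel) (simp add: a_minus_def r_distr r_minus)
  qed
qed

lemma forms_add:
  assumes "g \<in> forms" "h \<in> forms"
  shows "(\<lambda>x. g x \<oplus> h x) \<in> forms"
  using assms unfolding forms_def
  by (auto simp: K_closed K_carrier r_distr a_ac Pi_iff)

lemma forms_smult:
  assumes "g \<in> forms" "k \<in> K"
  shows "(\<lambda>x. k \<otimes> g x) \<in> forms"
  using assms unfolding forms_def
  by (auto simp: K_closed K_carrier r_distr m_lcomm Pi_iff)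

text \<open>A complement of \<open>K\<close> in \<open>L\<close> is a maximal \<open>K\<close>-subspace avoiding \<open>1\<close>.\<close>

lemma exists_form: "\<exists>g\<in>forms. g \<one> = \<one>"
proof -
  define subsp where "subsp U \<longleftrightarrow> U \<subseteq> carrier L \<and> \<zero> \<in> U \<and> (\<forall>x\<in>U. \<forall>y\<in>U. x \<oplus> y \<in> U)
     \<and> (\<forall>k\<in>K. \<forall>x\<in>U. k \<otimes> x \<in> U)" for U
  define S where "S = {U. subsp U \<and> \<one> \<notin> U}"
  have "\<exists>M\<in>S. \<forall>Z\<in>S. M \<subseteq> Z \<longrightarrow> Z = M"
  proof (rule subset_Zorn_nonempty)
    show "S \<noteq> {}"
      using one_not_zero K_carrier by (auto simp: S_def subsp_def intro!: exI[of _ "{\<zero>}"])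
  next
    fix C assume C: "C \<noteq> {}" "subset.chain S C"
    have sub: "subsp U" "\<one> \<notin> U" if "U \<in> C" for U
      using that C(2) by (auto simp: subset.chain_def S_def)
    have "x \<oplus> y \<in> \<Union>C" if xy: "x \<in> \<Union>C" "y \<in> \<Union>C" for x y
    proof -
      obtain U W where U: "U \<in> C" "W \<in> C" "x \<in> U" "y \<in> W" using xy by blast
      then have "U \<subseteq> W \<or> W \<subseteq> U" using C(2) unfolding subset_chain_def by blast
      then have "(x \<in> W \<and> y \<in> W) \<or> (x \<in> U \<and> y \<in> U)" using U by auto
      then have "x \<oplus> y \<in> U \<or> x \<oplus> y \<in> W" using sub(1)[OF U(1)] sub(1)[OF U(2)] by (auto simp: subsp_def)
      then show ?thesis using U by auto
    qed
    moreover have "\<Union>C \<subseteq> carrier L" "\<zero> \<in> \<Union>C" "\<one> \<notin> \<Union>C"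
      using sub(1)[unfolded subsp_def] sub(2) C(1) by blast+
    moreover have "k \<otimes> x \<in> \<Union>C" if k: "k \<in> K" and x: "x \<in> \<Union>C" for k x
    proof -
      obtain U where "U \<in> C" "x \<in> U" using x by blast
      then show ?thesis using sub(1)[of U] k by (auto simp: subsp_def intro!: bexI[of _ U])
    qed
    ultimately show "\<Union>C \<in> S"
      unfolding S_def mem_Collect_eq subsp_def[of "\<Union>C"] by metis
  qed
  then obtain U where U: "subsp U" "\<one> \<notin> U"
    and max: "\<And>Z. subsp Z \<Longrightarrow> \<one> \<notin> Z \<Longrightarrow> U \<subseteq> Z \<Longrightarrow> Z = U"
    by (auto simp: S_def)
  have Uc: "x \<in> U \<Longrightarrow> x \<in> carrier L" and U0: "\<zero> \<in> U"
    and Ua: "x \<in> U \<Longrightarrow> y \<in> U \<Longrightarrow> x \<oplus> y \<in> U" and Um: "k \<in> K \<Longrightarrow> x \<in> U \<Longrightarrow> k \<otimes> x \<in> U" for x y k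
    using U(1) unfolding subsp_def by auto
  have Un: "\<ominus> x \<in> U" if "x \<in> U" for x
  proof -
    have "\<ominus> \<one> \<otimes> x \<in> U" using that Um[of "\<ominus> \<one>"] K_closed by simp
    then show ?thesis using Uc[OF that] by (simp add: l_minus)
  qed
  have dec: "\<exists>k\<in>K. \<exists>u\<in>U. x = k \<oplus> u" if x: "x \<in> carrier L" for x
  proof (cases "x \<in> U")
    case True
    then have "\<zero> \<in> K \<and> x \<in> U \<and> x = \<zero> \<oplus> x" using K_closed(2) x by simp
    then show ?thesis by blast
  next
    case False
    \<comment> \<open>The subspace Kx + U properly contains U, so by maximality it contains 1.
      Solving \<open>\<one> = k \<otimes> x \<oplus> u\<close> for x gives the decomposition; k is
      invertible because 1 is not in U.\<close>
    define Z where "Z = {k \<otimes> x \<oplus> u |k u. k \<in> K \<and> u \<in> U}"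
    have "subsp Z"
      unfolding subsp_def
    proof (intro conjI ballI)
      show "Z \<subseteq> carrier L" using x Uc K_carrier by (auto simp: Z_def)
      have "\<zero> \<in> K \<and> \<zero> \<in> U \<and> \<zero> = \<zero> \<otimes> x \<oplus> \<zero>" using K_closed(2) x U0 by simp
      then show "\<zero> \<in> Z" unfolding Z_def by blast
    next
      fix a b assume "a \<in> Z" "b \<in> Z"
      then obtain k u k' u' where *: "k \<in> K" "u \<in> U" "k' \<in> K" "u' \<in> U"
        "a = k \<otimes> x \<oplus> u" "b = k' \<otimes> x \<oplus> u'" unfolding Z_def by blast
      then have "a \<oplus> b = (k \<oplus> k') \<otimes> x \<oplus> (u \<oplus> u')"
        using x Uc K_carrier by (simp add: l_distr a_ac)
      moreover have "k \<oplus> k' \<in> K" "u \<oplus> u' \<in> U" using * K_closed(7) Ua by auto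
      ultimately show "a \<oplus> b \<in> Z" unfolding Z_def by blast
    next
      fix c a assume c: "c \<in> K" and "a \<in> Z"
      then obtain k u where *: "k \<in> K" "u \<in> U" "a = k \<otimes> x \<oplus> u" unfolding Z_def by blast
      then have "c \<otimes> a = (c \<otimes> k) \<otimes> x \<oplus> (c \<otimes> u)"
        using x c Uc K_carrier by (simp add: r_distr m_assoc)
      moreover have "c \<otimes> k \<in> K" "c \<otimes> u \<in> U" using * c K_closed(6) Um by auto
      ultimately show "c \<otimes> a \<in> Z" unfolding Z_def by blast
    qed
    moreover have UX: "U \<subseteq> Z"
    proof
      fix u assume "u \<in> U"
      then have "\<zero> \<in> K \<and> u \<in> U \<and> u = \<zero> \<otimes> x \<oplus> u" using K_closed(2) x Uc by simp
      then show "u \<in> Z" unfolding Z_def by blast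
    qed
    moreover have "x \<in> Z"
    proof -
      have "\<one> \<in> K \<and> \<zero> \<in> U \<and> x = \<one> \<otimes> x \<oplus> \<zero>" using K_closed(3) x U0 by simp
      then show ?thesis unfolding Z_def by blast
    qed
    ultimately have "\<one> \<in> Z" using max[of Z] False by auto
    then obtain k u where ku: "k \<in> K" "u \<in> U" "\<one> = k \<otimes> x \<oplus> u" unfolding Z_def by blast
    have uc: "u \<in> carrier L" using Uc[OF ku(2)] .
    have "k \<noteq> \<zero>"
    proof
      assume "k = \<zero>"
      then have "k \<otimes> x \<oplus> u = u" using x uc by simp
      then show False using ku(2,3) U(2) by metis
    qed
    then have k: "k \<in> K - {\<zero>}" using ku by simp
    define j where "j = inv k"
    have j: "j \<in> K" "j \<otimes> k = \<one>" using subfield_m_inv[OF subfield_K k] by (auto simp: j_def)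
    have jc: "j \<in> carrier L" "k \<in> carrier L" using j ku K_carrier by auto
    have "j \<otimes> (k \<otimes> x \<oplus> u) = x \<oplus> j \<otimes> u"
      using x uc jc j(2) by (simp add: r_distr m_assoc[symmetric])
    then have "j = x \<oplus> j \<otimes> u"
      unfolding ku(3)[symmetric] using jc by simp
    then have "j \<oplus> \<ominus> (j \<otimes> u) = (x \<oplus> j \<otimes> u) \<oplus> \<ominus> (j \<otimes> u)" by (rule arg_cong)
    also have "\<dots> = x" using x uc jc by (simp add: a_assoc r_neg)
    finally show ?thesis using j Un[OF Um[OF j(1) ku(2)]] by (intro bexI[of _ j] bexI) auto
  qed
  \<comment> \<open>Otherwise the nonzero scalar k - k' would lie in U, and dividing by it would put
    1 into U.\<close>
  have uniq: "k = k'" if "k \<in> K" "k' \<in> K" "u \<in> U" "u' \<in> U" "k \<oplus> u = k' \<oplus> u'" for k k' u u'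
  proof (rule ccontr)
    assume ne: "k \<noteq> k'"
    note c = K_carrier[OF that(1)] K_carrier[OF that(2)] Uc[OF that(3)] Uc[OF that(4)]
    have eq: "k \<ominus> k' = u' \<ominus> u"
    proof -
      have "k \<ominus> k' = (k \<oplus> u) \<ominus> (k' \<oplus> u)"
        using c add_minus_add_cancel[of k k' u] by (simp add: a_comm)
      also have "\<dots> = u' \<ominus> u"
        unfolding that(5) using c by (simp add: add_minus_add_cancel)
      finally show ?thesis .
    qed
    then have "k \<ominus> k' \<in> U" using that Ua Un by (simp add: a_minus_def)
    moreover have d: "k \<ominus> k' \<in> K - {\<zero>}"
    proof -
      have "k \<ominus> k' \<in> K" unfolding a_minus_def using that K_closed by simp
      moreover have "k \<ominus> k' \<noteq> \<zero>" using ne c(1,2) r_right_minus_eq by simp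
      ultimately show ?thesis by simp
    qed
    ultimately have "inv (k \<ominus> k') \<otimes> (k \<ominus> k') \<in> U"
      using Um[of "inv (k \<ominus> k')" "k \<ominus> k'"] subfield_m_inv(1)[OF subfield_K d] by simp
    then show False unfolding subfield_m_inv(3)[OF subfield_K d] using U(2) by simp
  qed
  \<comment> \<open>The projection of L onto K along the complement U.\<close>
  define g where "g x = (THE k. k \<in> K \<and> (\<exists>u\<in>U. x = k \<oplus> u))" for x
  have gI: "g x = k" if "k \<in> K" "u \<in> U" "x = k \<oplus> u" for x k u
    unfolding g_def
  proof (rule the_equality)
    show "k \<in> K \<and> (\<exists>u\<in>U. x = k \<oplus> u)" using that by auto
    fix k' assume "k' \<in> K \<and> (\<exists>u\<in>U. x = k' \<oplus> u)"
    then obtain u' where "k' \<in> K" "u' \<in> U" "x = k' \<oplus> u'" by auto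
    then show "k' = k" using uniq[of k' k u' u] that by simp
  qed
  have gE: "\<exists>u\<in>U. g x \<in> K \<and> x = g x \<oplus> u" if x: "x \<in> carrier L" for x
  proof -
    obtain k u where *: "k \<in> K" "u \<in> U" "x = k \<oplus> u" using dec[OF x] by auto
    then have "g x = k" by (rule gI)
    then show ?thesis using * by auto
  qed
  have "g \<in> forms"
    unfolding forms_def
  proof (intro CollectI conjI ballI funcsetI)
    fix x assume "x \<in> carrier L" then show "g x \<in> K" using gE[of x] by auto
  next
    fix x y assume "x \<in> carrier L" "y \<in> carrier L"
    then obtain u v where *: "u \<in> U" "v \<in> U" "g x \<in> K" "g y \<in> K" "x = g x \<oplus> u" "y = g y \<oplus> v"
      using gE[of x] gE[of y] by auto
    have "x \<oplus> y = (g x \<oplus> u) \<oplus> (g y \<oplus> v)" using *(5,6) by simp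
    also have "\<dots> = (g x \<oplus> g y) \<oplus> (u \<oplus> v)"
      using *(1-4) Uc K_carrier by (simp add: a_ac)
    finally show "g (x \<oplus> y) = g x \<oplus> g y"
      using *(1-4) K_closed(7) Ua by (intro gI[of _ "u \<oplus> v"]) auto
  next
    fix k x assume k: "k \<in> K" and "x \<in> carrier L"
    then obtain u where *: "u \<in> U" "g x \<in> K" "x = g x \<oplus> u"
      using gE[of x] by auto
    have "k \<otimes> x = k \<otimes> (g x \<oplus> u)" using *(3) by simp
    also have "\<dots> = k \<otimes> g x \<oplus> k \<otimes> u"
      using *(1-2) k Uc K_carrier by (simp add: r_distr)
    finally show "g (k \<otimes> x) = k \<otimes> g x"
      using *(1,2) k K_closed(6) Um by (intro gI[of _ "k \<otimes> u"]) auto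
  qed
  moreover have "g \<one> = \<one>" using K_closed(3) U0 by (intro gI[of _ \<zero>]) auto
  ultimately show ?thesis by blast
qed

end

subsection \<open>The tensor square of a differential field extension\<close>

context differential_extension
begin

text \<open>The list \<open>[(x\<^sub>1, y\<^sub>1), \<dots>]\<close> stands for \<open>\<Sum>\<^sub>i x\<^sub>i \<otimes> y\<^sub>i\<close>. Since \<open>K\<close>-linear forms separate the points of \<open>L\<close>,
  two lists denote the same tensor iff all forms on the right factor agree on them.\<close>

definition tensors :: "('l \<times> 'l) list set" where
  "tensors = lists (carrier L \<times> carrier L)"

lemma tensors_Nil [simp]: "[] \<in> tensors"
  and tensors_Cons [simp]: "p # ps \<in> tensors \<longleftrightarrow> p \<in> carrier L \<times> carrier L \<and> ps \<in> tensors"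
  and tensors_append [simp]: "ps @ qs \<in> tensors \<longleftrightarrow> ps \<in> tensors \<and> qs \<in> tensors"
  by (auto simp: tensors_def)

primrec pairing :: "('l \<times> 'l) list \<Rightarrow> ('l \<Rightarrow> 'l) \<Rightarrow> 'l" where
  "pairing [] g = \<zero>"
| "pairing (p # ps) g = fst p \<otimes> g (snd p) \<oplus> pairing ps g"

definition tensor_eq :: "('l \<times> 'l) list \<Rightarrow> ('l \<times> 'l) list \<Rightarrow> bool" where
  "tensor_eq ps qs \<longleftrightarrow> (\<forall>g\<in>forms. pairing ps g = pairing qs g)"

definition tensor_mult1 :: "'l \<times> 'l \<Rightarrow> ('l \<times> 'l) list \<Rightarrow> ('l \<times> 'l) list" where
  "tensor_mult1 p qs = map (\<lambda>q. (fst p \<otimes> fst q, snd p \<otimes> snd q)) qs"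

definition tensor_mult :: "('l \<times> 'l) list \<Rightarrow> ('l \<times> 'l) list \<Rightarrow> ('l \<times> 'l) list" where
  "tensor_mult ps qs = concat (map (\<lambda>p. tensor_mult1 p qs) ps)"

definition tensor_der :: "('l \<times> 'l) list \<Rightarrow> ('l \<times> 'l) list" where
  "tensor_der ps = concat (map (\<lambda>p. [(\<delta> (fst p), snd p), (fst p, \<delta> (snd p))]) ps)"

definition tensor_minus :: "('l \<times> 'l) list \<Rightarrow> ('l \<times> 'l) list" where
  "tensor_minus ps = map (\<lambda>p. (\<ominus> fst p, snd p)) ps"

lemma tensor_mult_Nil [simp]: "tensor_mult [] qs = []"
  and tensor_mult_Cons [simp]: "tensor_mult (p # ps) qs = tensor_mult1 p qs @ tensor_mult ps qs"
  and tensor_mult_append: "tensor_mult (ps @ ps') qs = tensor_mult ps qs @ tensor_mult ps' qs"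
  and tensor_der_Nil [simp]: "tensor_der [] = []"
  and tensor_der_Cons [simp]:
    "tensor_der (p # ps) = (\<delta> (fst p), snd p) # (fst p, \<delta> (snd p)) # tensor_der ps"
  and tensor_der_append: "tensor_der (ps @ ps') = tensor_der ps @ tensor_der ps'"
  by (simp_all add: tensor_mult_def tensor_der_def)

lemma tensor_mult1_closed: "p \<in> carrier L \<times> carrier L \<Longrightarrow> qs \<in> tensors \<Longrightarrow> tensor_mult1 p qs \<in> tensors"
  by (induction qs) (auto simp: tensor_mult1_def)

lemma tensor_mult_closed: "ps \<in> tensors \<Longrightarrow> qs \<in> tensors \<Longrightarrow> tensor_mult ps qs \<in> tensors"
  by (induction ps) (auto simp: tensor_mult1_closed)

lemma tensor_der_closed: "ps \<in> tensors \<Longrightarrow> tensor_der ps \<in> tensors"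
  by (induction ps) (auto simp: der_closed)

lemma tensor_minus_closed: "ps \<in> tensors \<Longrightarrow> tensor_minus ps \<in> tensors"
  by (induction ps) (auto simp: tensor_minus_def)

lemma pairing_closed:
  assumes "\<And>x. x \<in> carrier L \<Longrightarrow> h x \<in> carrier L"
  shows "ps \<in> tensors \<Longrightarrow> pairing ps h \<in> carrier L"
  by (induction ps) (auto simp: assms)

lemma pairing_cong:
  assumes "\<And>x. x \<in> carrier L \<Longrightarrow> h x = h' x"
  shows "ps \<in> tensors \<Longrightarrow> pairing ps h = pairing ps h'"
  by (induction ps) (auto simp: assms)

lemma pairing_append:
  assumes "\<And>x. x \<in> carrier L \<Longrightarrow> h x \<in> carrier L"
  shows "ps \<in> tensors \<Longrightarrow> qs \<in> tensors \<Longrightarrow> pairing (ps @ qs) h = pairing ps h \<oplus> pairing qs h"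
  by (induction ps) (auto simp: assms pairing_closed a_assoc)

lemma pairing_add:
  assumes "\<And>x. x \<in> carrier L \<Longrightarrow> h x \<in> carrier L" and "\<And>x. x \<in> carrier L \<Longrightarrow> h' x \<in> carrier L"
  shows "ps \<in> tensors \<Longrightarrow> pairing ps (\<lambda>x. h x \<oplus> h' x) = pairing ps h \<oplus> pairing ps h'"
  by (induction ps) (auto simp: assms pairing_closed r_distr a_ac)

lemma pairing_smult:
  assumes "\<And>x. x \<in> carrier L \<Longrightarrow> h x \<in> carrier L"
  shows "ps \<in> tensors \<Longrightarrow> a \<in> carrier L \<Longrightarrow> pairing ps (\<lambda>x. a \<otimes> h x) = a \<otimes> pairing ps h"
  by (induction ps) (auto simp: assms pairing_closed r_distr m_lcomm)

lemma pairing_zero: "ps \<in> tensors \<Longrightarrow> pairing ps (\<lambda>x. \<zero>) = \<zero>"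
  by (induction ps) auto

lemma pairing_minus:
  assumes "\<And>x. x \<in> carrier L \<Longrightarrow> h x \<in> carrier L"
  shows "ps \<in> tensors \<Longrightarrow> pairing (tensor_minus ps) h = \<ominus> pairing ps h"
  by (induction ps) (auto simp: assms tensor_minus_def pairing_closed l_minus minus_add)

text \<open>Interchange of two finite sums, from which commutativity of the product of tensors
  follows.\<close>

lemma pairing_swap:
  assumes "\<And>x y. x \<in> carrier L \<Longrightarrow> y \<in> carrier L \<Longrightarrow> h x y \<in> carrier L"
  shows "ps \<in> tensors \<Longrightarrow> qs \<in> tensors \<Longrightarrow>
    pairing ps (\<lambda>x. pairing qs (h x)) = pairing qs (\<lambda>y. pairing ps (\<lambda>x. h x y))"
proof (induction ps)
  case (Cons p ps)
  obtain x y where p: "p = (x, y)" "x \<in> carrier L" "y \<in> carrier L" using Cons by auto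
  have "pairing qs (\<lambda>z. x \<otimes> h y z \<oplus> pairing ps (\<lambda>w. h w z))
      = x \<otimes> pairing qs (h y) \<oplus> pairing qs (\<lambda>z. pairing ps (\<lambda>w. h w z))"
    using assms Cons p by (subst pairing_add) (auto intro!: pairing_closed simp: pairing_smult)
  then show ?case using Cons p by simp
qed (simp add: pairing_zero)

lemma pairing_mult1:
  assumes "\<And>x. x \<in> carrier L \<Longrightarrow> h x \<in> carrier L"
  shows "p \<in> carrier L \<times> carrier L \<Longrightarrow> qs \<in> tensors \<Longrightarrow>
    pairing (tensor_mult1 p qs) h = fst p \<otimes> pairing qs (\<lambda>y. h (snd p \<otimes> y))"
  by (induction qs) (auto simp: assms tensor_mult1_def pairing_closed r_distr m_assoc)

lemma pairing_mult:
  assumes "\<And>x. x \<in> carrier L \<Longrightarrow> h x \<in> carrier L"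
  shows "ps \<in> tensors \<Longrightarrow> qs \<in> tensors \<Longrightarrow>
    pairing (tensor_mult ps qs) h = pairing ps (\<lambda>x. pairing qs (\<lambda>y. h (x \<otimes> y)))"
proof (induction ps)
  case (Cons p ps)
  then show ?case
    by (auto simp: assms pairing_append pairing_mult1 tensor_mult1_closed tensor_mult_closed)
qed simp

text \<open>Leibniz rule for the contraction, solved for the term with the derived list. On the
  right the list enters only through contractions with forms, namely g and its commutator with
  \<delta>; hence \<open>tensor_der\<close> respects \<open>tensor_eq\<close>.\<close>

lemma pairing_der:
  assumes g: "g \<in> forms"
  shows "ps \<in> tensors \<Longrightarrow>
    pairing (tensor_der ps) g = \<delta> (pairing ps g) \<ominus> pairing ps (\<lambda>x. \<delta> (g x) \<ominus> g (\<delta> x))"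
proof (induction ps)
  case (Cons p ps)
  note gD = formsD[OF g]
  obtain x y where p: "p = (x, y)" "x \<in> carrier L" "y \<in> carrier L" using Cons by auto
  define h where "h = (\<lambda>x. \<delta> (g x) \<ominus> g (\<delta> x))"
  have hc: "z \<in> carrier L \<Longrightarrow> h z \<in> carrier L" for z
    using formsD(2)[OF forms_der[OF g]] unfolding h_def .
  note gc = gD(2)
  define A B where "A = pairing ps g" and "B = pairing ps h"
  have [simp]: "A \<in> carrier L" "B \<in> carrier L" using pairing_closed gc hc Cons by (auto simp: A_def B_def)
  note [simp] = der_closed
  have hy: "h y \<oplus> g (\<delta> y) = \<delta> (g y)" "h y \<in> carrier L"
    using p hc by (auto simp: h_def gD a_minus_def a_assoc l_neg)
  have "\<delta> (x \<otimes> g y \<oplus> A) \<ominus> (x \<otimes> h y \<oplus> B)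
      = (x \<otimes> h y \<oplus> (\<delta> x \<otimes> g y \<oplus> x \<otimes> g (\<delta> y) \<oplus> \<delta> A)) \<ominus> (x \<otimes> h y \<oplus> B)"
    using p hy(2) by (simp add: der_add der_mult gD hy(1)[symmetric] r_distr a_ac)
  also have "\<dots> = (\<delta> x \<otimes> g y \<oplus> x \<otimes> g (\<delta> y) \<oplus> \<delta> A) \<ominus> B"
    using p hy(2) gD by (subst add_minus_add_cancel) auto
  also have "\<dots> = \<delta> x \<otimes> g y \<oplus> (x \<otimes> g (\<delta> y) \<oplus> (\<delta> A \<ominus> B))"
    using p gD by (simp add: a_minus_def a_assoc)
  finally show ?case
    using Cons p by (simp add: A_def B_def h_def)
qed (auto simp: a_minus_def)

lemma pairing_form:
  assumes "g \<in> forms"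
  shows pairing_form_closed: "ps \<in> tensors \<Longrightarrow> pairing ps g \<in> carrier L"
    and pairing_form_append: "ps \<in> tensors \<Longrightarrow> qs \<in> tensors \<Longrightarrow>
      pairing (ps @ qs) g = pairing ps g \<oplus> pairing qs g"
    and pairing_form_minus: "ps \<in> tensors \<Longrightarrow> pairing (tensor_minus ps) g = \<ominus> pairing ps g"
    and pairing_form_mult: "ps \<in> tensors \<Longrightarrow> qs \<in> tensors \<Longrightarrow>
      pairing (tensor_mult ps qs) g = pairing ps (\<lambda>x. pairing qs (\<lambda>y. g (x \<otimes> y)))"
  using pairing_closed[of g] pairing_append[of g] pairing_minus[of g] pairing_mult[of g]
    formsD(2)[OF assms] by auto

lemma tensor_eq_refl: "tensor_eq ps ps"
  and tensor_eq_sym: "tensor_eq ps qs \<Longrightarrow> tensor_eq qs ps"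
  and tensor_eq_trans: "tensor_eq ps qs \<Longrightarrow> tensor_eq qs rs \<Longrightarrow> tensor_eq ps rs"
  by (auto simp: tensor_eq_def)

lemma tensor_eq_append:
  assumes "ps \<in> tensors" "ps' \<in> tensors" "qs \<in> tensors" "qs' \<in> tensors"
    and "tensor_eq ps ps'" "tensor_eq qs qs'"
  shows "tensor_eq (ps @ qs) (ps' @ qs')"
  using assms by (simp add: tensor_eq_def pairing_form_append)

lemma tensor_mult_commute:
  assumes "ps \<in> tensors" "qs \<in> tensors"
  shows "tensor_eq (tensor_mult ps qs) (tensor_mult qs ps)"
  unfolding tensor_eq_def
proof
  fix g assume g: "g \<in> forms"
  note gm = pairing_form_mult[OF g]
  have "pairing (tensor_mult ps qs) g = pairing ps (\<lambda>x. pairing qs (\<lambda>y. g (x \<otimes> y)))"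
    using assms by (rule gm)
  also have "\<dots> = pairing qs (\<lambda>y. pairing ps (\<lambda>x. g (x \<otimes> y)))"
    using assms by (intro pairing_swap formsD(2)[OF g]) auto
  also have "\<dots> = pairing qs (\<lambda>y. pairing ps (\<lambda>x. g (y \<otimes> x)))"
    using assms by (intro pairing_cong) (auto simp: m_comm intro!: pairing_cong)
  also have "\<dots> = pairing (tensor_mult qs ps) g"
    using assms by (simp add: gm)
  finally show "pairing (tensor_mult ps qs) g = pairing (tensor_mult qs ps) g" .
qed

text \<open>In the second argument equality is tested at translates of g, which are again forms. The
  first argument is reached through commutativity, since contracting it directly would involve a
  function with values in L.\<close>

lemma tensor_eq_mult:
  assumes "ps \<in> tensors" "ps' \<in> tensors" "qs \<in> tensors" "qs' \<in> tensors"
    and "tensor_eq ps ps'" "tensor_eq qs qs'"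
  shows "tensor_eq (tensor_mult ps qs) (tensor_mult ps' qs')"
proof -
  have *: "tensor_eq (tensor_mult ps qs) (tensor_mult ps qs')"
    if "ps \<in> tensors" "qs \<in> tensors" "qs' \<in> tensors" "tensor_eq qs qs'" for ps qs qs'
    unfolding tensor_eq_def
  proof
    fix g assume g: "g \<in> forms"
    then have "pairing qs (\<lambda>y. g (x \<otimes> y)) = pairing qs' (\<lambda>y. g (x \<otimes> y))"
      if "x \<in> carrier L" for x
      using forms_translate[OF g that] \<open>tensor_eq qs qs'\<close> by (simp add: tensor_eq_def)
    then show "pairing (tensor_mult ps qs) g = pairing (tensor_mult ps qs') g"
      using that(1-3) by (auto simp: pairing_form_mult[OF g] intro!: pairing_cong)
  qed
  have "tensor_eq (tensor_mult ps qs) (tensor_mult qs' ps)"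
    using *[of ps qs qs'] tensor_mult_commute[of ps qs'] assms tensor_eq_trans by blast
  moreover have "tensor_eq (tensor_mult qs' ps) (tensor_mult ps' qs')"
    using *[of qs' ps ps'] tensor_mult_commute[of qs' ps'] assms tensor_eq_trans by blast
  ultimately show ?thesis by (rule tensor_eq_trans)
qed

lemma tensor_eq_der:
  assumes "ps \<in> tensors" "ps' \<in> tensors" "tensor_eq ps ps'"
  shows "tensor_eq (tensor_der ps) (tensor_der ps')"
  using assms forms_der by (simp add: tensor_eq_def pairing_der)

lemma tensor_mult_assoc:
  assumes "ps \<in> tensors" "qs \<in> tensors" "rs \<in> tensors"
  shows "tensor_eq (tensor_mult (tensor_mult ps qs) rs) (tensor_mult ps (tensor_mult qs rs))"
  unfolding tensor_eq_def
proof
  fix g assume "g \<in> forms"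
  note gm = pairing_form_mult[OF this] and g = formsD(2)[OF this]
  have "pairing (tensor_mult (tensor_mult ps qs) rs) g
      = pairing (tensor_mult ps qs) (\<lambda>x. pairing rs (\<lambda>z. g (x \<otimes> z)))"
    using assms by (simp add: gm tensor_mult_closed)
  also have "\<dots> = pairing ps (\<lambda>x. pairing qs (\<lambda>y. pairing rs (\<lambda>z. g (x \<otimes> y \<otimes> z))))"
    using assms g by (intro pairing_mult pairing_closed) auto
  also have "\<dots> = pairing ps (\<lambda>x. pairing qs (\<lambda>y. pairing rs (\<lambda>z. g (x \<otimes> (y \<otimes> z)))))"
    using assms g by (intro pairing_cong) (auto simp: m_assoc)
  also have "\<dots> = pairing ps (\<lambda>x. pairing (tensor_mult qs rs) (\<lambda>y. g (x \<otimes> y)))"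
    using assms g by (intro pairing_cong pairing_mult[symmetric]) auto
  also have "\<dots> = pairing (tensor_mult ps (tensor_mult qs rs)) g"
    using assms by (simp add: gm tensor_mult_closed)
  finally show "pairing (tensor_mult (tensor_mult ps qs) rs) g
      = pairing (tensor_mult ps (tensor_mult qs rs)) g" .
qed

lemma tensor_mult_one:
  assumes "ps \<in> tensors"
  shows "tensor_eq (tensor_mult [(\<one>, \<one>)] ps) ps"
  unfolding tensor_eq_def
proof
  fix g assume "g \<in> forms"
  note g = this
  have "pairing ps (\<lambda>y. g (\<one> \<otimes> y)) = pairing ps g"
    using assms by (intro pairing_cong) auto
  then show "pairing (tensor_mult [(\<one>, \<one>)] ps) g = pairing ps g"
    using assms pairing_form_mult[OF g, of "[(\<one>, \<one>)]" ps]
    by (simp add: pairing_form_closed[OF g] del: tensor_mult_Cons)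
qed

lemma tensor_add_minus: "ps \<in> tensors \<Longrightarrow> tensor_eq (tensor_minus ps @ ps) []"
  by (simp add: tensor_eq_def pairing_form_append tensor_minus_closed
      pairing_form_minus pairing_form_closed l_neg)

lemma tensor_add_commute: "ps \<in> tensors \<Longrightarrow> qs \<in> tensors \<Longrightarrow> tensor_eq (ps @ qs) (qs @ ps)"
  by (simp add: tensor_eq_def pairing_form_append pairing_form_closed a_comm)

lemma tensor_der_mult1:
  assumes "p \<in> carrier L \<times> carrier L" "g \<in> forms"
  shows "qs \<in> tensors \<Longrightarrow> pairing (tensor_der (tensor_mult1 p qs)) g
    = pairing (tensor_mult1 (\<delta> (fst p), snd p) qs) g \<oplus> pairing (tensor_mult1 (fst p, \<delta> (snd p)) qs) g
      \<oplus> pairing (tensor_mult1 p (tensor_der qs)) g"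
proof (induction qs)
  case Nil
  then show ?case by (simp add: tensor_mult1_def)
next
  case (Cons q qs)
  obtain x y where p: "p = (x, y)" "x \<in> carrier L" "y \<in> carrier L" using assms by auto
  obtain z w where q: "q = (z, w)" "z \<in> carrier L" "w \<in> carrier L" using Cons by auto
  note g = formsD(2,3)[OF assms(2)]
  note [simp] = der_closed
  have c: "pairing (tensor_mult1 (a, b) rs) g \<in> carrier L"
    if "a \<in> carrier L" "b \<in> carrier L" "rs \<in> tensors" for a b rs
    using that by (intro pairing_form_closed[OF assms(2)] tensor_mult1_closed) auto
  define s1 s2 s3 where "s1 = pairing (tensor_mult1 (\<delta> x, y) qs) g"
    and "s2 = pairing (tensor_mult1 (x, \<delta> y) qs) g"
    and "s3 = pairing (tensor_mult1 (x, y) (tensor_der qs)) g"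
  have s: "s1 \<in> carrier L" "s2 \<in> carrier L" "s3 \<in> carrier L"
    using p Cons.prems tensor_der_closed[of qs] by (auto simp: s1_def s2_def s3_def intro!: c)
  have cons: "pairing (tensor_mult1 u (v # vs)) g
      = fst u \<otimes> fst v \<otimes> g (snd u \<otimes> snd v) \<oplus> pairing (tensor_mult1 u vs) g" for u v vs
    by (simp add: tensor_mult1_def)
  have "pairing (tensor_der (tensor_mult1 p (q # qs))) g
     = \<delta> (x \<otimes> z) \<otimes> g (y \<otimes> w) \<oplus> (x \<otimes> z \<otimes> g (\<delta> (y \<otimes> w))
      \<oplus> pairing (tensor_der (tensor_mult1 p qs)) g)"
    using p q by (simp add: tensor_mult1_def)
  also have "pairing (tensor_der (tensor_mult1 p qs)) g = s1 \<oplus> s2 \<oplus> s3"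
    using Cons p by (simp add: s1_def s2_def s3_def)
  finally show ?case
    using s p q unfolding s1_def[symmetric]
    by (simp add: cons s1_def[symmetric] s2_def[symmetric] s3_def[symmetric] der_mult g
        l_distr r_distr a_ac)
qed

lemma tensor_der_mult:
  assumes "ps \<in> tensors" "qs \<in> tensors"
  shows "tensor_eq (tensor_der (tensor_mult ps qs))
    (tensor_mult (tensor_der ps) qs @ tensor_mult ps (tensor_der qs))"
  unfolding tensor_eq_def
proof
  fix g assume g: "g \<in> forms"
  note [simp] = der_closed
  show "pairing (tensor_der (tensor_mult ps qs)) g
      = pairing (tensor_mult (tensor_der ps) qs @ tensor_mult ps (tensor_der qs)) g"
    using assms
  proof (induction ps)
    case (Cons p ps)
    obtain x y where p: "p = (x, y)" "x \<in> carrier L" "y \<in> carrier L" using Cons by auto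
    have c: "tensor_mult1 p qs \<in> tensors" "tensor_mult1 (\<delta> x, y) qs \<in> tensors"
      "tensor_mult1 (x, \<delta> y) qs \<in> tensors" "tensor_mult1 p (tensor_der qs) \<in> tensors"
      "tensor_mult ps qs \<in> tensors" "tensor_mult (tensor_der ps) qs \<in> tensors"
      "tensor_mult ps (tensor_der qs) \<in> tensors"
      using p Cons.prems tensor_der_closed[of qs] tensor_der_closed[of ps]
      by (auto intro!: tensor_mult1_closed tensor_mult_closed)
    note c' = c[THEN pairing_form_closed[OF g]]
    have "pairing (tensor_der (tensor_mult (p # ps) qs)) g
        = pairing (tensor_der (tensor_mult1 p qs)) g \<oplus> pairing (tensor_der (tensor_mult ps qs)) g"
      using pairing_form_append[OF g tensor_der_closed[OF c(1)] tensor_der_closed[OF c(5)]]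
      by (simp only: tensor_mult_Cons tensor_der_append)
    moreover have "pairing (tensor_der (tensor_mult ps qs)) g
      = pairing (tensor_mult (tensor_der ps) qs) g \<oplus> pairing (tensor_mult ps (tensor_der qs)) g"
      using Cons c by (simp add: pairing_form_append[OF g])
    moreover have "pairing (tensor_der (tensor_mult1 p qs)) g
      = pairing (tensor_mult1 (\<delta> x, y) qs) g \<oplus> pairing (tensor_mult1 (x, \<delta> y) qs) g
      \<oplus> pairing (tensor_mult1 p (tensor_der qs)) g"
      using tensor_der_mult1[OF _ g, of p qs] p Cons by simp
    ultimately show ?case
      using p(1) c c' by (simp add: pairing_form_append[OF g] a_ac)
  qed simp
qed

end

text \<open>\<open>M\<close> is \<open>L \<otimes>\<^sub>K L\<close> transported to the type \<open>'m\<close>, and \<open>q\<close> is the quotient map from lists of pairs.\<close>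

locale tensor_square = differential_extension L K + M: differential_ring M
  for L :: "'l diff_ring" (structure) and K and M :: "'m diff_ring" +
  fixes q :: "('l \<times> 'l) list \<Rightarrow> 'm"
  assumes carrier_M: "carrier M = q ` tensors"
    and q_eq: "ps \<in> tensors \<Longrightarrow> qs \<in> tensors \<Longrightarrow> q ps = q qs \<longleftrightarrow> tensor_eq ps qs"
    and q_add: "ps \<in> tensors \<Longrightarrow> qs \<in> tensors \<Longrightarrow> q ps \<oplus>\<^bsub>M\<^esub> q qs = q (ps @ qs)"
    and q_mult: "ps \<in> tensors \<Longrightarrow> qs \<in> tensors \<Longrightarrow> q ps \<otimes>\<^bsub>M\<^esub> q qs = q (tensor_mult ps qs)"
    and q_zero: "\<zero>\<^bsub>M\<^esub> = q []"
    and q_one: "\<one>\<^bsub>M\<^esub> = q [(\<one>, \<one>)]"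
    and q_der: "ps \<in> tensors \<Longrightarrow> \<delta>\<^bsub>M\<^esub> (q ps) = q (tensor_der ps)"

lemma (in differential_extension) exists_tensor_square:
  fixes j :: "('l \<times> 'l) list \<Rightarrow> 'm"
  assumes j: "inj_on j tensors"
  shows "\<exists>(M :: 'm diff_ring) q. tensor_square L K M q"
proof -
  \<comment> \<open>The chosen list depends only on the class of \<open>ps\<close>, so
    \<open>c\<close> is a normal form and \<open>j\<close> makes it an element of \<open>'m\<close>.
    The section \<open>r\<close> of \<open>q\<close> then lets the operations be defined on
    representatives.\<close>
  define c where "c ps = (SOME qs. qs \<in> tensors \<and> tensor_eq ps qs)" for ps
  define q where "q ps = j (c ps)" for ps
  define r where "r = inv_into tensors q"
  define M where "M = \<lparr>carrier = q ` tensors,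
    monoid.mult = (\<lambda>a b. q (tensor_mult (r a) (r b))), one = q [(\<one>, \<one>)],
    ring.zero = q [], ring.add = (\<lambda>a b. q (r a @ r b)), der = (\<lambda>a. q (tensor_der (r a)))\<rparr>"
  have c: "c ps \<in> tensors \<and> tensor_eq ps (c ps)" if "ps \<in> tensors" for ps
    unfolding c_def by (rule someI[of _ ps]) (use that tensor_eq_refl in auto)
  have q_eq: "q ps = q qs \<longleftrightarrow> tensor_eq ps qs" if "ps \<in> tensors" "qs \<in> tensors" for ps qs
  proof
    assume "q ps = q qs"
    then have "c ps = c qs" using j c that unfolding q_def by (metis inj_onD)
    then show "tensor_eq ps qs" using c[OF that(1)] c[OF that(2)] by (metis tensor_eq_sym tensor_eq_trans)
  next
    assume "tensor_eq ps qs"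
    then have "c ps = c qs"
      unfolding c_def by (metis tensor_eq_sym tensor_eq_trans)
    then show "q ps = q qs" by (simp add: q_def)
  qed
  have r: "r (q ps) \<in> tensors" "tensor_eq (r (q ps)) ps" if "ps \<in> tensors" for ps
  proof -
    show "r (q ps) \<in> tensors" using that by (auto simp: r_def intro: inv_into_into)
    moreover have "q (r (q ps)) = q ps" using that by (auto simp: r_def intro: f_inv_into_f)
    ultimately show "tensor_eq (r (q ps)) ps" using q_eq that by blast
  qed
  have one: "[(\<one>, \<one>)] \<in> tensors" by simp
  have add: "q ps \<oplus>\<^bsub>M\<^esub> q qs = q (ps @ qs)"
    and mult: "q ps \<otimes>\<^bsub>M\<^esub> q qs = q (tensor_mult ps qs)"
    and der: "\<delta>\<^bsub>M\<^esub> (q ps) = q (tensor_der ps)" if "ps \<in> tensors" "qs \<in> tensors" for ps qs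
    using that r[OF that(1)] r[OF that(2)]
    by (auto simp: M_def q_eq tensor_mult_closed tensor_der_closed
        intro!: tensor_eq_append tensor_eq_mult tensor_eq_der)
  have M [simp]: "carrier M = q ` tensors" "\<zero>\<^bsub>M\<^esub> = q []" "\<one>\<^bsub>M\<^esub> = q [(\<one>, \<one>)]"
    by (simp_all add: M_def)
  note closed = tensor_mult_closed tensor_der_closed tensor_minus_closed
  have left_distr: "q (tensor_mult (ps @ qs) rs) = q (tensor_mult ps rs @ tensor_mult qs rs)" for ps qs rs
    by (simp add: tensor_mult_append)
  have "abelian_group M"
  proof (rule abelian_groupI)
    fix x assume "x \<in> carrier M"
    then obtain ps where ps: "ps \<in> tensors" "x = q ps" by auto
    show "\<exists>y\<in>carrier M. y \<oplus>\<^bsub>M\<^esub> x = \<zero>\<^bsub>M\<^esub>"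
      using ps by (intro bexI[of _ "q (tensor_minus ps)"])
        (auto simp: add tensor_minus_closed q_eq tensor_add_minus)
  qed (auto simp: add q_eq tensor_add_commute)
  moreover have "comm_monoid M"
  proof (rule comm_monoidI)
    fix x y z assume "x \<in> carrier M" "y \<in> carrier M" "z \<in> carrier M"
    then show "x \<otimes>\<^bsub>M\<^esub> y \<otimes>\<^bsub>M\<^esub> z = x \<otimes>\<^bsub>M\<^esub> (y \<otimes>\<^bsub>M\<^esub> z)"
      by (auto simp: mult q_eq closed tensor_mult_assoc)
  next
    fix x assume "x \<in> carrier M"
    then obtain ps where ps: "ps \<in> tensors" "x = q ps" by auto
    then show "\<one>\<^bsub>M\<^esub> \<otimes>\<^bsub>M\<^esub> x = x"
      using mult[OF one, of ps] tensor_mult_one[of ps] q_eq[OF tensor_mult_closed[OF one], of ps ps]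
      by simp
  qed (auto simp: mult q_eq closed tensor_mult_commute)
  moreover have "(x \<oplus>\<^bsub>M\<^esub> y) \<otimes>\<^bsub>M\<^esub> z = x \<otimes>\<^bsub>M\<^esub> z \<oplus>\<^bsub>M\<^esub> y \<otimes>\<^bsub>M\<^esub> z"
    if "x \<in> carrier M" "y \<in> carrier M" "z \<in> carrier M" for x y z
    using that by (auto simp: add mult closed left_distr)
  ultimately have "cring M" by (intro cringI)
  moreover have "differential_ring_axioms M"
  proof
    fix x y assume "x \<in> carrier M" "y \<in> carrier M"
    then obtain ps qs where *: "ps \<in> tensors" "x = q ps" "qs \<in> tensors" "y = q qs" by auto
    then show "\<delta>\<^bsub>M\<^esub> (x \<otimes>\<^bsub>M\<^esub> y) = \<delta>\<^bsub>M\<^esub> x \<otimes>\<^bsub>M\<^esub> y \<oplus>\<^bsub>M\<^esub> x \<otimes>\<^bsub>M\<^esub> \<delta>\<^bsub>M\<^esub> y"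
      by (simp add: add mult der closed q_eq tensor_der_mult)
  qed (auto simp: add der closed tensor_der_append)
  ultimately have "differential_ring M" by (rule differential_ring.intro)
  then have "tensor_square L K M q"
    by (intro tensor_square.intro tensor_square_axioms.intro)
      (auto simp: add mult der q_eq differential_extension_axioms)
  then show ?thesis by blast
qed

lemma (in ring) minus_zero_right: "x \<in> carrier R \<Longrightarrow> x \<ominus> \<zero> = x"
  by (simp add: a_minus_def)

section \<open>Contraction on the tensor square and the two embeddings of L\<close>

context tensor_square
begin

definition \<phi> :: "'l \<Rightarrow> 'm" where "\<phi> x = q [(\<one>, x)]"

definition \<tau> :: "'l \<Rightarrow> 'm" where "\<tau> x = q [(x, \<one>)]"

text \<open>Contraction of an element of M, computed on a chosen representative. Only at forms is
  independence of that choice known, which is why the lemmas about it ask for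
  \<open>g \<in> forms\<close>.\<close>

definition ev :: "'m \<Rightarrow> ('l \<Rightarrow> 'l) \<Rightarrow> 'l" where
  "ev u = pairing (inv_into tensors q u)"

lemma ev_q:
  assumes "g \<in> forms" "ps \<in> tensors"
  shows "ev (q ps) g = pairing ps g"
proof -
  have "inv_into tensors q (q ps) \<in> tensors" "q (inv_into tensors q (q ps)) = q ps"
    using assms(2) by (auto intro: inv_into_into f_inv_into_f)
  then have "tensor_eq (inv_into tensors q (q ps)) ps" using q_eq assms(2) by blast
  then show ?thesis using assms(1) by (simp add: ev_def tensor_eq_def)
qed

lemma carrier_cases:
  assumes "u \<in> carrier M"
  obtains ps where "ps \<in> tensors" "u = q ps"
  using assms carrier_M by auto

lemma q_closed: "ps \<in> tensors \<Longrightarrow> q ps \<in> carrier M"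
  using carrier_M by auto

lemma \<phi>_closed: "x \<in> carrier L \<Longrightarrow> \<phi> x \<in> carrier M"
  and \<tau>_closed: "x \<in> carrier L \<Longrightarrow> \<tau> x \<in> carrier M"
  by (auto simp: \<phi>_def \<tau>_def q_closed)

text \<open>Immediate from the way \<open>tensor_eq\<close> is defined. Identities in M are checked
  through it one form at a time, as identities in L.\<close>

lemma ev_eqI:
  assumes "u \<in> carrier M" "v \<in> carrier M" "\<And>g. g \<in> forms \<Longrightarrow> ev u g = ev v g"
  shows "u = v"
proof -
  obtain ps qs where "ps \<in> tensors" "u = q ps" "qs \<in> tensors" "v = q qs"
    using assms carrier_cases by metis
  then show ?thesis using assms(3) by (auto simp: q_eq tensor_eq_def ev_q)
qed

lemma ev_closed: "u \<in> carrier M \<Longrightarrow> g \<in> forms \<Longrightarrow> ev u g \<in> carrier L"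
  by (erule carrier_cases) (simp add: ev_q pairing_form_closed)

lemma ev_zero: "g \<in> forms \<Longrightarrow> ev \<zero>\<^bsub>M\<^esub> g = \<zero>"
  by (simp add: q_zero ev_q)

lemma ev_add:
  assumes "u \<in> carrier M" "v \<in> carrier M" "g \<in> forms"
  shows "ev (u \<oplus>\<^bsub>M\<^esub> v) g = ev u g \<oplus> ev v g"
proof -
  obtain ps qs where "ps \<in> tensors" "u = q ps" "qs \<in> tensors" "v = q qs"
    using assms carrier_cases by metis
  then show ?thesis using assms(3) by (simp add: q_add ev_q pairing_form_append)
qed

lemma ev_\<phi>_mult:
  assumes "u \<in> carrier M" "x \<in> carrier L" "g \<in> forms"
  shows "ev (\<phi> x \<otimes>\<^bsub>M\<^esub> u) g = ev u (\<lambda>y. g (x \<otimes> y))"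
proof -
  obtain ps where ps: "ps \<in> tensors" "u = q ps" using assms carrier_cases by metis
  have "ev (\<phi> x \<otimes>\<^bsub>M\<^esub> u) g = pairing (tensor_mult [(\<one>, x)] ps) g"
    using ps assms q_mult[of "[(\<one>, x)]" ps] tensor_mult_closed[of "[(\<one>, x)]" ps]
    by (simp add: \<phi>_def ev_q del: tensor_mult_Cons)
  also have "\<dots> = \<one> \<otimes> pairing ps (\<lambda>y. g (x \<otimes> y)) \<oplus> \<zero>"
    using ps assms by (subst pairing_form_mult) auto
  also have "\<dots> = ev u (\<lambda>y. g (x \<otimes> y))"
    using ps assms pairing_form_closed[OF forms_translate[OF assms(3,2)] ps(1)]
      ev_q[OF forms_translate[OF assms(3,2)] ps(1)] by simp
  finally show ?thesis .
qed

text \<open>A left factor leaves the contraction as a scalar, whereas a right factor is absorbed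
  into the form. This asymmetry turns a relation between \<tau>(a) and \<phi>(L) M^\<delta> into a
  relation for a inside L.\<close>

lemma ev_\<tau>_mult:
  assumes "u \<in> carrier M" "x \<in> carrier L" "g \<in> forms"
  shows "ev (\<tau> x \<otimes>\<^bsub>M\<^esub> u) g = x \<otimes> ev u g"
proof -
  obtain ps where ps: "ps \<in> tensors" "u = q ps" using assms carrier_cases by metis
  have "ev (\<tau> x \<otimes>\<^bsub>M\<^esub> u) g = pairing (tensor_mult [(x, \<one>)] ps) g"
    using ps assms q_mult[of "[(x, \<one>)]" ps] tensor_mult_closed[of "[(x, \<one>)]" ps]
    by (simp add: \<tau>_def ev_q del: tensor_mult_Cons)
  also have "\<dots> = x \<otimes> pairing ps (\<lambda>y. g (\<one> \<otimes> y)) \<oplus> \<zero>"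
    using ps assms by (subst pairing_form_mult) auto
  also have "pairing ps (\<lambda>y. g (\<one> \<otimes> y)) = pairing ps g"
    using ps by (intro pairing_cong) auto
  finally show ?thesis
    using ps assms pairing_form_closed[OF assms(3) ps(1)] ev_q[OF assms(3) ps(1)] by simp
qed

lemma ev_der:
  assumes "u \<in> carrier M" "g \<in> forms"
  shows "ev (\<delta>\<^bsub>M\<^esub> u) g = \<delta> (ev u g) \<ominus> ev u (\<lambda>x. \<delta> (g x) \<ominus> g (\<delta> x))"
proof -
  obtain ps where ps: "ps \<in> tensors" "u = q ps" using assms carrier_cases by metis
  then show ?thesis
    using assms forms_der[OF assms(2)] by (simp add: q_der ev_q tensor_der_closed pairing_der)
qed

lemma ev_\<tau>: "x \<in> carrier L \<Longrightarrow> g \<in> forms \<Longrightarrow> ev (\<tau> x) g = x \<otimes> g \<one>"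
  by (simp add: \<tau>_def ev_q formsD)

lemma ev_\<phi>: "x \<in> carrier L \<Longrightarrow> g \<in> forms \<Longrightarrow> ev (\<phi> x) g = g x"
  by (simp add: \<phi>_def ev_q formsD)

lemma ev_forms_add:
  assumes "u \<in> carrier M" "g \<in> forms" "h \<in> forms"
  shows "ev u (\<lambda>x. g x \<oplus> h x) = ev u g \<oplus> ev u h"
proof -
  obtain ps where ps: "ps \<in> tensors" "u = q ps" using assms carrier_cases by metis
  then show ?thesis
    using assms forms_add[OF assms(2,3)] formsD(2)[OF assms(2)] formsD(2)[OF assms(3)]
    by (simp add: ev_q pairing_add)
qed

lemma ev_forms_smult:
  assumes "u \<in> carrier M" "g \<in> forms" "k \<in> K"
  shows "ev u (\<lambda>x. k \<otimes> g x) = k \<otimes> ev u g"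
proof -
  obtain ps where ps: "ps \<in> tensors" "u = q ps" using assms carrier_cases by metis
  then show ?thesis
    using assms forms_smult[OF assms(2,3)] formsD(2)[OF assms(2)] K_carrier[OF assms(3)]
    by (simp add: ev_q pairing_smult)
qed

text \<open>The coefficients \<open>g (snd p)\<close> lie in K, so the left entries of one
  representative span the values at all forms simultaneously.\<close>

lemma ev_in_Span:
  assumes "u \<in> carrier M"
  shows "\<exists>Us. set Us \<subseteq> carrier L \<and> (\<forall>g\<in>forms. ev u g \<in> Span K Us)"
proof -
  obtain ps where ps: "ps \<in> tensors" "u = q ps" using assms carrier_cases by metis
  have fst: "set (map fst ps) \<subseteq> carrier L" using ps(1) by (induction ps) auto
  have "pairing ps g \<in> Span K (map fst ps)" if g: "g \<in> forms" for g
    using ps(1)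
  proof (induction ps)
    case (Cons p ps)
    then have "pairing (p # ps) g = g (snd p) \<otimes> fst p \<oplus> pairing ps g"
      by (auto simp: m_comm formsD(2)[OF g])
    then show ?case
      using Cons formsD(1)[OF g] by (auto simp: line_extension_mem_iff)
  qed simp
  then show ?thesis using fst ps ev_q by (intro exI[of _ "map fst ps"]) auto
qed

lemma \<phi>_hom: "\<phi> \<in> differential_hom L M"
proof -
  note [simp] = \<phi>_closed der_closed
  show ?thesis
    unfolding differential_hom_def
  proof (intro CollectI conjI ballI ring_hom_memI)
    show "\<phi> \<one> = \<one>\<^bsub>M\<^esub>" by (simp add: \<phi>_def q_one)
    fix x assume x: "x \<in> carrier L"
    then show "\<phi> x \<in> carrier M" by simp
    show "\<phi> (\<delta> x) = \<delta>\<^bsub>M\<^esub> (\<phi> x)"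
    proof (rule ev_eqI)
      fix g assume g: "g \<in> forms"
      have "ev (\<delta>\<^bsub>M\<^esub> (\<phi> x)) g = (\<delta> (g x) \<oplus> \<zero>) \<ominus> (\<delta> (g x) \<oplus> \<ominus> g (\<delta> x))"
        using x g formsD(2)[OF g] by (simp add: ev_der ev_\<phi> forms_der a_minus_def[of L "\<delta> (g x)" "g (\<delta> x)"])
      also have "\<dots> = g (\<delta> x)"
        using x formsD(2)[OF g] by (subst add_minus_add_cancel) (auto simp: a_minus_def)
      finally show "ev (\<phi> (\<delta> x)) g = ev (\<delta>\<^bsub>M\<^esub> (\<phi> x)) g" using x g by (simp add: ev_\<phi>)
    qed (use x in \<open>auto simp: M.der_closed\<close>)
    fix y assume y: "y \<in> carrier L"
    show "\<phi> (x \<otimes> y) = \<phi> x \<otimes>\<^bsub>M\<^esub> \<phi> y"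
      using x y by (intro ev_eqI) (auto simp: ev_\<phi> ev_\<phi>_mult forms_translate)
    show "\<phi> (x \<oplus> y) = \<phi> x \<oplus>\<^bsub>M\<^esub> \<phi> y"
      using x y by (intro ev_eqI) (auto simp: ev_\<phi> ev_add formsD(3))
  qed
qed

lemma \<tau>_hom: "\<tau> \<in> differential_hom L M"
proof -
  note [simp] = \<tau>_closed der_closed
  show ?thesis
    unfolding differential_hom_def
  proof (intro CollectI conjI ballI ring_hom_memI)
    show "\<tau> \<one> = \<one>\<^bsub>M\<^esub>" by (simp add: \<tau>_def q_one)
    fix x assume x: "x \<in> carrier L"
    then show "\<tau> x \<in> carrier M" by simp
    show "\<tau> (\<delta> x) = \<delta>\<^bsub>M\<^esub> (\<tau> x)"
    proof (rule ev_eqI)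
      fix g assume g: "g \<in> forms"
      note gD = formsD[OF g]
      have [simp]: "g \<one> \<in> carrier L" "g \<zero> = \<zero>"
        using gD(2)[of \<one>] gD(3)[of \<zero> \<zero>] gD(2)[of \<zero>] by (auto simp: add.l_cancel_one)
      have "ev (\<delta>\<^bsub>M\<^esub> (\<tau> x)) g = (x \<otimes> \<delta> (g \<one>) \<oplus> \<delta> x \<otimes> g \<one>) \<ominus> x \<otimes> \<delta> (g \<one>)"
        using x g ev_\<tau>[OF x forms_der[OF g]]
        by (simp add: ev_\<tau> ev_der der_mult a_comm minus_zero_right)
      also have "\<dots> = (x \<otimes> \<delta> (g \<one>) \<oplus> \<delta> x \<otimes> g \<one>) \<ominus> (x \<otimes> \<delta> (g \<one>) \<oplus> \<zero>)"
        using x by simp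
      also have "\<dots> = \<delta> x \<otimes> g \<one>"
        using x by (subst add_minus_add_cancel) (auto simp: a_minus_def)
      finally show "ev (\<tau> (\<delta> x)) g = ev (\<delta>\<^bsub>M\<^esub> (\<tau> x)) g" using x g by (simp add: ev_\<tau>)
    qed (use x in \<open>auto simp: M.der_closed\<close>)
    fix y assume y: "y \<in> carrier L"
    show "\<tau> (x \<otimes> y) = \<tau> x \<otimes>\<^bsub>M\<^esub> \<tau> y"
      using x y by (intro ev_eqI) (auto simp: ev_\<tau> ev_\<tau>_mult m_assoc formsD(2))
    show "\<tau> (x \<oplus> y) = \<tau> x \<oplus>\<^bsub>M\<^esub> \<tau> y"
      using x y by (intro ev_eqI) (auto simp: ev_\<tau> ev_add l_distr formsD(2))
  qed
qed

text \<open>Scalars of K cross the tensor sign because forms are K-linear.\<close>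

lemma \<tau>_eq_\<phi>: "k \<in> K \<Longrightarrow> \<tau> k = \<phi> k"
proof (intro ev_eqI)
  fix g assume k: "k \<in> K" and g: "g \<in> forms"
  have "g (k \<otimes> \<one>) = k \<otimes> g \<one>" using k formsD(4)[OF g] by blast
  then show "ev (\<tau> k) g = ev (\<phi> k) g" using k g K_carrier by (simp add: ev_\<tau> ev_\<phi>)
qed (auto simp: K_carrier \<phi>_closed \<tau>_closed)

lemma differential_algebra_M: "differential_algebra L M \<phi>"
  unfolding differential_algebra_def
  using \<phi>_hom differential_ring_axioms M.differential_ring_axioms by blast

lemma embedding_\<tau>: "differential_embedding_over K L M \<phi> \<tau>"
  unfolding differential_embedding_over_def
proof (intro conjI ballI)
  show "\<tau> \<in> differential_hom L M" by (rule \<tau>_hom)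
  \<comment> \<open>Contraction with such a form is a left inverse of \<tau>.\<close>
  obtain g where g: "g \<in> forms" "g \<one> = \<one>" using exists_form by blast
  show "inj_on \<tau> (carrier L)"
    by (rule inj_on_inverseI[of _ "\<lambda>u. ev u g"]) (use g in \<open>auto simp: ev_\<tau>\<close>)
  fix k x assume "k \<in> K" "x \<in> carrier L"
  then show "\<tau> (k \<otimes> x) = \<phi> k \<otimes>\<^bsub>M\<^esub> \<tau> x"
    using \<tau>_hom K_carrier \<tau>_eq_\<phi> by (auto simp: differential_hom_def ring_hom_def)
qed

end

subsection \<open>Constants in a differential algebra over a differential field\<close>

locale differential_field_hom = L: differential_field L + M: differential_ring M
  for L :: "('l, 'a) diff_ring_scheme" (structure) and M :: "('m, 'b) diff_ring_scheme" +
  fixes \<phi> :: "'l \<Rightarrow> 'm"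
  assumes hom: "\<phi> \<in> differential_hom L M"
begin

lemma hom_closed [simp]: "x \<in> carrier L \<Longrightarrow> \<phi> x \<in> carrier M"
  and hom_add: "x \<in> carrier L \<Longrightarrow> y \<in> carrier L \<Longrightarrow> \<phi> (x \<oplus> y) = \<phi> x \<oplus>\<^bsub>M\<^esub> \<phi> y"
  and hom_mult: "x \<in> carrier L \<Longrightarrow> y \<in> carrier L \<Longrightarrow> \<phi> (x \<otimes> y) = \<phi> x \<otimes>\<^bsub>M\<^esub> \<phi> y"
  and hom_one: "\<phi> \<one> = \<one>\<^bsub>M\<^esub>"
  and hom_der: "x \<in> carrier L \<Longrightarrow> \<phi> (\<delta> x) = \<delta>\<^bsub>M\<^esub> (\<phi> x)"
  using hom by (auto simp: differential_hom_def ring_hom_def)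

sublocale ring_hom_ring L M \<phi>
  using hom by (intro ring_hom_ringI2 L.ring_axioms M.ring_axioms) (simp add: differential_hom_def)

definition constant_span :: "'m set" where
  "constant_span = sum_prod M (\<phi> ` carrier L) (constants M)"

text \<open>The constants themselves serve as indices, so that shortening a combination means
  removing an element from a set. Nothing is assumed about their independence.\<close>

definition comb :: "'m set \<Rightarrow> ('m \<Rightarrow> 'l) \<Rightarrow> 'm" where
  "comb I l = (\<Oplus>\<^bsub>M\<^esub>c\<in>I. \<phi> (l c) \<otimes>\<^bsub>M\<^esub> c)"

lemma image_subring: "subring (\<phi> ` carrier L) M"
  using img_is_subring[OF L.carrier_is_subring] .

lemmas constant_span_closed_sets = subringE(1)[OF image_subring] M.constants_closed

lemma constant_span_closed: "constant_span \<subseteq> carrier M"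
  unfolding constant_span_def by (intro M.sum_prod_closed constant_span_closed_sets)

lemma constant_span_zero: "\<zero>\<^bsub>M\<^esub> \<in> constant_span"
  unfolding constant_span_def by (rule M.sum_prod_zero)

lemma constant_span_add: "u \<in> constant_span \<Longrightarrow> v \<in> constant_span \<Longrightarrow> u \<oplus>\<^bsub>M\<^esub> v \<in> constant_span"
  unfolding constant_span_def by (rule M.sum_prod_add[OF constant_span_closed_sets])

lemma constant_span_mult: "u \<in> constant_span \<Longrightarrow> v \<in> constant_span \<Longrightarrow> u \<otimes>\<^bsub>M\<^esub> v \<in> constant_span"
  unfolding constant_span_def by (rule M.sum_prod_mult[OF image_subring M.constants_subring])

lemma constant_span_image: "x \<in> carrier L \<Longrightarrow> \<phi> x \<in> constant_span"
  unfolding constant_span_def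
  by (intro M.sum_prod_left_incl constant_span_closed_sets M.constants_subring) auto

lemma constant_span_minus:
  assumes "u \<in> constant_span"
  shows "\<ominus>\<^bsub>M\<^esub> u \<in> constant_span"
proof -
  have "u \<in> carrier M" using assms constant_span_closed by blast
  then have "\<phi> (\<ominus> \<one>) \<otimes>\<^bsub>M\<^esub> u = \<ominus>\<^bsub>M\<^esub> u" by (simp add: M.l_minus)
  then show ?thesis
    using constant_span_mult[OF constant_span_image[of "\<ominus> \<one>"] assms] by simp
qed

lemma constant_span_constant: "c \<in> constants M \<Longrightarrow> c \<in> constant_span"
  unfolding constant_span_def
  by (intro M.sum_prod_right_incl constant_span_closed_sets image_subring) auto

lemma constant_span_induct [consumes 1, case_names zero add mult]:
  assumes "u \<in> constant_span" "P \<zero>\<^bsub>M\<^esub>"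
    and "\<And>u v. u \<in> carrier M \<Longrightarrow> v \<in> carrier M \<Longrightarrow> P u \<Longrightarrow> P v \<Longrightarrow> P (u \<oplus>\<^bsub>M\<^esub> v)"
    and "\<And>x c. x \<in> carrier L \<Longrightarrow> c \<in> constants M \<Longrightarrow> P (\<phi> x \<otimes>\<^bsub>M\<^esub> c)"
  shows "P u"
  using assms(1)[unfolded constant_span_def] constant_span_closed_sets
  by (rule M.sum_prod_induct) (use assms in auto)

lemma constantsD: "c \<in> constants M \<Longrightarrow> c \<in> carrier M" "c \<in> constants M \<Longrightarrow> \<delta>\<^bsub>M\<^esub> c = \<zero>\<^bsub>M\<^esub>"
  by (auto simp: constants_def)

lemma der_hom_mult_constant:
  "x \<in> carrier L \<Longrightarrow> c \<in> constants M \<Longrightarrow> \<delta>\<^bsub>M\<^esub> (\<phi> x \<otimes>\<^bsub>M\<^esub> c) = \<phi> (\<delta> x) \<otimes>\<^bsub>M\<^esub> c"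
  by (simp add: M.der_mult constantsD L.der_closed hom_der[symmetric])

lemma constant_span_der: "u \<in> constant_span \<Longrightarrow> \<delta>\<^bsub>M\<^esub> u \<in> constant_span"
proof (induction rule: constant_span_induct)
  case (mult x c)
  then show ?case
    by (simp add: der_hom_mult_constant L.der_closed constant_span_image constant_span_constant
        constant_span_mult)
qed (auto simp: M.der_add constant_span_zero constant_span_add)

lemma comb_closed: "I \<subseteq> constants M \<Longrightarrow> l \<in> I \<rightarrow> carrier L \<Longrightarrow> comb I l \<in> carrier M"
  unfolding comb_def using constantsD by (intro M.finsum_closed) (auto simp: Pi_iff subset_iff)

lemma comb_cong: "I \<subseteq> constants M \<Longrightarrow> l' \<in> I \<rightarrow> carrier L \<Longrightarrow>
    (\<And>c. c \<in> I \<Longrightarrow> l c = l' c) \<Longrightarrow> comb I l = comb I l'"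
  unfolding comb_def using constantsD by (intro M.finsum_cong') (auto simp: Pi_iff subset_iff)

lemma comb_mono_neutral:
  assumes "J \<subseteq> constants M" "finite J" "I \<subseteq> J" "l \<in> J \<rightarrow> carrier L"
    and "\<And>c. c \<in> J - I \<Longrightarrow> l c = \<zero>"
  shows "comb J l = comb I l"
  unfolding comb_def
proof (rule M.add.finprod_mono_neutral_cong_left[symmetric])
  show "finite J" "I \<subseteq> J" by fact+
  show "\<phi> (l c) \<otimes>\<^bsub>M\<^esub> c = \<zero>\<^bsub>M\<^esub>" if "c \<in> J - I" for c
    using that assms constantsD by (auto simp: hom_zero subset_iff)
  show "(\<lambda>c. \<phi> (l c) \<otimes>\<^bsub>M\<^esub> c) \<in> J \<rightarrow> carrier M" using assms constantsD by (auto simp: Pi_iff subset_iff)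
qed auto

lemma comb_add:
  assumes "I \<subseteq> constants M" "l \<in> I \<rightarrow> carrier L" "l' \<in> I \<rightarrow> carrier L"
  shows "comb I (\<lambda>c. l c \<oplus> l' c) = comb I l \<oplus>\<^bsub>M\<^esub> comb I l'"
proof -
  have "comb I l \<oplus>\<^bsub>M\<^esub> comb I l' = (\<Oplus>\<^bsub>M\<^esub>c\<in>I. \<phi> (l c) \<otimes>\<^bsub>M\<^esub> c \<oplus>\<^bsub>M\<^esub> \<phi> (l' c) \<otimes>\<^bsub>M\<^esub> c)"
    unfolding comb_def using assms constantsD by (intro M.finsum_addf[symmetric]) (auto simp: Pi_iff subset_iff)
  also have "\<dots> = comb I (\<lambda>c. l c \<oplus> l' c)"
    unfolding comb_def using assms constantsD
    by (intro M.finsum_cong') (auto simp: hom_add M.l_distr Pi_iff subset_iff)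
  finally show ?thesis by simp
qed

lemma comb_smult:
  assumes "I \<subseteq> constants M" "l \<in> I \<rightarrow> carrier L" "a \<in> carrier L"
  shows "comb I (\<lambda>c. a \<otimes> l c) = \<phi> a \<otimes>\<^bsub>M\<^esub> comb I l"
proof (cases "finite I")
  case True
  have "\<phi> a \<otimes>\<^bsub>M\<^esub> comb I l = (\<Oplus>\<^bsub>M\<^esub>c\<in>I. \<phi> a \<otimes>\<^bsub>M\<^esub> (\<phi> (l c) \<otimes>\<^bsub>M\<^esub> c))"
    unfolding comb_def using assms constantsD True by (intro M.finsum_rdistr) (auto simp: Pi_iff subset_iff)
  also have "\<dots> = comb I (\<lambda>c. a \<otimes> l c)"
    unfolding comb_def using assms constantsD
    by (intro M.finsum_cong') (auto simp: hom_mult M.m_assoc Pi_iff subset_iff)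
  finally show ?thesis by simp
qed (use assms in \<open>auto simp: comb_def\<close>)

lemma comb_der:
  assumes "I \<subseteq> constants M" "l \<in> I \<rightarrow> carrier L"
  shows "\<delta>\<^bsub>M\<^esub> (comb I l) = comb I (\<lambda>c. \<delta> (l c))"
proof -
  have "\<delta>\<^bsub>M\<^esub> (comb I l) = (\<Oplus>\<^bsub>M\<^esub>c\<in>I. \<delta>\<^bsub>M\<^esub> (\<phi> (l c) \<otimes>\<^bsub>M\<^esub> c))"
    unfolding comb_def using assms constantsD by (intro M.der_finsum) (auto simp: Pi_iff subset_iff)
  also have "\<dots> = comb I (\<lambda>c. \<delta> (l c))"
    unfolding comb_def using assms constantsD
    by (intro M.finsum_cong') (auto simp: der_hom_mult_constant L.der_closed Pi_iff subset_iff)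
  finally show ?thesis .
qed

lemma comb_zero: "I \<subseteq> constants M \<Longrightarrow> comb I (\<lambda>c. \<zero>) = \<zero>\<^bsub>M\<^esub>"
  unfolding comb_def using constantsD
  by (subst M.finsum_cong'[of I I "\<lambda>_. \<zero>\<^bsub>M\<^esub>"]) (auto simp: hom_zero subset_iff)

lemma comb_finsum:
  assumes "I \<subseteq> constants M" "\<And>p. p \<in> P \<Longrightarrow> l p \<in> I \<rightarrow> carrier L" "\<And>p. p \<in> P \<Longrightarrow> a p \<in> carrier L"
  shows "comb I (\<lambda>c. \<Oplus>p\<in>P. a p \<otimes> l p c) = (\<Oplus>\<^bsub>M\<^esub>p\<in>P. \<phi> (a p) \<otimes>\<^bsub>M\<^esub> comb I (l p))"
  using assms(2,3)
proof (induction P rule: infinite_finite_induct)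
  case (insert p P)
  have c: "\<And>c. c \<in> I \<Longrightarrow> (\<lambda>p. a p \<otimes> l p c) \<in> insert p P \<rightarrow> carrier L"
    using insert.prems by (fastforce simp: Pi_iff)
  have "comb I (\<lambda>c. \<Oplus>p\<in>insert p P. a p \<otimes> l p c)
      = comb I (\<lambda>c. a p \<otimes> l p c \<oplus> (\<Oplus>p\<in>P. a p \<otimes> l p c))"
    using c insert.hyps assms(1) by (intro comb_cong) (auto intro!: L.finsum_closed)
  also have "\<dots> = \<phi> (a p) \<otimes>\<^bsub>M\<^esub> comb I (l p) \<oplus>\<^bsub>M\<^esub> comb I (\<lambda>c. \<Oplus>p\<in>P. a p \<otimes> l p c)"
    using c assms(1) insert.prems
    by (subst comb_add) (auto intro!: L.finsum_closed simp: comb_smult)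
  also have "\<dots> = (\<Oplus>\<^bsub>M\<^esub>p\<in>insert p P. \<phi> (a p) \<otimes>\<^bsub>M\<^esub> comb I (l p))"
    using insert assms(1) comb_closed by (simp add: Pi_iff)
  finally show ?case .
qed (auto simp: comb_zero assms(1))

text \<open>The coefficients vanish off the support so that combinations with different supports can
  be padded to their union and added there.\<close>

lemma constant_span_comb:
  "u \<in> constant_span \<Longrightarrow> \<exists>I l. finite I \<and> I \<subseteq> constants M \<and> l \<in> UNIV \<rightarrow> carrier L \<and>
    (\<forall>c. c \<notin> I \<longrightarrow> l c = \<zero>) \<and> u = comb I l"
proof (induction rule: constant_span_induct)
  case zero
  show ?case by (intro exI[of _ "{}"] exI[of _ "\<lambda>_. \<zero>"]) (simp add: comb_def)
next
  case (mult x c)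
  then show ?case
    using constantsD(1) by (intro exI[of _ "{c}"] exI[of _ "\<lambda>d. if d = c then x else \<zero>"])
      (auto simp: comb_def)
next
  case (add u v)
  then obtain I l I' l' where *: "finite I" "I \<subseteq> constants M" "l \<in> UNIV \<rightarrow> carrier L"
    "\<forall>c. c \<notin> I \<longrightarrow> l c = \<zero>" "u = comb I l"
    "finite I'" "I' \<subseteq> constants M" "l' \<in> UNIV \<rightarrow> carrier L" "\<forall>c. c \<notin> I' \<longrightarrow> l' c = \<zero>" "v = comb I' l'"
    by blast
  have "comb (I \<union> I') l = comb I l" "comb (I \<union> I') l' = comb I' l'"
    using * by (intro comb_mono_neutral; auto)+
  then have "u \<oplus>\<^bsub>M\<^esub> v = comb (I \<union> I') (\<lambda>c. l c \<oplus> l' c)"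
    using * by (subst comb_add) auto
  then show ?case using *
    by (intro exI[of _ "I \<union> I'"] exI[of _ "\<lambda>c. l c \<oplus> l' c"]) (auto simp: Pi_iff)
qed

lemma constant_span_comb_family:
  assumes "\<And>i. i < (n::nat) \<Longrightarrow> u i \<in> constant_span"
  shows "\<exists>I l. finite I \<and> I \<subseteq> constants M \<and> (\<forall>i<n. l i \<in> I \<rightarrow> carrier L \<and> u i = comb I (l i))"
proof -
  have "\<forall>i\<in>{..<n}. \<exists>Il. finite (fst Il) \<and> fst Il \<subseteq> constants M \<and> snd Il \<in> UNIV \<rightarrow> carrier L \<and>
    (\<forall>c. c \<notin> fst Il \<longrightarrow> snd Il c = \<zero>) \<and> u i = comb (fst Il) (snd Il)"
    using constant_span_comb assms by fastforce
  from bchoice[OF this] obtain F where F: "\<And>i. i < n \<Longrightarrow> finite (fst (F i)) \<and> fst (F i) \<subseteq> constants M \<and>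
    snd (F i) \<in> UNIV \<rightarrow> carrier L \<and> (\<forall>c. c \<notin> fst (F i) \<longrightarrow> snd (F i) c = \<zero>) \<and>
    u i = comb (fst (F i)) (snd (F i))"
    by blast
  define I where "I = (\<Union>i<n. fst (F i))"
  have I: "finite I" "I \<subseteq> constants M" using F by (auto simp: I_def)
  have "u i = comb I (snd (F i))" if "i < n" for i
    using F[OF that] that I by (auto simp: I_def intro!: comb_mono_neutral[symmetric])
  moreover have "snd (F i) \<in> I \<rightarrow> carrier L" if "i < n" for i
    using F[OF that] by auto
  ultimately show ?thesis using I by (intro exI[of _ I] exI[of _ "\<lambda>i. snd (F i)"]) auto
qed

text \<open>One step of Gaussian elimination with pivot \<open>c0\<close>. It serves two purposes:
  with \<open>comb I m\<close> a constant it splits off a generator, and with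
  \<open>comb I m\<close> zero it removes a dependent constant.\<close>

lemma comb_eliminate:
  assumes "finite I" "I \<subseteq> constants M" "l \<in> I \<rightarrow> carrier L" "m \<in> I \<rightarrow> carrier L"
    and "c0 \<in> I" "m c0 = \<one>"
  shows "comb I l = \<phi> (l c0) \<otimes>\<^bsub>M\<^esub> comb I m \<oplus>\<^bsub>M\<^esub> comb (I - {c0}) (\<lambda>c. l c \<ominus> l c0 \<otimes> m c)"
proof -
  have c: "l c \<in> carrier L" "m c \<in> carrier L" if "c \<in> I" for c using assms that by auto
  have l0: "l c0 \<in> carrier L" using c assms by auto
  have "comb (I - {c0}) (\<lambda>c. l c \<ominus> l c0 \<otimes> m c) = comb I (\<lambda>c. l c \<ominus> l c0 \<otimes> m c)"
    using assms c l0 by (intro comb_mono_neutral[symmetric]) (auto simp: L.r_neg a_minus_def)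
  then have "\<phi> (l c0) \<otimes>\<^bsub>M\<^esub> comb I m \<oplus>\<^bsub>M\<^esub> comb (I - {c0}) (\<lambda>c. l c \<ominus> l c0 \<otimes> m c)
    = comb I (\<lambda>c. l c0 \<otimes> m c \<oplus> (l c \<ominus> l c0 \<otimes> m c))"
    using assms c l0 by (subst comb_add) (auto simp: comb_smult)
  also have "\<dots> = comb I l"
  proof (intro comb_cong)
    fix c assume "c \<in> I"
    then show "l c0 \<otimes> m c \<oplus> (l c \<ominus> l c0 \<otimes> m c) = l c"
      using c l0 by (simp add: a_minus_def L.a_lcomm L.r_neg)
  qed (use assms in auto)
  finally show ?thesis by simp
qed

text \<open>The module spanned by the constants has only the obvious differential submodules: an element
  of minimal support with one coefficient equal to \<open>1\<close> has a derivative of smaller support.\<close>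

lemma differential_submodule_generated_by_constants:
  assumes J: "J \<subseteq> carrier M" "\<And>u v. u \<in> J \<Longrightarrow> v \<in> J \<Longrightarrow> u \<oplus>\<^bsub>M\<^esub> v \<in> J"
    "\<And>x u. x \<in> carrier L \<Longrightarrow> u \<in> J \<Longrightarrow> \<phi> x \<otimes>\<^bsub>M\<^esub> u \<in> J" "\<And>u. u \<in> J \<Longrightarrow> \<delta>\<^bsub>M\<^esub> u \<in> J"
    and u: "u \<in> J" "u \<in> constant_span"
  shows "u \<in> sum_prod M (\<phi> ` carrier L) (J \<inter> constants M)"
proof -
  have sets: "\<phi> ` carrier L \<subseteq> carrier M" "J \<inter> constants M \<subseteq> carrier M" using J by auto
  have "comb I l \<in> sum_prod M (\<phi> ` carrier L) (J \<inter> constants M)"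
    if "finite I" "I \<subseteq> constants M" "l \<in> I \<rightarrow> carrier L" "comb I l \<in> J" for I l
    using that
  proof (induction "card I" arbitrary: I l rule: less_induct)
    case less
    show ?case
    proof (cases "comb I l = \<zero>\<^bsub>M\<^esub>")
      case True
      then show ?thesis by (simp add: M.sum_prod_zero)
    next
      case False
      \<comment> \<open>Support sizes of nonzero elements of J inside I. As the constants in I may
        be dependent, it is the value of the combination that has to be nonzero, not merely a
        coefficient.\<close>
      define Q where "Q n \<longleftrightarrow> (\<exists>I' m. card I' = n \<and> I' \<subseteq> I \<and> m \<in> I' \<rightarrow> carrier L \<and>
        comb I' m \<in> J \<and> comb I' m \<noteq> \<zero>\<^bsub>M\<^esub>)" for n
      have "Q (card I)" unfolding Q_def using less.prems False by blast
      then have Q: "Q (LEAST n. Q n)" by (rule LeastI)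
      then obtain I' m where I': "card I' = (LEAST n. Q n)" "I' \<subseteq> I" and m: "m \<in> I' \<rightarrow> carrier L"
        and mJ: "comb I' m \<in> J" "comb I' m \<noteq> \<zero>\<^bsub>M\<^esub>" unfolding Q_def by blast
      have fin: "finite I'" and const: "I' \<subseteq> constants M"
        using I' less.prems finite_subset by auto
      obtain c0 where c0: "c0 \<in> I'" "m c0 \<noteq> \<zero>"
      proof (rule ccontr)
        assume "\<not> thesis"
        then have "comb I' m = comb I' (\<lambda>_. \<zero>)"
          using that const by (intro comb_cong) auto
        then show False using mJ comb_zero[OF const] by simp
      qed
      have mc0: "m c0 \<in> carrier L" using m c0 by auto
      have inv: "inv (m c0) \<in> carrier L" "m c0 \<otimes> inv (m c0) = \<one>" "inv (m c0) \<otimes> m c0 = \<one>"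
        using c0 mc0 by (auto simp: L.field_Units)
      define k where "k c = inv (m c0) \<otimes> m c" for c
      define z where "z = comb I' k"
      have k: "k \<in> I' \<rightarrow> carrier L" "k c0 = \<one>" using m inv by (auto simp: k_def Pi_iff)
      have z: "z = \<phi> (inv (m c0)) \<otimes>\<^bsub>M\<^esub> comb I' m"
        unfolding z_def k_def using const m inv by (simp add: comb_smult)
      have zJ: "z \<in> J" unfolding z using J mJ inv by auto
      have dz: "\<delta>\<^bsub>M\<^esub> z = comb (I' - {c0}) (\<lambda>c. \<delta> (k c))"
        unfolding z_def comb_der[OF const k(1)]
        using const fin k by (intro comb_mono_neutral) (auto simp: L.der_closed Pi_iff)
      have "\<delta>\<^bsub>M\<^esub> z = \<zero>\<^bsub>M\<^esub>"
      proof (rule ccontr)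
        assume "\<delta>\<^bsub>M\<^esub> z \<noteq> \<zero>\<^bsub>M\<^esub>"
        then have "Q (card (I' - {c0}))"
          unfolding Q_def using dz J(4)[OF zJ] I' k
          by (intro exI[of _ "I' - {c0}"] exI[of _ "\<lambda>c. \<delta> (k c)"]) (auto simp: L.der_closed Pi_iff)
        then have "(LEAST n. Q n) \<le> card (I' - {c0})" by (rule Least_le)
        then show False using I'(1) fin c0(1) by (metis card_Diff1_less linorder_not_less)
      qed
      then have zc: "z \<in> J \<inter> constants M" using zJ J(1) by (auto simp: constants_def)
      define k' where "k' c = (if c \<in> I' then k c else \<zero>)" for c
      have k': "k' \<in> I \<rightarrow> carrier L" "k' c0 = \<one>" using k c0 by (auto simp: k'_def)
      have zk: "z = comb I k'"
      proof -
        have "comb I k' = comb I' k'"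
          using less.prems I' k' by (intro comb_mono_neutral) (auto simp: k'_def)
        also have "\<dots> = comb I' k" using const k by (intro comb_cong) (auto simp: k'_def)
        finally show ?thesis by (simp add: z_def)
      qed
      \<comment> \<open>Subtracting a multiple of the constant z stays inside J and clears the
        coefficient at \<open>c0\<close>, so the induction hypothesis applies to the
        remainder.\<close>
      define w where "w = comb (I - {c0}) (\<lambda>c. l c \<ominus> l c0 \<otimes> k' c)"
      have c0I: "c0 \<in> I" and lc0: "l c0 \<in> carrier L" using c0 I' less.prems by auto
      have dec: "comb I l = \<phi> (l c0) \<otimes>\<^bsub>M\<^esub> z \<oplus>\<^bsub>M\<^esub> w"
        unfolding zk w_def using less.prems k' c0I by (intro comb_eliminate) auto
      have lw: "(\<lambda>c. l c \<ominus> l c0 \<otimes> k' c) \<in> I - {c0} \<rightarrow> carrier L"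
        using less.prems k' lc0 by (auto simp: Pi_iff)
      have wM: "w \<in> carrier M" unfolding w_def using less.prems lw by (intro comb_closed) auto
      have pz: "\<phi> (l c0) \<otimes>\<^bsub>M\<^esub> z \<in> carrier M" "\<phi> (l c0) \<otimes>\<^bsub>M\<^esub> z \<in> J" using J lc0 zJ by auto
      \<comment> \<open>Closure of J under subtraction comes from addition and multiplication by
        \<phi>(-1).\<close>
      have "\<phi> (\<ominus> \<one>) \<otimes>\<^bsub>M\<^esub> (\<phi> (l c0) \<otimes>\<^bsub>M\<^esub> z) \<oplus>\<^bsub>M\<^esub> comb I l \<in> J"
        using less.prems(4) by (intro J(2) J(3)[OF _ pz(2)]) auto
      also have "\<phi> (\<ominus> \<one>) \<otimes>\<^bsub>M\<^esub> (\<phi> (l c0) \<otimes>\<^bsub>M\<^esub> z) \<oplus>\<^bsub>M\<^esub> comb I l = w"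
        unfolding dec using pz wM by (simp add: M.l_minus M.r_neg1)
      finally have "w \<in> J" .
      moreover have "card (I - {c0}) < card I" using less.prems c0I by (intro card_Diff1_less) auto
      ultimately have "w \<in> sum_prod M (\<phi> ` carrier L) (J \<inter> constants M)"
        unfolding w_def using less.prems lw by (intro less.hyps) auto
      then show ?thesis
        unfolding dec using zc lc0 by (intro M.sum_prod_add sets M.sum_prod_single) auto
    qed
  qed
  then show ?thesis using constant_span_comb[OF u(2)] u(1) by blast
qed

definition solution :: "nat \<Rightarrow> (nat \<Rightarrow> nat \<Rightarrow> 'l) \<Rightarrow> (nat \<Rightarrow> 'l) \<Rightarrow> bool" where
  "solution n A v \<longleftrightarrow> (\<forall>i<n. v i \<in> carrier L \<and> \<delta> (v i) = (\<Oplus>p\<in>{..<n}. A i p \<otimes> v p))"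

text \<open>The coefficients of a solution with respect to independent constants are solutions over \<open>L\<close>;
  a dependency among the constants shortens the representation.\<close>

lemma solution_in_constant_span:
  assumes A: "\<And>i p. i < n \<Longrightarrow> p < n \<Longrightarrow> A i p \<in> carrier L"
    and f: "\<And>i. i < n \<Longrightarrow> f i \<in> carrier L"
    and ann: "\<And>v. solution n A v \<Longrightarrow> (\<Oplus>i\<in>{..<n}. f i \<otimes> v i) = \<zero>"
    and u: "\<And>i. i < n \<Longrightarrow> u i \<in> constant_span"
    and du: "\<And>i. i < n \<Longrightarrow> \<delta>\<^bsub>M\<^esub> (u i) = (\<Oplus>\<^bsub>M\<^esub>p\<in>{..<n}. \<phi> (A i p) \<otimes>\<^bsub>M\<^esub> u p)"
  shows "(\<Oplus>\<^bsub>M\<^esub>i\<in>{..<n}. \<phi> (f i) \<otimes>\<^bsub>M\<^esub> u i) = \<zero>\<^bsub>M\<^esub>"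
proof -
  have *: "(\<Oplus>\<^bsub>M\<^esub>i\<in>{..<n}. \<phi> (f i) \<otimes>\<^bsub>M\<^esub> u i) = \<zero>\<^bsub>M\<^esub>"
    if "finite I" "I \<subseteq> constants M" "\<And>i. i < n \<Longrightarrow> l i \<in> I \<rightarrow> carrier L"
      "\<And>i. i < n \<Longrightarrow> u i = comb I (l i)" for I l
    using that
  proof (induction "card I" arbitrary: I l rule: less_induct)
    case less
    \<comment> \<open>The defect of the coefficients. If it vanishes everywhere, every c yields a
      solution over L, to which \<open>ann\<close> applies; a nonzero entry in row i yields a
      relation among the constants.\<close>
    define w where "w i c = \<delta> (l i c) \<ominus> (\<Oplus>p\<in>{..<n}. A i p \<otimes> l p c)" for i c
    have lc: "l i c \<in> carrier L" if "i < n" "c \<in> I" for i c using less.prems(3) that by blast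
    have sc: "(\<Oplus>p\<in>{..<n}. A i p \<otimes> l p c) \<in> carrier L" if "i < n" "c \<in> I" for i c
      using A lc that by (intro L.finsum_closed) auto
    have wc: "w i c \<in> carrier L" if "i < n" "c \<in> I" for i c
      unfolding w_def using lc sc that L.der_closed by auto
    show ?case
    proof (cases "\<forall>i<n. \<forall>c\<in>I. w i c = \<zero>")
      case True
      have sol: "solution n A (\<lambda>i. l i c)" if "c \<in> I" for c
        unfolding solution_def using True lc sc that L.der_closed by (auto simp: w_def)
      have "(\<Oplus>\<^bsub>M\<^esub>i\<in>{..<n}. \<phi> (f i) \<otimes>\<^bsub>M\<^esub> u i) = (\<Oplus>\<^bsub>M\<^esub>i\<in>{..<n}. \<phi> (f i) \<otimes>\<^bsub>M\<^esub> comb I (l i))"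
        using less.prems comb_closed f by (intro M.finsum_cong') (auto simp: Pi_iff subset_iff)
      also have "\<dots> = comb I (\<lambda>c. \<Oplus>i\<in>{..<n}. f i \<otimes> l i c)"
        using less.prems f by (intro comb_finsum[symmetric]) auto
      also have "\<dots> = comb I (\<lambda>c. \<zero>)"
        using less.prems ann[OF sol] by (intro comb_cong) auto
      finally show ?thesis using comb_zero less.prems by simp
    next
      case False
      then obtain i c0 where i: "i < n" and c0: "c0 \<in> I" "w i c0 \<noteq> \<zero>" by blast
      \<comment> \<open>The derivative of \<open>u i\<close> is computed twice, from the
        coefficients and from the equation.\<close>
      have "comb I (w i) = \<zero>\<^bsub>M\<^esub>"
      proof -
        have "comb I (\<lambda>c. \<delta> (l i c)) = comb I (\<lambda>c. w i c \<oplus> (\<Oplus>p\<in>{..<n}. A i p \<otimes> l p c))"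
          using less.prems(2) i lc sc wc L.der_closed
          by (intro comb_cong) (auto simp: w_def a_minus_def L.a_assoc L.l_neg)
        also have "\<dots> = comb I (w i) \<oplus>\<^bsub>M\<^esub> comb I (\<lambda>c. \<Oplus>p\<in>{..<n}. A i p \<otimes> l p c)"
          using less.prems(2) i sc wc by (intro comb_add) auto
        also have "comb I (\<lambda>c. \<Oplus>p\<in>{..<n}. A i p \<otimes> l p c)
            = (\<Oplus>\<^bsub>M\<^esub>p\<in>{..<n}. \<phi> (A i p) \<otimes>\<^bsub>M\<^esub> comb I (l p))"
          using less.prems A i by (intro comb_finsum) auto
        also have "\<dots> = (\<Oplus>\<^bsub>M\<^esub>p\<in>{..<n}. \<phi> (A i p) \<otimes>\<^bsub>M\<^esub> u p)"
          using less.prems A i u constant_span_closed by (intro M.finsum_cong') (auto simp: Pi_iff subset_iff)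
        also have "\<dots> = comb I (\<lambda>c. \<delta> (l i c))"
          using du[OF i] less.prems(4)[OF i] comb_der[OF less.prems(2) less.prems(3)[OF i]] by simp
        finally have "comb I (\<lambda>c. \<delta> (l i c)) = comb I (w i) \<oplus>\<^bsub>M\<^esub> comb I (\<lambda>c. \<delta> (l i c))" .
        moreover have "comb I (w i) \<in> carrier M" "comb I (\<lambda>c. \<delta> (l i c)) \<in> carrier M"
          using wc[OF i] lc[OF i] L.der_closed by (auto intro!: comb_closed[OF less.prems(2)])
        ultimately show ?thesis using M.add.r_cancel_one' by blast
      qed
      define m where "m c = inv (w i c0) \<otimes> w i c" for c
      have inv: "inv (w i c0) \<in> carrier L" "inv (w i c0) \<otimes> w i c0 = \<one>"
        using c0 wc[OF i] by (auto simp: L.field_Units)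
      have m: "m \<in> I \<rightarrow> carrier L" "m c0 = \<one>" using inv wc[OF i] by (auto simp: m_def Pi_iff)
      have m0: "comb I m = \<zero>\<^bsub>M\<^esub>"
        unfolding m_def using less.prems(2) wc[OF i] inv \<open>comb I (w i) = \<zero>\<^bsub>M\<^esub>\<close>
        by (subst comb_smult) auto
      show ?thesis
      proof (rule less.hyps)
        show "card (I - {c0}) < card I" using less.prems c0 by (intro card_Diff1_less) auto
        show "finite (I - {c0})" "I - {c0} \<subseteq> constants M" using less.prems by auto
        fix j assume j: "j < n"
        show "(\<lambda>c. l j c \<ominus> l j c0 \<otimes> m c) \<in> I - {c0} \<rightarrow> carrier L"
          using lc[OF j] m c0 by (auto simp: Pi_iff)
        then have "comb (I - {c0}) (\<lambda>c. l j c \<ominus> l j c0 \<otimes> m c) \<in> carrier M"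
          using less.prems by (intro comb_closed) auto
        then show "u j = comb (I - {c0}) (\<lambda>c. l j c \<ominus> l j c0 \<otimes> m c)"
          using comb_eliminate[OF less.prems(1,2) less.prems(3)[OF j] m(1) c0(1) m(2)]
            less.prems(4)[OF j] m0 lc[OF j c0(1)] by simp
      qed
    qed
  qed
  obtain I l where Il: "finite I" "I \<subseteq> constants M"
    "\<forall>i<n. l i \<in> I \<rightarrow> carrier L \<and> u i = comb I (l i)"
    using constant_span_comb_family[of n u] u by auto
  show ?thesis by (rule *[OF Il(1,2), of l]) (use Il(3) in auto)
qed

end

subsection \<open>Fundamental matrices\<close>

lemma (in cring) finsum_exchange:
  assumes "finite J" "\<And>i j. i \<in> I \<Longrightarrow> j \<in> J \<Longrightarrow> f i j \<in> carrier R"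
  shows "(\<Oplus>i\<in>I. \<Oplus>j\<in>J. f i j) = (\<Oplus>j\<in>J. \<Oplus>i\<in>I. f i j)"
  using assms
proof (induction J)
  case empty
  then show ?case by simp
next
  case (insert j J)
  have "(\<Oplus>i\<in>I. \<Oplus>j\<in>insert j J. f i j) = (\<Oplus>i\<in>I. f i j \<oplus> (\<Oplus>j\<in>J. f i j))"
    using insert by (intro finsum_cong') (auto intro!: finsum_closed)
  also have "\<dots> = (\<Oplus>i\<in>I. f i j) \<oplus> (\<Oplus>i\<in>I. \<Oplus>j\<in>J. f i j)"
    using insert by (intro finsum_addf) (auto intro!: finsum_closed)
  also have "\<dots> = (\<Oplus>j\<in>insert j J. \<Oplus>i\<in>I. f i j)"
    using insert by (simp add: Pi_iff)
  finally show ?case .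
qed

lemma (in cring) finsum_assoc_mult:
  fixes n :: nat
  assumes a: "\<And>j. j < n \<Longrightarrow> a j \<in> carrier R"
    and B: "\<And>j p. j < n \<Longrightarrow> p < n \<Longrightarrow> B j p \<in> carrier R"
    and v: "\<And>p. p < n \<Longrightarrow> v p \<in> carrier R"
  shows "(\<Oplus>j\<in>{..<n}. a j \<otimes> (\<Oplus>p\<in>{..<n}. B j p \<otimes> v p))
    = (\<Oplus>p\<in>{..<n}. (\<Oplus>j\<in>{..<n}. a j \<otimes> B j p) \<otimes> v p)"
proof -
  have "(\<Oplus>j\<in>{..<n}. a j \<otimes> (\<Oplus>p\<in>{..<n}. B j p \<otimes> v p))
      = (\<Oplus>j\<in>{..<n}. \<Oplus>p\<in>{..<n}. a j \<otimes> B j p \<otimes> v p)"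
    using assms by (intro finsum_cong') (auto simp: finsum_rdistr m_assoc Pi_iff intro!: finsum_cong' finsum_closed)
  also have "\<dots> = (\<Oplus>p\<in>{..<n}. \<Oplus>j\<in>{..<n}. a j \<otimes> B j p \<otimes> v p)"
    using assms by (intro finsum_exchange) auto
  also have "\<dots> = (\<Oplus>p\<in>{..<n}. (\<Oplus>j\<in>{..<n}. a j \<otimes> B j p) \<otimes> v p)"
    using assms by (intro finsum_cong') (auto simp: finsum_ldistr Pi_iff intro!: finsum_closed)
  finally show ?thesis .
qed

lemma (in cring) finsum_mat_one:
  fixes n :: nat
  assumes "\<And>p. p < n \<Longrightarrow> v p \<in> carrier R" "i < n"
  shows "(\<Oplus>p\<in>{..<n}. mat_one R i p \<otimes> v p) = v i"
proof -
  have "(\<Oplus>p\<in>{..<n}. mat_one R i p \<otimes> v p) = (\<Oplus>p\<in>{..<n}. if i = p then v p else \<zero>)"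
    using assms by (intro finsum_cong') (auto simp: mat_one_def)
  also have "\<dots> = v i" using assms by (intro finsum_singleton) auto
  finally show ?thesis .
qed

lemma (in cring) mat_one_mult_vec:
  fixes n :: nat
  assumes "mat_entries_in n (carrier R) A" "mat_entries_in n (carrier R) B"
    and "mat_eq n (mat_prod R n A B) (mat_one R)"
    and "\<And>p. p < n \<Longrightarrow> v p \<in> carrier R" "i < n"
  shows "(\<Oplus>j\<in>{..<n}. A i j \<otimes> (\<Oplus>p\<in>{..<n}. B j p \<otimes> v p)) = v i"
proof -
  have "(\<Oplus>j\<in>{..<n}. A i j \<otimes> (\<Oplus>p\<in>{..<n}. B j p \<otimes> v p))
      = (\<Oplus>p\<in>{..<n}. (\<Oplus>j\<in>{..<n}. A i j \<otimes> B j p) \<otimes> v p)"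
    using assms by (intro finsum_assoc_mult) (auto simp: mat_entries_in_def)
  also have "\<dots> = (\<Oplus>p\<in>{..<n}. mat_one R i p \<otimes> v p)"
    using assms by (intro finsum_cong') (auto simp: mat_eq_def mat_prod_def mat_one_def)
  finally show ?thesis using finsum_mat_one assms(4,5) by simp
qed

text \<open>Columns of an invertible matrix are exchanged for vectors of \<open>S\<close> one at a time: row \<open>k\<close> of the
  inverse does not vanish on \<open>S\<close>, so column \<open>k\<close> can be replaced.\<close>

lemma (in field) exists_invertible_columns:
  fixes n :: nat
  assumes S: "\<And>v i. v \<in> S \<Longrightarrow> i < n \<Longrightarrow> v i \<in> carrier R"
    and ann: "\<And>f. (\<And>i. i < n \<Longrightarrow> f i \<in> carrier R) \<Longrightarrow>
      (\<And>v. v \<in> S \<Longrightarrow> (\<Oplus>i\<in>{..<n}. f i \<otimes> v i) = \<zero>) \<Longrightarrow> (\<And>i. i < n \<Longrightarrow> f i = \<zero>)"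
  shows "\<exists>Y\<in>GL n R. \<forall>j<n. (\<lambda>i. Y i j) \<in> S"
proof -
  have "\<exists>P B. mat_entries_in n (carrier R) P \<and> mat_entries_in n (carrier R) B \<and>
      mat_eq n (mat_prod R n P B) (mat_one R) \<and> mat_eq n (mat_prod R n B P) (mat_one R) \<and>
      (\<forall>j<k. (\<lambda>i. P i j) \<in> S)" if "k \<le> n" for k
    using that
  proof (induction k)
    case 0
    have "mat_eq n (mat_prod R n (mat_one R) (mat_one R)) (mat_one R)"
      unfolding mat_eq_def mat_prod_def
      by (intro allI impI finsum_mat_one) (auto simp: mat_one_def)
    moreover have "mat_entries_in n (carrier R) (mat_one R)"
      by (auto simp: mat_entries_in_def mat_one_def)
    ultimately show ?case by blast
  next
    case (Suc k)
    then obtain P B where P: "mat_entries_in n (carrier R) P" and B: "mat_entries_in n (carrier R) B"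
      and PB: "mat_eq n (mat_prod R n P B) (mat_one R)"
      and BP: "mat_eq n (mat_prod R n B P) (mat_one R)"
      and PS: "\<forall>j<k. (\<lambda>i. P i j) \<in> S" by auto
    have k: "k < n" using Suc by simp
    have Pc: "P i j \<in> carrier R" and Bc: "B i j \<in> carrier R" if "i < n" "j < n" for i j
      using P B that by (auto simp: mat_entries_in_def)
    have BPe: "(\<Oplus>p\<in>{..<n}. B i p \<otimes> P p j) = mat_one R i j"
      and PBe: "(\<Oplus>p\<in>{..<n}. P i p \<otimes> B p j) = mat_one R i j" if "i < n" "j < n" for i j
      using BP PB that by (auto simp: mat_eq_def mat_prod_def)
    obtain v where v: "v \<in> S" and ne: "(\<Oplus>i\<in>{..<n}. B k i \<otimes> v i) \<noteq> \<zero>"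
    proof (rule ccontr)
      assume none: "\<not> thesis"
      have "B k i = \<zero>" if "i < n" for i
        by (rule ann) (use none that Bc k \<open>\<And>v. v \<in> S \<Longrightarrow> _ \<Longrightarrow> thesis\<close> in auto)
      then have "(\<Oplus>p\<in>{..<n}. B k p \<otimes> P p k) = (\<Oplus>p\<in>{..<n}. \<zero>)"
        using Pc k by (intro finsum_cong') auto
      then show False using BPe[OF k k] by (simp add: mat_one_def finsum_zero)
    qed
    have vc: "v i \<in> carrier R" if "i < n" for i using S v that by blast
    \<comment> \<open>Coordinates of v in the columns of P; \<open>b k\<close> is the pivot of the
      exchange.\<close>
    define b where "b i = (\<Oplus>p\<in>{..<n}. B i p \<otimes> v p)" for i
    have bc: "b i \<in> carrier R" if "i < n" for i
      unfolding b_def using Bc vc that by (intro finsum_closed) auto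
    have bk: "b k \<noteq> \<zero>" using ne by (simp add: b_def)
    define s where "s = inv (b k)"
    have s: "s \<in> carrier R" "s \<otimes> b k = \<one>"
      unfolding s_def using bk bc[OF k] by (auto simp: field_Units)
    define P' where "P' i j = (if j = k then v i else P i j)" for i j
    \<comment> \<open>The new matrix is P' = P E, where E is the identity matrix with column k
      replaced by b. Accordingly B' is B multiplied on the left by the inverse of E.\<close>
    define B' where "B' i j = (if i = k then s \<otimes> B k j else B i j \<ominus> b i \<otimes> s \<otimes> B k j)" for i j
    have P'c: "P' i j \<in> carrier R" and B'c: "B' i j \<in> carrier R" if "i < n" "j < n" for i j
      using that Pc Bc vc bc s k by (auto simp: P'_def B'_def)
    have Pb: "(\<Oplus>p\<in>{..<n}. P i p \<otimes> b p) = v i" if "i < n" for i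
      unfolding b_def by (rule mat_one_mult_vec[OF P B PB vc that])
    have row: "(\<Oplus>p\<in>{..<n}. B' i p \<otimes> x p) = (if i = k then s \<otimes> (\<Oplus>p\<in>{..<n}. B k p \<otimes> x p)
        else (\<Oplus>p\<in>{..<n}. B i p \<otimes> x p) \<ominus> b i \<otimes> s \<otimes> (\<Oplus>p\<in>{..<n}. B k p \<otimes> x p))"
      if i: "i < n" and x: "\<And>p. p < n \<Longrightarrow> x p \<in> carrier R" for i x
    proof (cases "i = k")
      case True
      then show ?thesis
        using Bc k s x by (simp add: B'_def finsum_rdistr m_assoc Pi_iff cong: finsum_cong)
    next
      case False
      define t where "t = \<ominus> (b i \<otimes> s)"
      have t: "t \<in> carrier R" using bc[OF i] s by (simp add: t_def)
      have "(\<Oplus>p\<in>{..<n}. B' i p \<otimes> x p) = (\<Oplus>p\<in>{..<n}. B i p \<otimes> x p \<oplus> t \<otimes> (B k p \<otimes> x p))"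
        using False Bc[OF i] Bc[OF k] x t bc[OF i] s
        by (intro finsum_cong') (auto simp: B'_def t_def a_minus_def l_distr l_minus m_assoc)
      also have "\<dots> = (\<Oplus>p\<in>{..<n}. B i p \<otimes> x p) \<oplus> (\<Oplus>p\<in>{..<n}. t \<otimes> (B k p \<otimes> x p))"
        using Bc[OF i] Bc[OF k] x t by (intro finsum_addf) auto
      also have "(\<Oplus>p\<in>{..<n}. t \<otimes> (B k p \<otimes> x p)) = t \<otimes> (\<Oplus>p\<in>{..<n}. B k p \<otimes> x p)"
        using Bc[OF k] x t by (intro finsum_rdistr[symmetric]) auto
      finally show ?thesis
        using False t bc[OF i] s Bc[OF k] x
        by (simp add: t_def a_minus_def l_minus Pi_iff)
    qed
    have "mat_eq n (mat_prod R n B' P') (mat_one R)"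
      unfolding mat_eq_def mat_prod_def
    proof (intro allI impI)
      fix i j assume ij: "i < n" "j < n"
      show "(\<Oplus>p\<in>{..<n}. B' i p \<otimes> P' p j) = mat_one R i j"
      proof (cases "j = k")
        case True
        have "(\<Oplus>p\<in>{..<n}. B' i p \<otimes> P' p j) = (\<Oplus>p\<in>{..<n}. B' i p \<otimes> v p)"
          using True by (simp add: P'_def)
        also have "\<dots> = (if i = k then s \<otimes> b k else b i \<ominus> b i \<otimes> s \<otimes> b k)"
          using row[of i v] ij vc by (simp add: b_def)
        also have "\<dots> = mat_one R i j"
          using True s bc ij k by (auto simp: mat_one_def m_assoc a_minus_def r_neg)
        finally show ?thesis .
      next
        case False
        have "(\<Oplus>p\<in>{..<n}. B' i p \<otimes> P' p j) = (\<Oplus>p\<in>{..<n}. B' i p \<otimes> P p j)"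
          using False by (simp add: P'_def)
        also have "\<dots> = (if i = k then s \<otimes> mat_one R k j
            else mat_one R i j \<ominus> b i \<otimes> s \<otimes> mat_one R k j)"
          using row[of i "\<lambda>p. P p j"] ij Pc k BPe by auto
        also have "\<dots> = mat_one R i j"
          using False s bc ij k by (auto simp: mat_one_def a_minus_def)
        finally show ?thesis .
      qed
    qed
    moreover have "mat_eq n (mat_prod R n P' B') (mat_one R)"
      unfolding mat_eq_def mat_prod_def
    proof (intro allI impI)
      fix i j assume ij: "i < n" "j < n"
      \<comment> \<open>The entry of B' in row k. Apart from the term at k, the product P'B'
        contains \<open>c \<otimes> X2\<close> twice, once from the new column v and once, with
        opposite sign, from the correction of the other rows.\<close>
      define c where "c = s \<otimes> B k j"
      have c: "c \<in> carrier R" using s Bc k ij by (simp add: c_def)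
      have bkc: "b k \<otimes> c = B k j"
        using s Bc k ij bc by (simp add: c_def m_assoc[symmetric] m_comm[of "b k"])
      have split: "(\<Oplus>p\<in>{..<n}. h p) = h k \<oplus> (\<Oplus>p\<in>{..<n} - {k}. h p)"
        if "\<And>p. p < n \<Longrightarrow> h p \<in> carrier R" for h
      proof -
        have "(\<Oplus>p\<in>insert k ({..<n} - {k}). h p) = h k \<oplus> (\<Oplus>p\<in>{..<n} - {k}. h p)"
          using that k by (intro finsum_insert) auto
        then show ?thesis using k by (simp add: insert_absorb)
      qed
      have cl: "(\<Oplus>p\<in>{..<n} - {k}. h p) \<in> carrier R"
        if "\<And>p. p < n \<Longrightarrow> h p \<in> carrier R" for h
        using that by (intro finsum_closed) auto
      define X1 X2 where "X1 = (\<Oplus>p\<in>{..<n} - {k}. P i p \<otimes> B p j)"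
        and "X2 = (\<Oplus>p\<in>{..<n} - {k}. P i p \<otimes> b p)"
      have Xc: "X1 \<in> carrier R" "X2 \<in> carrier R"
        unfolding X1_def X2_def using Pc Bc bc ij by (auto intro!: cl)
      have v: "v i = P i k \<otimes> b k \<oplus> X2"
        unfolding X2_def Pb[OF ij(1), symmetric] using Pc bc ij k by (intro split) auto
      have one: "mat_one R i j = P i k \<otimes> B k j \<oplus> X1"
        unfolding X1_def PBe[OF ij, symmetric] using Pc Bc ij k by (intro split) auto
      have "(\<Oplus>p\<in>{..<n}. P' i p \<otimes> B' p j) = v i \<otimes> c \<oplus> (\<Oplus>p\<in>{..<n} - {k}. P' i p \<otimes> B' p j)"
        using split[of "\<lambda>p. P' i p \<otimes> B' p j"] P'c B'c ij by (simp add: P'_def B'_def c_def)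
      also have "(\<Oplus>p\<in>{..<n} - {k}. P' i p \<otimes> B' p j)
          = (\<Oplus>p\<in>{..<n} - {k}. P i p \<otimes> B p j \<oplus> \<ominus> c \<otimes> (P i p \<otimes> b p))"
        using Pc Bc bc s c ij k
        by (intro finsum_cong')
          (auto simp: P'_def B'_def c_def a_minus_def r_distr r_minus l_minus m_ac)
      also have "\<dots> = X1 \<oplus> (\<Oplus>p\<in>{..<n} - {k}. \<ominus> c \<otimes> (P i p \<otimes> b p))"
        unfolding X1_def using Pc Bc bc c ij by (intro finsum_addf) auto
      also have "(\<Oplus>p\<in>{..<n} - {k}. \<ominus> c \<otimes> (P i p \<otimes> b p)) = \<ominus> c \<otimes> X2"
        unfolding X2_def using Pc bc c ij by (intro finsum_rdistr[symmetric]) auto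
      also have "v i \<otimes> c \<oplus> (X1 \<oplus> \<ominus> c \<otimes> X2) = P i k \<otimes> (b k \<otimes> c) \<oplus> X1 \<oplus> (c \<otimes> X2 \<oplus> \<ominus> (c \<otimes> X2))"
        unfolding v using Pc[OF ij(1) k] bc[OF k] c Xc
        by (simp add: l_distr l_minus m_assoc m_comm[of X2 c] a_ac)
      also have "\<dots> = mat_one R i j"
        unfolding bkc one using Pc[OF ij(1) k] Bc[OF k ij(2)] c Xc by (simp add: r_neg)
      finally show "(\<Oplus>p\<in>{..<n}. P' i p \<otimes> B' p j) = mat_one R i j" .
    qed
    moreover have "\<forall>j<Suc k. (\<lambda>i. P' i j) \<in> S"
      using PS \<open>v \<in> S\<close> by (auto simp: P'_def less_Suc_eq)
    ultimately show ?case
      using P'c B'c by (intro exI[of _ P'] exI[of _ B']) (auto simp: mat_entries_in_def)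
  qed
  from this[of n] show ?thesis by (auto simp: GL_def)
qed

text \<open>If \<open>v = Y w\<close> and \<open>Y' = A Y\<close>, then \<open>v' = A v + Y w'\<close>.\<close>

lemma (in differential_ring) fundamental_matrix:
  fixes n :: nat
  assumes A: "mat_entries_in n (carrier R) A"
    and Y: "mat_entries_in n (carrier R) Y" and Z: "mat_entries_in n (carrier R) Z"
    and YZ: "mat_eq n (mat_prod R n Y Z) (mat_one R)"
    and ZY: "mat_eq n (mat_prod R n Z Y) (mat_one R)"
    and dY: "mat_eq n (\<lambda>i j. \<delta> (Y i j)) (mat_prod R n A Y)"
    and v: "\<And>i. i < n \<Longrightarrow> v i \<in> carrier R"
    and dv: "\<And>i. i < n \<Longrightarrow> \<delta> (v i) = (\<Oplus>p\<in>{..<n}. A i p \<otimes> v p)"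
  obtains w where "\<And>i. i < n \<Longrightarrow> w i \<in> constants R"
    and "\<And>i. i < n \<Longrightarrow> v i = (\<Oplus>p\<in>{..<n}. Y i p \<otimes> w p)"
proof
  define w where "w i = (\<Oplus>p\<in>{..<n}. Z i p \<otimes> v p)" for i
  have Ac: "A i j \<in> carrier R" and Yc: "Y i j \<in> carrier R" and Zc: "Z i j \<in> carrier R"
    if "i < n" "j < n" for i j
    using A Y Z that by (auto simp: mat_entries_in_def)
  have wc: "w i \<in> carrier R" if "i < n" for i
    unfolding w_def using Zc v that by (intro finsum_closed) auto
  have dwc: "\<delta> (w i) \<in> carrier R" if "i < n" for i using wc der_closed that by blast
  show vY: "v i = (\<Oplus>p\<in>{..<n}. Y i p \<otimes> w p)" if "i < n" for i
    unfolding w_def by (rule mat_one_mult_vec[OF Y Z YZ v that, symmetric])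
  \<comment> \<open>Both v' = A v and v' = A v + Y w' hold, so Y w' vanishes; multiplying by Z then
    gives w' = 0.\<close>
  have Yw: "(\<Oplus>p\<in>{..<n}. Y i p \<otimes> \<delta> (w p)) = \<zero>" if i: "i < n" for i
  proof -
    have "\<delta> (v i) = (\<Oplus>p\<in>{..<n}. \<delta> (Y i p \<otimes> w p))"
      unfolding vY[OF i] using Yc wc i by (intro der_finsum) auto
    also have "\<dots> = (\<Oplus>p\<in>{..<n}. (\<Oplus>j\<in>{..<n}. A i j \<otimes> Y j p) \<otimes> w p \<oplus> Y i p \<otimes> \<delta> (w p))"
      using Yc wc Ac dwc i dY
      by (intro finsum_cong') (auto simp: der_mult mat_eq_def mat_prod_def intro!: finsum_closed)
    also have "\<dots> = (\<Oplus>p\<in>{..<n}. (\<Oplus>j\<in>{..<n}. A i j \<otimes> Y j p) \<otimes> w p)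
        \<oplus> (\<Oplus>p\<in>{..<n}. Y i p \<otimes> \<delta> (w p))"
      using Yc wc Ac dwc i by (intro finsum_addf) (auto intro!: finsum_closed)
    also have "(\<Oplus>p\<in>{..<n}. (\<Oplus>j\<in>{..<n}. A i j \<otimes> Y j p) \<otimes> w p)
        = (\<Oplus>j\<in>{..<n}. A i j \<otimes> (\<Oplus>p\<in>{..<n}. Y j p \<otimes> w p))"
      using Yc wc Ac i by (intro finsum_assoc_mult[symmetric]) auto
    also have "\<dots> = (\<Oplus>j\<in>{..<n}. A i j \<otimes> v j)"
      using Yc wc Ac i v by (intro finsum_cong') (auto simp: vY[symmetric])
    also have "\<dots> = \<delta> (v i)" using dv[OF i] by simp
    finally have "\<delta> (v i) = \<delta> (v i) \<oplus> (\<Oplus>p\<in>{..<n}. Y i p \<otimes> \<delta> (w p))" .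
    moreover have "(\<Oplus>p\<in>{..<n}. Y i p \<otimes> \<delta> (w p)) \<in> carrier R"
      using Yc dwc i by (intro finsum_closed) auto
    ultimately show ?thesis using v[OF i] der_closed add.l_cancel_one' by blast
  qed
  show "w i \<in> constants R" if i: "i < n" for i
  proof -
    have "\<delta> (w i) = (\<Oplus>j\<in>{..<n}. Z i j \<otimes> (\<Oplus>p\<in>{..<n}. Y j p \<otimes> \<delta> (w p)))"
      by (rule mat_one_mult_vec[OF Z Y ZY dwc i, symmetric])
    also have "\<dots> = (\<Oplus>j\<in>{..<n}. \<zero>)"
      using Zc i Yw by (intro finsum_cong') auto
    finally show ?thesis using wc[OF i] by (simp add: constants_def finsum_zero)
  qed
qed

subsection \<open>Finite-dimensional differential submodules of \<open>L\<close>\<close>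

lemma (in ring) subring_finsum_closed:
  "subring F R \<Longrightarrow> (\<And>i. i \<in> I \<Longrightarrow> f i \<in> F) \<Longrightarrow> (\<Oplus>i\<in>I. f i) \<in> F"
proof (induction I rule: infinite_finite_induct)
  case (insert i I)
  then have "f i \<in> F" "(\<Oplus>i\<in>I. f i) \<in> F" "f \<in> insert i I \<rightarrow> carrier R"
    using subringE(1) by auto
  then show ?case using insert by (simp add: subringE(7)[OF insert.prems(1)])
qed (auto simp: subringE)

lemma (in ring) combine_eq_finsum:
  assumes "set Ks \<subseteq> carrier R" "set Us \<subseteq> carrier R" "length Ks = length Us"
  shows "combine Ks Us = (\<Oplus>i\<in>{..<length Us}. Ks ! i \<otimes> Us ! i)"
  using assms(3,1,2)
proof (induction Ks Us rule: list_induct2)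
  case (Cons k Ks u Us)
  let ?f = "\<lambda>i. (k # Ks) ! i \<otimes> (u # Us) ! i"
  have c: "Ks ! i \<in> carrier R" "Us ! i \<in> carrier R" if "i < length Us" for i
    using that Cons by auto
  have "(\<Oplus>i\<in>{..<length (u # Us)}. ?f i) = (\<Oplus>i\<in>insert 0 (Suc ` {..<length Us}). ?f i)"
    by (simp add: lessThan_Suc_eq_insert_0)
  also have "\<dots> = ?f 0 \<oplus> (\<Oplus>i\<in>Suc ` {..<length Us}. ?f i)"
    using Cons.prems c by (intro finsum_insert) auto
  also have "(\<Oplus>i\<in>Suc ` {..<length Us}. ?f i) = (\<Oplus>i\<in>{..<length Us}. ?f (Suc i))"
    using c by (intro add.finprod_reindex) auto
  finally show ?case using Cons by simp
qed simp

context differential_extension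
begin

text \<open>Containment in a span, not equality with one, expresses finite dimension, so that any
  finite set of vectors bounding W suffices; a basis is extracted only once, at the end.\<close>

definition diff_module :: "'l set \<Rightarrow> bool" where
  "diff_module W \<longleftrightarrow> \<zero> \<in> W \<and> (\<forall>x\<in>W. \<forall>y\<in>W. x \<oplus> y \<in> W) \<and>
     (\<forall>k\<in>K. \<forall>x\<in>W. k \<otimes> x \<in> W) \<and> (\<forall>x\<in>W. \<delta> x \<in> W) \<and>
     (\<exists>Us. set Us \<subseteq> carrier L \<and> W \<subseteq> Span K Us)"

lemma diff_moduleD:
  assumes "diff_module W"
  shows diff_module_zero: "\<zero> \<in> W"
    and diff_module_add: "x \<in> W \<Longrightarrow> y \<in> W \<Longrightarrow> x \<oplus> y \<in> W"
    and diff_module_smult: "k \<in> K \<Longrightarrow> x \<in> W \<Longrightarrow> k \<otimes> x \<in> W"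
    and diff_module_der: "x \<in> W \<Longrightarrow> \<delta> x \<in> W"
    and diff_module_carrier: "x \<in> W \<Longrightarrow> x \<in> carrier L"
    and diff_module_Span: "\<exists>Us. set Us \<subseteq> carrier L \<and> W \<subseteq> Span K Us"
proof -
  note W = assms[unfolded diff_module_def]
  show Span: "\<exists>Us. set Us \<subseteq> carrier L \<and> W \<subseteq> Span K Us" using W by (elim conjE)
  show "\<zero> \<in> W" using W by (elim conjE)
  show "x \<oplus> y \<in> W" if "x \<in> W" "y \<in> W" using W that by (elim conjE) simp
  show "k \<otimes> x \<in> W" if "k \<in> K" "x \<in> W" using W that by (elim conjE) simp
  show "\<delta> x \<in> W" if "x \<in> W" using W that by (elim conjE) simp
  from Span obtain Us where Us: "set Us \<subseteq> carrier L" "W \<subseteq> Span K Us" by (elim exE conjE)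
  have "W \<subseteq> carrier L" using Us(2) Span_in_carrier[OF K_closed(1) Us(1)] by (rule subset_trans)
  then show "x \<in> carrier L" if "x \<in> W" using that by (rule subsetD)
qed

lemma diff_module_sum:
  assumes U: "diff_module U" and W: "diff_module W"
  shows "\<exists>V. diff_module V \<and> U \<subseteq> V \<and> W \<subseteq> V"
proof -
  note u = diff_moduleD[OF U] and w = diff_moduleD[OF W]
  define V where "V = {x \<oplus> y |x y. x \<in> U \<and> y \<in> W}"
  have VI: "x \<oplus> y \<in> V" if "x \<in> U" "y \<in> W" for x y using that by (auto simp: V_def)
  obtain Us Ws where Us: "set Us \<subseteq> carrier L" "U \<subseteq> Span K Us"
    and Ws: "set Ws \<subseteq> carrier L" "W \<subseteq> Span K Ws"
    using diff_module_Span[OF U] diff_module_Span[OF W] by (elim exE conjE)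
  have "V \<subseteq> Span K Us <+>\<^bsub>L\<^esub> Span K Ws"
    unfolding V_def set_add_def' using subsetD[OF Us(2)] subsetD[OF Ws(2)]
    by (auto simp del: Span.simps)
  then have "V \<subseteq> Span K (Us @ Ws)"
    unfolding Span_append_eq_set_add[OF subfield_K Us(1) Ws(1)] .
  moreover have "set (Us @ Ws) \<subseteq> carrier L" using Us Ws by simp
  moreover have "\<zero> \<in> V" using VI[OF u(1) w(1)] by simp
  moreover have "a \<oplus> b \<in> V" if ab: "a \<in> V" "b \<in> V" for a b
  proof -
    obtain x y x' y' where *: "x \<in> U" "y \<in> W" "x' \<in> U" "y' \<in> W" "a = x \<oplus> y" "b = x' \<oplus> y'"
      using ab unfolding V_def by blast
    then have "a \<oplus> b = (x \<oplus> x') \<oplus> (y \<oplus> y')" using u(5) w(5) by (simp add: a_ac)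
    then show ?thesis using VI u(2) w(2) * by simp
  qed
  moreover have "k \<otimes> a \<in> V" if k: "k \<in> K" and a: "a \<in> V" for k a
  proof -
    obtain x y where *: "x \<in> U" "y \<in> W" "a = x \<oplus> y"
      using a unfolding V_def by blast
    then have "k \<otimes> a = k \<otimes> x \<oplus> k \<otimes> y" using u(5) w(5) K_carrier[OF k] by (simp add: r_distr)
    then show ?thesis using VI u(3) w(3) * k by simp
  qed
  moreover have "\<delta> a \<in> V" if a: "a \<in> V" for a
  proof -
    obtain x y where *: "x \<in> U" "y \<in> W" "a = x \<oplus> y"
      using a unfolding V_def by blast
    then have "\<delta> a = \<delta> x \<oplus> \<delta> y" using u(5) w(5) by (simp add: der_add)
    then show ?thesis using VI u(4) w(4) * by simp
  qed
  ultimately have "diff_module V" unfolding diff_module_def by blast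
  moreover have "U \<subseteq> V" using VI[OF _ w(1)] u(5) by fastforce
  moreover have "W \<subseteq> V" using VI[OF u(1)] w(5) by fastforce
  ultimately show ?thesis by blast
qed

text \<open>The module from which the collection of generators starts. It puts 1 into the final
  module, whose basis is therefore not empty.\<close>

lemma diff_module_K: "diff_module K"
proof -
  have "K \<subseteq> Span K [\<one>]"
  proof
    fix k assume "k \<in> K"
    then have "k = k \<otimes> \<one> \<oplus> \<zero>" using K_carrier by simp
    then show "k \<in> Span K [\<one>]" using \<open>k \<in> K\<close> by (auto simp: line_extension_mem_iff)
  qed
  then show ?thesis
    unfolding diff_module_def using K_closed der_K by (auto intro!: exI[of _ "[\<one>]"])
qed

text \<open>Independent lists in W are no longer than the dimension of an enclosing span, so a
  longest one exists. An element of W outside its span would lengthen it.\<close>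

lemma diff_module_base:
  assumes W: "diff_module W"
  obtains Us where "set Us \<subseteq> carrier L" "independent K Us" "Span K Us = W"
proof -
  obtain Vs where Vs: "set Vs \<subseteq> carrier L" "W \<subseteq> Span K Vs"
    using diff_module_Span[OF W] by (elim exE conjE)
  obtain m where m: "dimension m K (Span K Vs)"
    using Span_finite_dimension[OF subfield_K Vs(1)] by (auto simp: finite_dimension_def)
  define P where "P n \<longleftrightarrow> (\<exists>Us. independent K Us \<and> set Us \<subseteq> W \<and> length Us = n)" for n
  have "P 0" by (auto simp: P_def)
  moreover have bound: "\<And>n. P n \<Longrightarrow> n \<le> m"
    unfolding P_def using independent_length_le_dimension[OF subfield_K m] Vs(2) by blast
  ultimately have "P (GREATEST n. P n)" by (rule GreatestI_nat)
  then obtain Us where Us: "independent K Us" "set Us \<subseteq> W" "length Us = (GREATEST n. P n)"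
    unfolding P_def by blast
  have c: "set Us \<subseteq> carrier L" using Us(1) by (rule independent_in_carrier)
  have "W \<subseteq> Span K Us"
  proof
    fix x assume x: "x \<in> W"
    show "x \<in> Span K Us"
    proof (rule ccontr)
      assume "x \<notin> Span K Us"
      then have "independent K (x # Us)" using Us(1) diff_moduleD(5)[OF W x] by (intro li_Cons)
      then have "P (Suc (length Us))" unfolding P_def using Us(2) x by (intro exI[of _ "x # Us"]) simp
      then have "Suc (length Us) \<le> (GREATEST n. P n)" using bound by (rule Greatest_le_nat)
      then show False using Us(3) by simp
    qed
  qed
  moreover have "Span K Us \<subseteq> W"
    using Us(2)
  proof (induction Us)
    case Nil
    then show ?case using diff_moduleD(1)[OF W] by simp
  next
    case (Cons u Us)
    then show ?case
      using diff_moduleD(2,3)[OF W] by (auto simp: line_extension_mem_iff subset_iff)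
  qed
  ultimately show thesis using that Us(1) c by blast
qed

end

section \<open>Values of constants and denominators in the tensor square\<close>

sublocale tensor_square \<subseteq> \<Phi>: differential_field_hom L M \<phi>
  by (intro differential_field_hom.intro differential_field_hom_axioms.intro
      differential_field_axioms M.differential_ring_axioms \<phi>_hom)

sublocale tensor_square \<subseteq> \<T>: differential_field_hom L M \<tau>
  by (intro differential_field_hom.intro differential_field_hom_axioms.intro
      differential_field_axioms M.differential_ring_axioms \<tau>_hom)

context tensor_square
begin

text \<open>Since \<open>c\<close> is constant, \<open>\<delta>\<close> maps the value of \<open>c\<close> at a form \<open>g\<close> to its value at the form
  \<open>[\<delta>, g]\<close>.\<close>

lemma diff_module_values:
  assumes c: "c \<in> constants M"
  shows "diff_module {ev c g |g. g \<in> forms}"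
proof -
  have cM: "c \<in> carrier M" "\<delta>\<^bsub>M\<^esub> c = \<zero>\<^bsub>M\<^esub>" using c by (auto simp: constants_def)
  obtain g where g: "g \<in> forms" using exists_form by blast
  have zero: "\<zero> = ev c (\<lambda>x. \<zero> \<otimes> g x)"
    using ev_forms_smult[OF cM(1) g K_closed(2)] ev_closed[OF cM(1) g] by simp
  have der: "\<delta> (ev c g) = ev c (\<lambda>x. \<delta> (g x) \<ominus> g (\<delta> x))" if g: "g \<in> forms" for g
  proof -
    have "\<zero> = \<delta> (ev c g) \<ominus> ev c (\<lambda>x. \<delta> (g x) \<ominus> g (\<delta> x))"
      using ev_der[OF cM(1) g] cM(2) ev_zero[OF g] by simp
    then show ?thesis
      using ev_closed[OF cM(1) g] ev_closed[OF cM(1) forms_der[OF g]] der_closed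
        r_right_minus_eq by metis
  qed
  obtain Us where "set Us \<subseteq> carrier L" "\<And>g. g \<in> forms \<Longrightarrow> ev c g \<in> Span K Us"
    using ev_in_Span[OF cM(1)] by blast
  then have "\<exists>Us. set Us \<subseteq> carrier L \<and> {ev c g |g. g \<in> forms} \<subseteq> Span K Us" by blast
  moreover have "\<zero> \<in> {ev c g |g. g \<in> forms}"
    using zero forms_smult[OF g K_closed(2)] by blast
  moreover have "ev c g \<oplus> ev c h \<in> {ev c g |g. g \<in> forms}" if "g \<in> forms" "h \<in> forms" for g h
    using that ev_forms_add[OF cM(1) that] forms_add[OF that] by (metis (mono_tags, lifting) mem_Collect_eq)
  moreover have "k \<otimes> ev c g \<in> {ev c g |g. g \<in> forms}" if "g \<in> forms" "k \<in> K" for g k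
    using that ev_forms_smult[OF cM(1) that] forms_smult[OF that] by (metis (mono_tags, lifting) mem_Collect_eq)
  moreover have "\<delta> (ev c g) \<in> {ev c g |g. g \<in> forms}" if "g \<in> forms" for g
    using that der[OF that] forms_der[OF that] by (metis (mono_tags, lifting) mem_Collect_eq)
  ultimately show ?thesis unfolding diff_module_def by blast
qed

text \<open>In a product of \<open>\<phi> x\<close> and c the first factor is absorbed into the
  form, which leaves a value of the constant c. A sum is handled by joining the two modules.\<close>

lemma diff_module_constant_span:
  assumes "r \<in> \<Phi>.constant_span" and g: "g \<in> forms"
  shows "\<exists>W. diff_module W \<and> ev r g \<in> W"
  using assms(1)
proof (induction rule: \<Phi>.constant_span_induct)
  case zero
  then show ?case using diff_module_K K_closed(2) ev_zero[OF g] by metis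
next
  case (add u v)
  then obtain U W where "diff_module U" "ev u g \<in> U" "diff_module W" "ev v g \<in> W" by blast
  moreover obtain V where "diff_module V" "U \<subseteq> V" "W \<subseteq> V"
    using diff_module_sum calculation by blast
  ultimately have "diff_module V \<and> ev u g \<oplus> ev v g \<in> V"
    using diff_module_add by (simp add: subset_iff)
  then show ?case using ev_add[OF add(1,2) g] by auto
next
  case (mult x c)
  then have "ev (\<phi> x \<otimes>\<^bsub>M\<^esub> c) g = ev c (\<lambda>y. g (x \<otimes> y))"
    using g by (intro ev_\<phi>_mult) (auto simp: constants_def)
  then show ?case
    using diff_module_values[OF mult(2)] forms_translate[OF g mult(1)]
    by (intro exI[of _ "{ev c g |g. g \<in> forms}"]) auto
qed

text \<open>Ensures that the unit in the denominator of an element of the compositum is not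
  zero.\<close>

lemma M_nontrivial: "\<one>\<^bsub>M\<^esub> \<noteq> \<zero>\<^bsub>M\<^esub>"
proof -
  obtain g where g: "g \<in> forms" "g \<one> = \<one>" using exists_form by blast
  have "ev \<one>\<^bsub>M\<^esub> g = \<one>" using ev_\<phi>[OF one_closed g(1)] g(2) by (simp add: \<Phi>.hom_one)
  then show ?thesis using ev_zero[OF g(1)] by auto
qed

lemma quotient_of_diff_module:
  assumes a: "a \<in> carrier L"
    and comp: "\<tau> a \<in> compositum M (\<phi> ` carrier L) (constants M)"
  shows "\<exists>W s t. diff_module W \<and> s \<in> W \<and> t \<in> W \<and> t \<noteq> \<zero> \<and> a \<otimes> t = s"
proof -
  obtain r r' where r: "r \<in> \<Phi>.constant_span" "r' \<in> \<Phi>.constant_span" "r' \<in> Units M"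
    and eq: "\<tau> a = r \<otimes>\<^bsub>M\<^esub> inv\<^bsub>M\<^esub> r'"
    using comp by (auto simp: compositum_def \<Phi>.constant_span_def)
  have rM: "r \<in> carrier M" "r' \<in> carrier M" using r \<Phi>.constant_span_closed by auto
  have prod: "\<tau> a \<otimes>\<^bsub>M\<^esub> r' = r"
    unfolding eq using rM r(3) by (simp add: M.m_assoc)
  have "r' \<noteq> \<zero>\<^bsub>M\<^esub>" using r(3) M_nontrivial M.Units_r_inv M.Units_inv_closed M.l_null by metis
  \<comment> \<open>The forms separate the elements of M, so some contraction of r' is nonzero; it
    becomes the denominator in L.\<close>
  then obtain g where g: "g \<in> forms" "ev r' g \<noteq> \<zero>"
    using ev_eqI[OF rM(2) M.zero_closed] ev_zero by metis
  obtain U W where "diff_module U" "ev r g \<in> U" "diff_module W" "ev r' g \<in> W"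
    using diff_module_constant_span[OF r(1) g(1)] diff_module_constant_span[OF r(2) g(1)] by blast
  then obtain V where "diff_module V" "ev r g \<in> V" "ev r' g \<in> V"
    using diff_module_sum by blast
  moreover have "a \<otimes> ev r' g = ev r g" using ev_\<tau>_mult[OF rM(2) a g(1)] prod by simp
  ultimately show ?thesis using g(2) by blast
qed

text \<open>The product of the single denominators. It is again a unit, as the later cancellation
  requires in a ring that may have zero divisors.\<close>

lemma common_denominator:
  fixes n :: nat
  assumes "\<And>i. i < n \<Longrightarrow> y i \<in> carrier L"
    and "\<And>i. i < n \<Longrightarrow> \<tau> (y i) \<in> compositum M (\<phi> ` carrier L) (constants M)"
  shows "\<exists>r. r \<in> \<Phi>.constant_span \<and> r \<in> Units M \<and> (\<forall>i<n. r \<otimes>\<^bsub>M\<^esub> \<tau> (y i) \<in> \<Phi>.constant_span)"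
  using assms
proof (induction n)
  case 0
  then show ?case using \<Phi>.constant_span_image[OF one_closed] by (auto simp: \<Phi>.hom_one)
next
  case (Suc n)
  then obtain r where r: "r \<in> \<Phi>.constant_span" "r \<in> Units M"
    "\<And>i. i < n \<Longrightarrow> r \<otimes>\<^bsub>M\<^esub> \<tau> (y i) \<in> \<Phi>.constant_span" by auto
  obtain s s' where s: "s \<in> \<Phi>.constant_span" "s' \<in> \<Phi>.constant_span" "s' \<in> Units M"
    and eq: "\<tau> (y n) = s \<otimes>\<^bsub>M\<^esub> inv\<^bsub>M\<^esub> s'"
    using Suc.prems(2)[of n] by (auto simp: compositum_def \<Phi>.constant_span_def)
  have c: "r \<in> carrier M" "s \<in> carrier M" "s' \<in> carrier M"
    using r s \<Phi>.constant_span_closed by auto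
  have last: "s' \<otimes>\<^bsub>M\<^esub> \<tau> (y n) = s"
    unfolding eq using M.m_lcomm[OF c(3,2) M.Units_inv_closed[OF s(3)]] c s(3) by simp
  have "(r \<otimes>\<^bsub>M\<^esub> s') \<otimes>\<^bsub>M\<^esub> \<tau> (y i) \<in> \<Phi>.constant_span" if "i < Suc n" for i
  proof (cases "i = n")
    case True
    then have "(r \<otimes>\<^bsub>M\<^esub> s') \<otimes>\<^bsub>M\<^esub> \<tau> (y i) = r \<otimes>\<^bsub>M\<^esub> s"
      using c last \<tau>_closed Suc.prems(1)[of n] by (simp add: M.m_assoc)
    then show ?thesis using \<Phi>.constant_span_mult r(1) s(1) by simp
  next
    case False
    then have i: "i < n" using that by simp
    have "(r \<otimes>\<^bsub>M\<^esub> s') \<otimes>\<^bsub>M\<^esub> \<tau> (y i) = s' \<otimes>\<^bsub>M\<^esub> (r \<otimes>\<^bsub>M\<^esub> \<tau> (y i))"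
      using c \<tau>_closed Suc.prems(1)[of i] i by (simp add: M.m_ac)
    then show ?thesis using \<Phi>.constant_span_mult s(2) r(3)[OF i] by simp
  qed
  moreover have "r \<otimes>\<^bsub>M\<^esub> s' \<in> \<Phi>.constant_span" "r \<otimes>\<^bsub>M\<^esub> s' \<in> Units M"
    using \<Phi>.constant_span_mult r s by auto
  ultimately show ?case by blast
qed

text \<open>The denominators of \<open>\<tau> y\<close> form a differential submodule, hence are generated by constants \<open>d\<close>;
  each \<open>d \<cdot> \<tau> y\<close> is a solution without denominators.\<close>

lemma no_annihilator_of_solutions:
  fixes n :: nat
  assumes y: "\<And>i. i < n \<Longrightarrow> y i \<in> carrier L"
    and indep: "\<And>k. (\<And>i. i < n \<Longrightarrow> k i \<in> K) \<Longrightarrow> (\<Oplus>i\<in>{..<n}. k i \<otimes> y i) = \<zero> \<Longrightarrow>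
      (\<And>i. i < n \<Longrightarrow> k i = \<zero>)"
    and A: "\<And>i p. i < n \<Longrightarrow> p < n \<Longrightarrow> A i p \<in> K"
    and dy: "\<And>i. i < n \<Longrightarrow> \<delta> (y i) = (\<Oplus>p\<in>{..<n}. A i p \<otimes> y p)"
    and comp: "\<And>i. i < n \<Longrightarrow> \<tau> (y i) \<in> compositum M (\<phi> ` carrier L) (constants M)"
    and f: "\<And>i. i < n \<Longrightarrow> f i \<in> carrier L"
    and ann: "\<And>v. \<Phi>.solution n A v \<Longrightarrow> (\<Oplus>i\<in>{..<n}. f i \<otimes> v i) = \<zero>"
    and i: "i < n"
  shows "f i = \<zero>"
proof -
  note Ac = K_carrier[OF A]
  have ty: "\<tau> (y i) \<in> carrier M" if "i < n" for i using y that \<tau>_closed by blast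
  obtain r where r: "r \<in> \<Phi>.constant_span" "r \<in> Units M"
    "\<And>i. i < n \<Longrightarrow> r \<otimes>\<^bsub>M\<^esub> \<tau> (y i) \<in> \<Phi>.constant_span"
    using common_denominator[of n y, OF y comp] by auto
  have dty: "\<delta>\<^bsub>M\<^esub> (\<tau> (y i)) = (\<Oplus>\<^bsub>M\<^esub>p\<in>{..<n}. \<phi> (A i p) \<otimes>\<^bsub>M\<^esub> \<tau> (y p))" if i: "i < n" for i
  proof -
    have "\<tau> (\<Oplus>p\<in>{..<n}. A i p \<otimes> y p) = (\<Oplus>\<^bsub>M\<^esub>p\<in>{..<n}. \<tau> (A i p \<otimes> y p))"
      using Ac[OF i] y by (intro \<T>.hom_finsum[unfolded comp_def]) auto
    also have "\<dots> = (\<Oplus>\<^bsub>M\<^esub>p\<in>{..<n}. \<phi> (A i p) \<otimes>\<^bsub>M\<^esub> \<tau> (y p))"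
      using Ac[OF i] A[OF i] y ty
      by (intro M.finsum_cong') (auto simp: \<T>.hom_mult \<tau>_eq_\<phi> \<phi>_closed)
    finally show ?thesis using \<T>.hom_der[OF y[OF i]] dy[OF i] by simp
  qed
  define J where "J = {u \<in> \<Phi>.constant_span. \<forall>i<n. u \<otimes>\<^bsub>M\<^esub> \<tau> (y i) \<in> \<Phi>.constant_span}"
  have JM: "u \<in> carrier M" if "u \<in> J" for u
    using that \<Phi>.constant_span_closed by (auto simp: J_def)
  have smult: "\<phi> x \<otimes>\<^bsub>M\<^esub> u \<in> \<Phi>.constant_span" if "x \<in> carrier L" "u \<in> \<Phi>.constant_span" for x u
    using that \<Phi>.constant_span_mult \<Phi>.constant_span_image by blast
  have fins: "(\<Oplus>\<^bsub>M\<^esub>p\<in>{..<n}. \<phi> (A i p) \<otimes>\<^bsub>M\<^esub> (u \<otimes>\<^bsub>M\<^esub> \<tau> (y p))) \<in> \<Phi>.constant_span"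
    if "u \<in> J" "i < n" for u i
    unfolding \<Phi>.constant_span_def
    by (intro M.sum_prod_finsum \<Phi>.constant_span_closed_sets)
      (use that smult Ac in \<open>auto simp: J_def \<Phi>.constant_span_def[symmetric]\<close>)
  have move: "u \<otimes>\<^bsub>M\<^esub> (\<Oplus>\<^bsub>M\<^esub>p\<in>{..<n}. \<phi> (a p) \<otimes>\<^bsub>M\<^esub> \<tau> (y p))
      = (\<Oplus>\<^bsub>M\<^esub>p\<in>{..<n}. \<phi> (a p) \<otimes>\<^bsub>M\<^esub> (u \<otimes>\<^bsub>M\<^esub> \<tau> (y p)))"
    if u: "u \<in> carrier M" and a: "\<And>p. p < n \<Longrightarrow> a p \<in> carrier L" for u a
  proof -
    have "u \<otimes>\<^bsub>M\<^esub> (\<Oplus>\<^bsub>M\<^esub>p\<in>{..<n}. \<phi> (a p) \<otimes>\<^bsub>M\<^esub> \<tau> (y p))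
        = (\<Oplus>\<^bsub>M\<^esub>p\<in>{..<n}. u \<otimes>\<^bsub>M\<^esub> (\<phi> (a p) \<otimes>\<^bsub>M\<^esub> \<tau> (y p)))"
      using u a ty by (intro M.finsum_rdistr) auto
    also have "\<dots> = (\<Oplus>\<^bsub>M\<^esub>p\<in>{..<n}. \<phi> (a p) \<otimes>\<^bsub>M\<^esub> (u \<otimes>\<^bsub>M\<^esub> \<tau> (y p)))"
      using u a ty by (intro M.finsum_cong') (auto simp: M.m_lcomm)
    finally show ?thesis .
  qed
  \<comment> \<open>By the product rule, u' \<tau>(y_i) is the derivative of u \<tau>(y_i) minus a
    combination of the u \<tau>(y_p); all these lie in the span.\<close>
  have Jder: "\<delta>\<^bsub>M\<^esub> u \<in> J" if u: "u \<in> J" for u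
  proof -
    have "\<delta>\<^bsub>M\<^esub> u \<otimes>\<^bsub>M\<^esub> \<tau> (y i) \<in> \<Phi>.constant_span" if i: "i < n" for i
    proof -
      have uc: "u \<in> carrier M" "\<delta>\<^bsub>M\<^esub> u \<in> carrier M" using JM[OF u] M.der_closed by auto
      let ?s = "(\<Oplus>\<^bsub>M\<^esub>p\<in>{..<n}. \<phi> (A i p) \<otimes>\<^bsub>M\<^esub> (u \<otimes>\<^bsub>M\<^esub> \<tau> (y p)))"
      have s: "?s \<in> \<Phi>.constant_span" "?s \<in> carrier M"
        using fins[OF u i] \<Phi>.constant_span_closed by auto
      have "\<delta>\<^bsub>M\<^esub> (u \<otimes>\<^bsub>M\<^esub> \<tau> (y i)) = \<delta>\<^bsub>M\<^esub> u \<otimes>\<^bsub>M\<^esub> \<tau> (y i) \<oplus>\<^bsub>M\<^esub> ?s"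
        using M.der_mult[OF uc(1) ty[OF i]] dty[OF i] move[OF uc(1) Ac[OF i]] by simp
      then have "\<delta>\<^bsub>M\<^esub> u \<otimes>\<^bsub>M\<^esub> \<tau> (y i) = \<delta>\<^bsub>M\<^esub> (u \<otimes>\<^bsub>M\<^esub> \<tau> (y i)) \<oplus>\<^bsub>M\<^esub> \<ominus>\<^bsub>M\<^esub> ?s"
        using s(2) uc ty[OF i] by (simp add: M.a_assoc M.r_neg)
      moreover have "\<delta>\<^bsub>M\<^esub> (u \<otimes>\<^bsub>M\<^esub> \<tau> (y i)) \<in> \<Phi>.constant_span"
        using u i \<Phi>.constant_span_der by (simp add: J_def)
      ultimately show ?thesis using \<Phi>.constant_span_add \<Phi>.constant_span_minus[OF s(1)] by simp
    qed
    then show ?thesis using u \<Phi>.constant_span_der by (simp add: J_def)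
  qed
  have "r \<in> sum_prod M (\<phi> ` carrier L) (J \<inter> constants M)"
  proof (rule \<Phi>.differential_submodule_generated_by_constants)
    show "J \<subseteq> carrier M" using JM by blast
    show "r \<in> J" using r by (simp add: J_def)
    show "r \<in> \<Phi>.constant_span" by (rule r)
  next
    fix u v assume uv: "u \<in> J" "v \<in> J"
    then show "u \<oplus>\<^bsub>M\<^esub> v \<in> J"
      using JM[OF uv(1)] JM[OF uv(2)] ty by (auto simp: J_def M.l_distr \<Phi>.constant_span_add)
  next
    fix x u assume xu: "x \<in> carrier L" "u \<in> J"
    then show "\<phi> x \<otimes>\<^bsub>M\<^esub> u \<in> J"
      using JM[OF xu(2)] ty \<phi>_closed[OF xu(1)] by (auto simp: J_def M.m_assoc smult)
  qed (rule Jder)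
  \<comment> \<open>The linear form f evaluated at \<tau>(y). Every constant d in J kills s because
    d \<tau>(y) is a solution in the span. So does r, a combination of such d, and r is a
    unit.\<close>
  moreover define s where "s = (\<Oplus>\<^bsub>M\<^esub>i\<in>{..<n}. \<phi> (f i) \<otimes>\<^bsub>M\<^esub> \<tau> (y i))"
  have sM: "s \<in> carrier M" unfolding s_def using f ty by (intro M.finsum_closed) auto
  have ds: "d \<otimes>\<^bsub>M\<^esub> s = \<zero>\<^bsub>M\<^esub>" if d: "d \<in> J \<inter> constants M" for d
  proof -
    have dc: "d \<in> carrier M" "\<delta>\<^bsub>M\<^esub> d = \<zero>\<^bsub>M\<^esub>" using d by (auto simp: constants_def)
    have "d \<otimes>\<^bsub>M\<^esub> s = (\<Oplus>\<^bsub>M\<^esub>i\<in>{..<n}. \<phi> (f i) \<otimes>\<^bsub>M\<^esub> (d \<otimes>\<^bsub>M\<^esub> \<tau> (y i)))"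
      unfolding s_def by (rule move[OF dc(1) f])
    also have "\<dots> = \<zero>\<^bsub>M\<^esub>"
    proof (rule \<Phi>.solution_in_constant_span[OF Ac f ann])
      fix i assume i: "i < n"
      show "d \<otimes>\<^bsub>M\<^esub> \<tau> (y i) \<in> \<Phi>.constant_span" using d i by (simp add: J_def)
      show "\<delta>\<^bsub>M\<^esub> (d \<otimes>\<^bsub>M\<^esub> \<tau> (y i)) = (\<Oplus>\<^bsub>M\<^esub>p\<in>{..<n}. \<phi> (A i p) \<otimes>\<^bsub>M\<^esub> (d \<otimes>\<^bsub>M\<^esub> \<tau> (y p)))"
        using M.der_mult[OF dc(1) ty[OF i]] dc ty[OF i] dty[OF i] move[OF dc(1) Ac[OF i]]
          M.der_closed[OF ty[OF i]] subsetD[OF \<Phi>.constant_span_closed fins[OF _ i, of d]] d by simp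
    qed
    finally show ?thesis .
  qed
  ultimately have "r \<otimes>\<^bsub>M\<^esub> s = \<zero>\<^bsub>M\<^esub>"
  proof (elim M.sum_prod_induct)
    show "\<phi> ` carrier L \<subseteq> carrier M" "J \<inter> constants M \<subseteq> carrier M" using JM \<phi>_closed by auto
    show "\<zero>\<^bsub>M\<^esub> \<otimes>\<^bsub>M\<^esub> s = \<zero>\<^bsub>M\<^esub>" using sM by simp
  next
    fix u v assume "u \<in> carrier M" "v \<in> carrier M" "u \<otimes>\<^bsub>M\<^esub> s = \<zero>\<^bsub>M\<^esub>" "v \<otimes>\<^bsub>M\<^esub> s = \<zero>\<^bsub>M\<^esub>"
    then show "(u \<oplus>\<^bsub>M\<^esub> v) \<otimes>\<^bsub>M\<^esub> s = \<zero>\<^bsub>M\<^esub>" using sM by (simp add: M.l_distr)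
  next
    fix x d assume xd: "x \<in> \<phi> ` carrier L" "d \<in> J \<inter> constants M"
    then have "x \<in> carrier M" "d \<in> carrier M" using JM \<phi>_closed by auto
    then show "(x \<otimes>\<^bsub>M\<^esub> d) \<otimes>\<^bsub>M\<^esub> s = \<zero>\<^bsub>M\<^esub>" using ds[OF xd(2)] sM by (simp add: M.m_assoc)
  qed
  moreover have "r \<in> carrier M" using r(2) by auto
  ultimately have s0: "s = \<zero>\<^bsub>M\<^esub>"
    using r(2) sM M.Units_l_inv M.Units_inv_closed M.m_assoc M.l_one M.r_null by metis
  \<comment> \<open>Contracting s = 0 with g gives a relation among the y_p with coefficients g(f_p)
    in K, to which independence applies.\<close>
  have gf: "g (f i) = \<zero>" if g: "g \<in> forms" and i: "i < n" for g i
  proof -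
    have ev_fin: "ev (\<Oplus>\<^bsub>M\<^esub>p\<in>P. \<phi> (f p) \<otimes>\<^bsub>M\<^esub> \<tau> (y p)) g = (\<Oplus>p\<in>P. g (f p) \<otimes> y p)"
      if "finite P" "P \<subseteq> {..<n}" for P
      using that
    proof (induction P)
      case empty
      then show ?case using ev_zero[OF g] by simp
    next
      case (insert p P)
      have c: "(\<lambda>p. g (f p) \<otimes> y p) \<in> P \<rightarrow> carrier L"
        "(\<lambda>p. \<phi> (f p) \<otimes>\<^bsub>M\<^esub> \<tau> (y p)) \<in> P \<rightarrow> carrier M" and p: "p < n"
        using insert.prems f y ty \<phi>_closed formsD(2)[OF g] by (auto simp: subset_iff)
      have "ev (\<phi> (f p) \<otimes>\<^bsub>M\<^esub> \<tau> (y p)) g = y p \<otimes> g (f p \<otimes> \<one>)"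
        using ev_\<phi>_mult[OF ty[OF p] f[OF p] g] ev_\<tau>[OF y[OF p] forms_translate[OF g f[OF p]]] by simp
      then show ?case
        using insert c p y[OF p] f[OF p] ty[OF p] \<phi>_closed[OF f[OF p]] formsD(2)[OF g f[OF p]] g
        by (simp add: ev_add m_comm)
    qed
    have "(\<Oplus>p\<in>{..<n}. g (f p) \<otimes> y p) = \<zero>"
      using ev_fin[of "{..<n}"] s0 ev_zero[OF g] by (simp add: s_def)
    then show ?thesis
      by (intro indep[of "\<lambda>p. g (f p)"]) (use f i formsD(1)[OF g] in auto)
  qed
  show ?thesis
  proof (rule ccontr)
    \<comment> \<open>All forms vanish at \<open>f i\<close>. Translating by its inverse a form with
      value 1 at 1 gives one that does not.\<close>
    assume ne: "f i \<noteq> \<zero>"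
    then have inv: "inv (f i) \<in> carrier L" "inv (f i) \<otimes> f i = \<one>"
      using f[OF i] by (auto simp: field_Units)
    obtain g where g: "g \<in> forms" "g \<one> = \<one>" using exists_form by blast
    have "g (inv (f i) \<otimes> f i) = \<zero>"
      using gf[OF forms_translate[OF g(1) inv(1)] i] .
    then show False using inv g by simp
  qed
qed

end

subsection \<open>Picard-Vessiot extensions\<close>

lemma (in differential_field_hom) mem_compositumI:
  assumes "u \<in> carrier M" "r \<in> constant_span" "r \<in> Units M" "u \<otimes>\<^bsub>M\<^esub> r \<in> constant_span"
  shows "u \<in> compositum M (\<phi> ` carrier L) (constants M)"
proof -
  have "u = (u \<otimes>\<^bsub>M\<^esub> r) \<otimes>\<^bsub>M\<^esub> inv\<^bsub>M\<^esub> r"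
    using assms M.Units_closed[OF assms(3)] by (simp add: M.m_assoc)
  then show ?thesis using assms unfolding compositum_def constant_span_def by blast
qed

lemma (in differential_field_hom) hom_mat_prod:
  assumes "mat_entries_in n (carrier L) A" "mat_entries_in n (carrier L) B" "i < n" "j < n"
  shows "mat_prod M n (\<lambda>i j. \<phi> (A i j)) (\<lambda>i j. \<phi> (B i j)) i j = \<phi> (mat_prod L n A B i j)"
proof -
  have c: "A i p \<in> carrier L" "B p j \<in> carrier L" if "p < n" for p
    using assms that by (auto simp: mat_entries_in_def)
  have "\<phi> (\<Oplus>p\<in>{..<n}. A i p \<otimes> B p j) = (\<Oplus>\<^bsub>M\<^esub>p\<in>{..<n}. \<phi> (A i p \<otimes> B p j))"
    using c by (intro hom_finsum[unfolded comp_def]) auto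
  also have "\<dots> = (\<Oplus>\<^bsub>M\<^esub>p\<in>{..<n}. \<phi> (A i p) \<otimes>\<^bsub>M\<^esub> \<phi> (B p j))"
    using c by (intro M.finsum_cong') (auto simp: hom_mult)
  finally show ?thesis by (simp add: mat_prod_def)
qed

context differential_extension
begin

text \<open>Both images of a fundamental matrix \<open>Y\<close> are fundamental matrices of the same equation, so
  they differ by a constant matrix.\<close>

lemma picard_vessiot_imp_compositum:
  assumes PV: "picard_vessiot L K"
    and M: "differential_algebra L M \<phi>"
    and \<tau>: "differential_embedding_over K L M \<phi> \<tau>"
  shows "\<tau> ` carrier L \<subseteq> compositum M (\<phi> ` carrier L) (constants M)"
proof -
  interpret M: differential_ring M using M by (simp add: differential_algebra_def)
  interpret \<Phi>: differential_field_hom L M \<phi>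
    using M differential_field_axioms M.differential_ring_axioms
    by (simp add: differential_field_hom_def differential_field_hom_axioms_def differential_algebra_def)
  interpret T: differential_field_hom L M \<tau>
    using \<tau> differential_field_axioms M.differential_ring_axioms
    by (simp add: differential_field_hom_def differential_field_hom_axioms_def
        differential_embedding_over_def)
  \<comment> \<open>Hence \<tau>(A) = \<phi>(A), and both images of Y satisfy literally the same
    equation.\<close>
  have \<tau>K: "\<tau> k = \<phi> k" if "k \<in> K" for k
  proof -
    have "\<tau> (k \<otimes> \<one>) = \<phi> k \<otimes>\<^bsub>M\<^esub> \<tau> \<one>" using \<tau> that by (simp add: differential_embedding_over_def)
    then show ?thesis using K_carrier[OF that] by (simp add: T.hom_one)
  qed
  obtain n A Y where A: "mat_entries_in n K A" and Y: "Y \<in> GL n L"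
    and dY: "mat_eq n (\<lambda>i j. \<delta> (Y i j)) (mat_prod L n A Y)"
    and gen: "generate_field L (K \<union> {Y i j |i j. i < n \<and> j < n}) = carrier L"
    using PV by (auto simp: picard_vessiot_def)
  obtain Z where Yc: "mat_entries_in n (carrier L) Y" and Zc: "mat_entries_in n (carrier L) Z"
    and YZ: "mat_eq n (mat_prod L n Y Z) (mat_one L)" and ZY: "mat_eq n (mat_prod L n Z Y) (mat_one L)"
    using Y by (auto simp: GL_def)
  have Ac: "mat_entries_in n (carrier L) A" using A K_carrier by (auto simp: mat_entries_in_def)
  have mat_one: "mat_eq n (\<lambda>i j. \<phi> (mat_one L i j)) (mat_one M)"
    by (auto simp: mat_eq_def mat_one_def \<Phi>.hom_one \<Phi>.hom_zero)
  have entry: "\<tau> (Y i j) \<in> \<Phi>.constant_span" if i: "i < n" and j: "j < n" for i j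
  proof (rule M.fundamental_matrix)
    show "mat_entries_in n (carrier M) (\<lambda>i j. \<phi> (A i j))" "mat_entries_in n (carrier M) (\<lambda>i j. \<phi> (Y i j))"
      "mat_entries_in n (carrier M) (\<lambda>i j. \<phi> (Z i j))"
      using Ac Yc Zc by (auto simp: mat_entries_in_def)
    show "mat_eq n (mat_prod M n (\<lambda>i j. \<phi> (Y i j)) (\<lambda>i j. \<phi> (Z i j))) (mat_one M)"
      "mat_eq n (mat_prod M n (\<lambda>i j. \<phi> (Z i j)) (\<lambda>i j. \<phi> (Y i j))) (mat_one M)"
      using YZ ZY mat_one by (auto simp: mat_eq_def \<Phi>.hom_mat_prod[OF Yc Zc] \<Phi>.hom_mat_prod[OF Zc Yc])
    show "mat_eq n (\<lambda>i j. \<delta>\<^bsub>M\<^esub> (\<phi> (Y i j))) (mat_prod M n (\<lambda>i j. \<phi> (A i j)) (\<lambda>i j. \<phi> (Y i j)))"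
      using dY Yc by (auto simp: mat_eq_def \<Phi>.hom_mat_prod[OF Ac Yc] mat_entries_in_def \<Phi>.hom_der[symmetric])
    show "\<tau> (Y i j) \<in> carrier M" if "i < n" for i
      using Yc that j by (auto simp: mat_entries_in_def)
    show "\<delta>\<^bsub>M\<^esub> (\<tau> (Y i j)) = (\<Oplus>\<^bsub>M\<^esub>p\<in>{..<n}. \<phi> (A i p) \<otimes>\<^bsub>M\<^esub> \<tau> (Y p j))" if i: "i < n" for i
    proof -
      have "\<delta>\<^bsub>M\<^esub> (\<tau> (Y i j)) = mat_prod M n (\<lambda>i j. \<tau> (A i j)) (\<lambda>i j. \<tau> (Y i j)) i j"
        using dY Yc i j by (auto simp: mat_eq_def T.hom_mat_prod[OF Ac Yc] mat_entries_in_def T.hom_der[symmetric])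
      also have "\<dots> = (\<Oplus>\<^bsub>M\<^esub>p\<in>{..<n}. \<phi> (A i p) \<otimes>\<^bsub>M\<^esub> \<tau> (Y p j))"
        unfolding mat_prod_def using A Ac Yc i j
        by (intro M.finsum_cong') (auto simp: mat_entries_in_def \<tau>K)
      finally show ?thesis .
    qed
    fix w assume w: "\<And>i. i < n \<Longrightarrow> w i \<in> constants M"
      "\<And>i. i < n \<Longrightarrow> \<tau> (Y i j) = (\<Oplus>\<^bsub>M\<^esub>p\<in>{..<n}. \<phi> (Y i p) \<otimes>\<^bsub>M\<^esub> w p)"
    show ?thesis
      unfolding w(2)[OF i] \<Phi>.constant_span_def using w(1) Yc i
      by (intro M.sum_prod_finsum M.sum_prod_single \<Phi>.constant_span_closed_sets)
        (auto simp: mat_entries_in_def)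
  qed
  define H where "H = K \<union> {Y i j |i j. i < n \<and> j < n}"
  have Hc: "H \<subseteq> carrier L"
    using K_carrier Yc by (auto simp: H_def mat_entries_in_def)
  have one: "\<one>\<^bsub>M\<^esub> \<in> \<Phi>.constant_span"
    using \<Phi>.constant_span_image[OF one_closed] by (simp add: \<Phi>.hom_one)
  have "\<exists>r\<in>\<Phi>.constant_span. r \<in> Units M \<and> \<tau> h \<otimes>\<^bsub>M\<^esub> r \<in> \<Phi>.constant_span"
    if "h \<in> generate_field L H" for h
    using that
  proof induction
    case one
    show ?case using \<open>\<one>\<^bsub>M\<^esub> \<in> \<Phi>.constant_span\<close> by (intro bexI[of _ "\<one>\<^bsub>M\<^esub>"]) (auto simp: T.hom_one)
  next
    case (incl h)
    then have "\<tau> h \<in> \<Phi>.constant_span"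
      using entry \<Phi>.constant_span_image K_carrier by (auto simp: H_def \<tau>K)
    then show ?case using one \<Phi>.constant_span_closed by (intro bexI[of _ "\<one>\<^bsub>M\<^esub>"]) auto
  next
    case (a_inv h)
    then obtain r where r: "r \<in> \<Phi>.constant_span" "r \<in> Units M" "\<tau> h \<otimes>\<^bsub>M\<^esub> r \<in> \<Phi>.constant_span" by blast
    have "h \<in> carrier L" using generate_field_in_carrier[OF Hc] a_inv by blast
    then have "\<tau> (\<ominus> h) \<otimes>\<^bsub>M\<^esub> r = \<ominus>\<^bsub>M\<^esub> (\<tau> h \<otimes>\<^bsub>M\<^esub> r)" using M.Units_closed[OF r(2)] by (simp add: M.l_minus)
    then show ?case using r \<Phi>.constant_span_minus by auto
  next
    case (m_inv h)
    then obtain r where r: "r \<in> \<Phi>.constant_span" "r \<in> Units M" "\<tau> h \<otimes>\<^bsub>M\<^esub> r \<in> \<Phi>.constant_span" by blast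
    have h: "h \<in> carrier L" using generate_field_in_carrier[OF Hc] m_inv by blast
    then have inv: "inv h \<in> carrier L" "inv h \<otimes> h = \<one>" using m_inv(2) by (auto simp: field_Units)
    then have ti: "\<tau> (inv h) \<otimes>\<^bsub>M\<^esub> \<tau> h = \<one>\<^bsub>M\<^esub>" using h T.hom_mult T.hom_one by metis
    have "\<tau> h \<in> Units M" using ti h inv M.m_comm[of "\<tau> h" "\<tau> (inv h)"]
        by (auto simp: Units_def intro!: bexI[of _ "\<tau> (inv h)"])
    then have "\<tau> h \<otimes>\<^bsub>M\<^esub> r \<in> Units M" using r(2) by simp
    moreover have "\<tau> (inv h) \<otimes>\<^bsub>M\<^esub> (\<tau> h \<otimes>\<^bsub>M\<^esub> r) = r"
      using ti h inv M.Units_closed[OF r(2)] by (simp add: M.m_assoc[symmetric])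
    ultimately show ?case using r by metis
  next
    case (eng_add h h')
    then obtain r r' where r: "r \<in> \<Phi>.constant_span" "r \<in> Units M" "\<tau> h \<otimes>\<^bsub>M\<^esub> r \<in> \<Phi>.constant_span"
      "r' \<in> \<Phi>.constant_span" "r' \<in> Units M" "\<tau> h' \<otimes>\<^bsub>M\<^esub> r' \<in> \<Phi>.constant_span" by blast
    have h: "h \<in> carrier L" "h' \<in> carrier L" using generate_field_in_carrier[OF Hc] eng_add by blast+
    have "\<tau> (h \<oplus> h') \<otimes>\<^bsub>M\<^esub> (r \<otimes>\<^bsub>M\<^esub> r') = (\<tau> h \<otimes>\<^bsub>M\<^esub> r) \<otimes>\<^bsub>M\<^esub> r' \<oplus>\<^bsub>M\<^esub> (\<tau> h' \<otimes>\<^bsub>M\<^esub> r') \<otimes>\<^bsub>M\<^esub> r"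
      using h M.Units_closed[OF r(2)] M.Units_closed[OF r(5)] by (simp add: M.r_distr M.m_ac)
    then have "\<tau> (h \<oplus> h') \<otimes>\<^bsub>M\<^esub> (r \<otimes>\<^bsub>M\<^esub> r') \<in> \<Phi>.constant_span"
      using r \<Phi>.constant_span_add \<Phi>.constant_span_mult by simp
    then show ?case using r \<Phi>.constant_span_mult by (intro bexI[of _ "r \<otimes>\<^bsub>M\<^esub> r'"]) auto
  next
    case (eng_mult h h')
    then obtain r r' where r: "r \<in> \<Phi>.constant_span" "r \<in> Units M" "\<tau> h \<otimes>\<^bsub>M\<^esub> r \<in> \<Phi>.constant_span"
      "r' \<in> \<Phi>.constant_span" "r' \<in> Units M" "\<tau> h' \<otimes>\<^bsub>M\<^esub> r' \<in> \<Phi>.constant_span" by blast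
    have h: "h \<in> carrier L" "h' \<in> carrier L" using generate_field_in_carrier[OF Hc] eng_mult by blast+
    have "\<tau> (h \<otimes> h') \<otimes>\<^bsub>M\<^esub> (r \<otimes>\<^bsub>M\<^esub> r') = (\<tau> h \<otimes>\<^bsub>M\<^esub> r) \<otimes>\<^bsub>M\<^esub> (\<tau> h' \<otimes>\<^bsub>M\<^esub> r')"
      using h M.Units_closed[OF r(2)] M.Units_closed[OF r(5)] by (simp add: M.m_ac)
    then have "\<tau> (h \<otimes> h') \<otimes>\<^bsub>M\<^esub> (r \<otimes>\<^bsub>M\<^esub> r') \<in> \<Phi>.constant_span"
      using r \<Phi>.constant_span_mult by simp
    then show ?case using r \<Phi>.constant_span_mult by (intro bexI[of _ "r \<otimes>\<^bsub>M\<^esub> r'"]) auto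
  qed
  then show ?thesis
    unfolding H_def gen using T.hom_closed \<Phi>.mem_compositumI by blast
qed

text \<open>By the sum, product and quotient rules \<delta> has to be controlled on generators only.
  This links generation as a field, as required of a Picard-Vessiot extension, with differential
  generation.\<close>

lemma generate_field_der:
  assumes H: "H \<subseteq> carrier L" and der: "\<And>h. h \<in> H \<Longrightarrow> \<delta> h \<in> generate_field L H"
  shows "differential_subfield (generate_field L H) L"
  unfolding differential_subfield_def
proof (intro conjI ballI)
  show "subfield (generate_field L H) L" by (rule generate_field_is_subfield[OF H])
  note F = subringE[OF subfieldE(1)[OF this]]
  note carrier = generate_field_in_carrier[OF H]
  show "\<delta> h \<in> generate_field L H" if "h \<in> generate_field L H" for h
    using that
  proof induction
    case (m_inv h)
    then have "h \<in> Units L" using carrier by (simp add: field_Units)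
    then show ?case
      unfolding der_inv[OF \<open>h \<in> Units L\<close>] using m_inv by (intro F(5,6) generate_field.m_inv)
  qed (auto simp: F der der_minus der_add der_mult carrier)
qed

end

text \<open>Once an invertible solution matrix Y is found, K(Y) is all of L: it contains y and hence
  the module W, so also the quotients of elements of W that generate L differentially, and it is
  closed under \<delta> because Y' = A Y.\<close>

lemma (in tensor_square) picard_vessiot_if_compositum:
  assumes comp: "\<tau> ` carrier L \<subseteq> compositum M (\<phi> ` carrier L) (constants M)"
    and fin: "finitely_diff_generated L K"
    and const: "constants L = constants (L\<lparr>carrier := K\<rparr>)"
  shows "picard_vessiot L K"
proof -
  have constK: "constants L \<subseteq> K" unfolding const by (auto simp: constants_def)
  obtain S where S: "finite S" "S \<subseteq> carrier L" "generate_diff_field L (K \<union> S) = carrier L"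
    using fin by (auto simp: finitely_diff_generated_def)
  \<comment> \<open>One module serves all generators, since enlarging it keeps the quotients already
    obtained.\<close>
  have "\<exists>W. diff_module W \<and> K \<subseteq> W \<and> (\<forall>a\<in>S. \<exists>s\<in>W. \<exists>t\<in>W. t \<noteq> \<zero> \<and> a \<otimes> t = s)"
    using S(1,2)
  proof (induction S)
    case empty
    then show ?case using diff_module_K by auto
  next
    case (insert a S)
    then obtain W where W: "diff_module W" "K \<subseteq> W" "\<forall>a\<in>S. \<exists>s\<in>W. \<exists>t\<in>W. t \<noteq> \<zero> \<and> a \<otimes> t = s"
      by auto
    obtain U s t where U: "diff_module U" "s \<in> U" "t \<in> U" "t \<noteq> \<zero>" "a \<otimes> t = s"
      using quotient_of_diff_module[of a] insert.prems comp by blast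
    obtain V where V: "diff_module V" "U \<subseteq> V" "W \<subseteq> V"
      using diff_module_sum[OF U(1) W(1)] by blast
    then show ?case using W(2,3) U(2-5) by (intro exI[of _ V]) (auto, (meson subsetD)+)
  qed
  then obtain W where W: "diff_module W" "K \<subseteq> W" and quot: "\<And>a. a \<in> S \<Longrightarrow> \<exists>s\<in>W. \<exists>t\<in>W. t \<noteq> \<zero> \<and> a \<otimes> t = s"
    by blast
  obtain Us where Us: "set Us \<subseteq> carrier L" "independent K Us" "Span K Us = W"
    by (rule diff_module_base[OF W(1)])
  define n where "n = length Us"
  define y where "y i = Us ! i" for i
  have yU: "y i \<in> set Us" if "i < n" for i using that by (simp add: y_def n_def)
  have y: "y i \<in> carrier L" and yW: "y i \<in> W" if "i < n" for i
    using subsetD[OF Us(1) yU[OF that]]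
      subsetD[OF Span_base_incl[OF subfield_K Us(1), unfolded Us(3)] yU[OF that]] .
  have W_comb: "\<exists>k. (\<forall>i<n. k i \<in> K) \<and> x = (\<Oplus>i\<in>{..<n}. k i \<otimes> y i)" if x: "x \<in> W" for x
  proof -
    obtain Ks where Ks: "set Ks \<subseteq> K" "length Ks = length Us" "x = combine Ks Us"
      using x Span_mem_iff_length_version[OF subfield_K Us(1), of x, unfolded Us(3)] by auto
    have "combine Ks Us = (\<Oplus>i\<in>{..<n}. Ks ! i \<otimes> y i)"
      unfolding n_def y_def using Ks(1,2) Us(1) K_carrier by (intro combine_eq_finsum) auto
    then show ?thesis using Ks by (intro exI[of _ "\<lambda>i. Ks ! i"]) (auto simp: n_def)
  qed
  have indep: "k i = \<zero>"
    if k: "\<And>i. i < n \<Longrightarrow> k i \<in> K" and "(\<Oplus>i\<in>{..<n}. k i \<otimes> y i) = \<zero>" and i: "i < n" for k i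
  proof -
    let ?Ks = "map k [0..<n]"
    have "set ?Ks \<subseteq> carrier L" using k K_carrier by auto
    then have "combine ?Ks Us = (\<Oplus>i\<in>{..<length Us}. ?Ks ! i \<otimes> Us ! i)"
      using Us(1) by (intro combine_eq_finsum) (auto simp: n_def)
    also have "\<dots> = (\<Oplus>i\<in>{..<n}. k i \<otimes> y i)"
      unfolding n_def[symmetric] using k y K_carrier by (intro finsum_cong') (auto simp: y_def)
    finally have "combine ?Ks Us = \<zero>" using that(2) by simp
    moreover have "set ?Ks \<subseteq> K" using k by auto
    ultimately have "set (take (length Us) ?Ks) \<subseteq> {\<zero>}"
      using independent_imp_trivial_combine[OF subfield_K Us(2)] by blast
    then have "k ` {..<n} \<subseteq> {\<zero>}" by (simp add: n_def lessThan_atLeast0)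
    then show ?thesis using i by blast
  qed
  have "\<forall>i\<in>{..<n}. \<exists>k. (\<forall>p<n. k p \<in> K) \<and> \<delta> (y i) = (\<Oplus>p\<in>{..<n}. k p \<otimes> y p)"
    using W_comb diff_module_der[OF W(1) yW] by blast
  from bchoice[OF this] obtain A where A: "\<And>i p. i < n \<Longrightarrow> p < n \<Longrightarrow> A i p \<in> K"
    and dy: "\<And>i. i < n \<Longrightarrow> \<delta> (y i) = (\<Oplus>p\<in>{..<n}. A i p \<otimes> y p)"
    by auto
  have "\<exists>Y\<in>GL n L. \<forall>j<n. (\<lambda>i. Y i j) \<in> {v. \<Phi>.solution n A v}"
  proof (rule exists_invertible_columns)
    show "v i \<in> carrier L" if "v \<in> {v. \<Phi>.solution n A v}" "i < n" for v i
      using that by (auto simp: \<Phi>.solution_def)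
    fix f i assume f: "\<And>i. i < n \<Longrightarrow> f i \<in> carrier L"
      "\<And>v. v \<in> {v. \<Phi>.solution n A v} \<Longrightarrow> (\<Oplus>i\<in>{..<n}. f i \<otimes> v i) = \<zero>" and i: "i < n"
    show "f i = \<zero>"
    proof (rule no_annihilator_of_solutions[of n y A f i])
      show "k i = \<zero>" if "\<And>i. i < n \<Longrightarrow> k i \<in> K" "(\<Oplus>i\<in>{..<n}. k i \<otimes> y i) = \<zero>" "i < n" for k i
        by (rule indep[OF that])
    qed (use y A dy comp f i in auto)
  qed
  then obtain Y where Y: "Y \<in> GL n L" and sol: "\<And>j. j < n \<Longrightarrow> \<Phi>.solution n A (\<lambda>i. Y i j)"
    by auto
  obtain Z where Yc: "mat_entries_in n (carrier L) Y" and Zc: "mat_entries_in n (carrier L) Z"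
    and YZ: "mat_eq n (mat_prod L n Y Z) (mat_one L)" and ZY: "mat_eq n (mat_prod L n Z Y) (mat_one L)"
    using Y by (auto simp: GL_def)
  have AK: "mat_entries_in n K A" using A by (simp add: mat_entries_in_def)
  then have Ac: "mat_entries_in n (carrier L) A" using K_carrier by (simp add: mat_entries_in_def)
  have dY: "mat_eq n (\<lambda>i j. \<delta> (Y i j)) (mat_prod L n A Y)"
    using sol by (simp add: mat_eq_def mat_prod_def \<Phi>.solution_def)
  \<comment> \<open>The basis y is itself a solution, hence a combination of the columns of Y with
    constants of L. As there are no new constants, these lie in K, so the entries of y lie in
    K(Y).\<close>
  obtain w where w: "\<And>i. i < n \<Longrightarrow> w i \<in> constants L"
    "\<And>i. i < n \<Longrightarrow> y i = (\<Oplus>p\<in>{..<n}. Y i p \<otimes> w p)"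
    using fundamental_matrix[OF Ac Yc Zc YZ ZY dY y dy] by blast
  define H where "H = K \<union> {Y i j |i j. i < n \<and> j < n}"
  define F where "F = generate_field L H"
  have Hc: "H \<subseteq> carrier L" using K_carrier Yc by (auto simp: H_def mat_entries_in_def)
  have subF: "subfield F L" unfolding F_def by (rule generate_field_is_subfield[OF Hc])
  note Fring = subfieldE(1)[OF subF]
  have HF: "h \<in> F" if "h \<in> H" for h using that by (auto simp: F_def intro: generate_field.incl)
  have KF: "k \<in> F" if "k \<in> K" for k using that HF by (simp add: H_def)
  have YF: "Y i j \<in> F" if "i < n" "j < n" for i j using that by (intro HF) (auto simp: H_def)
  have yF: "y i \<in> F" if "i < n" for i
    unfolding w(2)[OF that]
    by (intro subring_finsum_closed[OF Fring] subringE(6)[OF Fring])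
      (use YF KF[OF subsetD[OF constK w(1)]] that in auto)
  have WF: "x \<in> F" if "x \<in> W" for x
  proof -
    obtain k where k: "\<forall>i<n. k i \<in> K" "x = (\<Oplus>i\<in>{..<n}. k i \<otimes> y i)" using W_comb[OF \<open>x \<in> W\<close>] by blast
    show ?thesis unfolding k(2)
      by (intro subring_finsum_closed[OF Fring] subringE(6)[OF Fring]) (use k yF KF in auto)
  qed
  have SF: "a \<in> F" if a: "a \<in> S" for a
  proof -
    obtain s t where st: "s \<in> W" "t \<in> W" "t \<noteq> \<zero>" "a \<otimes> t = s" using quot[OF a] by blast
    have t: "t \<in> F - {\<zero>}" "t \<in> carrier L" using WF st diff_module_carrier[OF W(1)] by auto
    note inv = subfield_m_inv[OF subF t(1)]
    have "a = (a \<otimes> t) \<otimes> inv t"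
      using a S(2) t inv subringE(1)[OF Fring] by (simp add: m_assoc subset_iff)
    also have "\<dots> \<in> F" using WF[OF st(1)] inv(1) subringE(6)[OF Fring] by (simp add: st(4))
    finally show ?thesis .
  qed
  have "differential_subfield F L"
    unfolding F_def
  proof (rule generate_field_der[OF Hc])
    fix h assume "h \<in> H"
    then consider "h \<in> K" | i j where "h = Y i j" "i < n" "j < n" by (auto simp: H_def)
    then show "\<delta> h \<in> generate_field L H"
      unfolding F_def[symmetric]
    proof cases
      case 1
      then show "\<delta> h \<in> F" using der_K KF by blast
    next
      case 2
      then have "\<delta> h = (\<Oplus>p\<in>{..<n}. A i p \<otimes> Y p j)"
        using dY by (simp add: mat_eq_def mat_prod_def)
      also have "\<dots> \<in> F"
        by (intro subring_finsum_closed[OF Fring] subringE(6)[OF Fring]) (use 2 YF KF A in auto)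
      finally show "\<delta> h \<in> F" .
    qed
  qed
  then have "generate_diff_field L (K \<union> S) \<subseteq> F"
    unfolding generate_diff_field_def using KF SF by (intro Inter_lower) auto
  then have "F = carrier L" using S(3) subringE(1)[OF Fring] by auto
  \<comment> \<open>An empty basis would make W zero, although it contains 1.\<close>
  moreover have "n \<ge> 1"
  proof (rule ccontr)
    assume "\<not> n \<ge> 1"
    then have "Us = []" by (cases Us) (auto simp: n_def)
    then have "W = {\<zero>}" using Us(3) by simp
    then show False using W(2) K_closed(3) one_not_zero by auto
  qed
  ultimately show ?thesis
    unfolding picard_vessiot_def using const AK Y dY unfolding F_def H_def by blast
qed

theorem theorem1p3:
  fixes L :: "'l diff_ring" and K :: "'l set"
  assumes "differential_field L"
    and "differential_subfield K L"
    and "char_zero (L\<lparr>carrier := K\<rparr>)"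
    and "algebraically_closed (L\<lparr>carrier := constants (L\<lparr>carrier := K\<rparr>)\<rparr>)"
    and "finitely_diff_generated L K"
    and "constants L = constants (L\<lparr>carrier := K\<rparr>)"
    and universe: "\<exists>\<iota> :: 'l \<Rightarrow> 'm. inj_on \<iota> (carrier L)"
  shows "picard_vessiot L K \<longleftrightarrow>
    (\<forall>(M :: 'm diff_ring) \<phi> \<tau>.
       differential_algebra L M \<phi> \<longrightarrow> differential_embedding_over K L M \<phi> \<tau> \<longrightarrow>
       \<tau> ` carrier L \<subseteq> compositum M (\<phi> ` carrier L) (constants M))"
proof -
  interpret differential_field L by fact
  interpret differential_extension L K
    using assms(1,2) by (simp add: differential_extension_def differential_extension_axioms_def)
  \<comment> \<open>In characteristic zero the multiples of 1 are distinct; this is what lets the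
    tensor square fit into \<open>'m\<close>.\<close>
  have "infinite (carrier L)"
  proof
    assume fin: "finite (carrier L)"
    define e where "e n = [n] \<cdot>\<^bsub>L\<^esub> \<one>\<^bsub>L\<^esub>" for n :: nat
    have c: "e n \<in> carrier L" for n by (simp add: e_def)
    then have "\<not> inj e"
      using fin by (meson finite_imageD finite_subset image_subsetI infinite_UNIV_nat)
    then obtain m n where mn: "m < n" "e m = e n"
      unfolding inj_def by (metis linorder_neq_iff)
    have "e m \<oplus>\<^bsub>L\<^esub> e (n - m) = e m"
      using add.nat_pow_mult[of "\<one>\<^bsub>L\<^esub>" m "n - m"] mn by (simp add: e_def)
    then have "e (n - m) = \<zero>\<^bsub>L\<^esub>" using c by (simp add: add.l_cancel_one)
    moreover have "[(n - m)] \<cdot>\<^bsub>L\<lparr>carrier := K\<rparr>\<^esub> \<one>\<^bsub>L\<^esub> = e (n - m)"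
      by (simp add: e_def add_pow_def nat_pow_def)
    ultimately show False using assms(3) mn(1) unfolding char_zero_def by auto
  qed
  then obtain j :: "('l \<times> 'l) list \<Rightarrow> 'm" where "inj_on j tensors"
    using infinite_pair_lists_inject universe unfolding tensors_def by blast
  then obtain M :: "'m diff_ring" and q where "tensor_square L K M q"
    using exists_tensor_square by blast
  then interpret T: tensor_square L K M q .
  \<comment> \<open>One direction holds for every M; the other applies the condition to the tensor
    square alone.\<close>
  show ?thesis
    using picard_vessiot_imp_compositum T.picard_vessiot_if_compositum
      T.differential_algebra_M T.embedding_\<tau> assms(5,6) by blast
qed

end
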